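(* Let $L_1$ be an analytic Jordan curve, $h$ a positive analytic weight on $L_1$, and let $P_n$, $\gamma_n$, $\phi$, $\Delta_e$, $\Delta_i$, $\rho$, $\Omega_s$, $G_s$, $L_s$ and $W$ be as defined in the context. Let $r_1$ be such that $\rho<r_1<1/\rho$. Then for every $r>\rho$, $$\gamma_n=\Delta_e(\infty)[\phi'(\infty)]^{n+1/2}\left\{1+\mathcal{O}\left(r^{2n}\right)\right\},$$ $$P_n(z)=\frac{\Delta_e(z)\sqrt{\phi'(z)}\,[\phi(z)]^n}{\Delta_e(\infty)[\phi'(\infty)]^{n+1/2}}\left\{1+\mathcal{O}\left(\frac{r^n}{r_1^n}\right)\right\},\quad z\in\overline{\Omega}_{r_1}.$$ If $\rho<r_1<1$, then (again for every $r>\rho$) $$\frac{\Delta_e(\infty)P_n(z)}{[\phi'(\infty)]^{-n-1/2}}=\frac{\Delta_i(z)^{-1}}{2\pi i}\oint_{L_1}\Delta_e(\zeta)\Delta_i(\zeta)W(\zeta,z)\sqrt{\phi'(\zeta)}\,[\phi(\zeta)]^nd\zeta+\mathcal{O}\left(r_1^nr^{2n}\right),\quad z\in\overline{G}_{r_1}.$$ The last two displayed equalities hold uniformly in $z$ (on $\overline{\Omega}_{r_1}$, respectively $\overline{G}_{r_1}$) as $n\to\infty$.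
   Context: Notation: $\mathbb{E}_s=\{w: s<|w|\le\infty\}$, $\mathbb{D}_s=\{|w|<s\}$. A function is called analytic on a closed set if it is analytic on a neighborhood of it (possibly after analytic continuation). Contours are positively oriented. Orthogonal polynomials. $L_1$ is an analytic Jordan curve in $\mathbb{C}$ and $h$ is analytic in a neighborhood of $L_1$ with $h(z)>0$ for all $z\in L_1$. $p_n(z)=\gamma_nz^n+\cdots$, $\gamma_n>0$, $n\ge0$, are the orthonormal polynomials: $\frac{1}{2\pi}\oint_{L_1}p_n(z)\overline{p_m(z)}h(z)|dz|=\delta_{nm}$. $P_n=\gamma_n^{-1}p_n$ is the monic orthogonal polynomial. Exterior map. $\Omega_1$ is the unbounded component of $\overline{\mathbb{C}}\setminus L_1$; $\psi$ is the conformal map of $\mathbb{E}_1$ onto $\Omega_1$ with $\psi(\infty)=\infty$, $\psi'(\infty)>0$. $\widehat\rho\ge0$ is the smallest number such that $\psi$ has an analytic and univalent continuation to $\mathbb{E}_{\widehat\rho}$ (so $\widehat\rho<1$). For $\widehat\rho\le s<\infty$: $\Omega_s=\psi(\mathbb{E}_s)$, $L_s=\partial\Omega_s$, $G_s=\mathbb{C}\setminus\overline{\Omega}_s$. $\phi:\Omega_{\widehat\rho}\to\mathbb{E}_{\widehat\rho}$ is the inverse of $\psi$; $\sqrt{\phi'}$ is the analytic branch on $\Omega_{\widehat\rho}$ with $\sqrt{\phi'(\infty)}>0$. The Schwarz reflection about $L_1$ is $z^*=\psi\big(1/\overline{\phi(z)}\big)$, $z\in\Omega_{\widehat\rho}\cap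 G_{1/\widehat\rho}$ (with $1/0=\infty$, $G_\infty=\mathbb{C}$). Szegő functions. The exterior Szegő function $\Delta_e$ for $h$ is the unique function analytic and never zero on $\overline{\Omega}_1$ with $\Delta_e(\infty)>0$ and $|\Delta_e(z)|^{-2}=h(z)$ on $L_1$. An interior Szegő function $\Delta_i$ is a function analytic and never zero on $\overline{G}_1$ with $|\Delta_i(z)|^2=h(z)$ on $L_1$; it is unique up to a multiplicative constant of modulus 1, and one is fixed. $\rho$ is the smallest number $\ge\widehat\rho$ such that $\Delta_e$ is analytic on $\Omega_\rho$ (so $\widehat\rho\le\rho<1$; if $\rho=0$ then $1/\rho=\infty$). Kernel. For a conformal map $\varphi$ of $G_1$ onto $\mathbb{D}_1$, $W(\zeta,z)=\frac{\sqrt{\varphi'(z)}\sqrt{\varphi'(\zeta)}}{\varphi(\zeta)-\varphi(z)}$, $\zeta,z\in G_1$ (same branch of $\sqrt{\varphi'}$ in both factors); it does not depend on the choice of $\varphi$. Choosing $\varphi$ with no zero in $\Omega_{\widehat\rho}\cap G_1$, $\varphi$ extends analytically and univalently to $G_{1/\widehat\rho}$ by $\varphi(z)=1/\overline{\varphi(z^* )}$, $z\in G_{1/\widehat\rho}\setminus\overline{G}_1$, and so $W$ extends by the same formula to $G_{1/\widehat\rho}\times G_{1/\widehat\rho}$ (in particular to $\zeta\in L_1$, $z\in G_1$); for fixed $z$ it is analytic in $\zeta\ne z$ with a simple pole at $\zeta=z$ of residue 1. The formula for $P_n$ on $\overline\Omega_{r_1}$ is understood for finite $z$ (at $\infty$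 as a limit of the ratio of both sides). Implied constants may depend on $L_1,h,r,r_1$ but not on $n$ or $z$.
   Formalization: The formula for P_n fails at zeros of Δ_e in Ω_ρ∩G_1; it is proved with Δ_e(z){1+O(r^n/r_1^n)} replaced by Δ_e(z)+O(r^n/r_1^n) on all of closure(Ω_{r_1}), and as printed, uniformly, on each closed subset of it free of zeros of Δ_e. *)

theory Defs
  imports "HOL-Complex_Analysis.Complex_Analysis" "HOL-Library.Landau_Symbols"
begin

text \<open>
  Conventions.  Subsets of the Riemann sphere that contain \<open>\<infinity>\<close> (\<open>E\<^sub>s\<close>, \<open>\<Omega>\<^sub>s\<close>) are
  represented by their finite parts.  A function is analytic at \<open>\<infinity>\<close> iff it is holomorphic near
  \<open>\<infinity>\<close> and has a finite limit there, so analyticity on such a set is holomorphy on the finite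
  part together with a limit along \<^term>\<open>at_infinity\<close>.  An analytic function and its
  analytic continuation are denoted by the same total function; values outside the domain of
  the continuation are irrelevant.
\<close>

definition analytic_jordan_path :: "(real \<Rightarrow> complex) \<Rightarrow> bool" where
  "analytic_jordan_path c \<longleftrightarrow>
     (\<exists>F U. open U \<and> sphere 0 1 \<subseteq> U \<and> F holomorphic_on U \<and> inj_on F U \<and>
            (\<forall>t\<in>{0..1}. c t = F (exp (2 * of_real pi * \<i> * of_real t))))"

definition positively_oriented :: "(real \<Rightarrow> complex) \<Rightarrow> bool" where
  "positively_oriented c \<longleftrightarrow> (\<forall>z\<in>inside (path_image c). winding_number c z = 1)"

definition arclength_integral :: "(real \<Rightarrow> complex) \<Rightarrow> (complex \<Rightarrow> complex) \<Rightarrow> complex" where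
  "arclength_integral c f =
     integral {0..1} (\<lambda>t. f (c t) * of_real (norm (vector_derivative c (at t within {0..1}))))"

definition positive_analytic_weight :: "(real \<Rightarrow> complex) \<Rightarrow> (complex \<Rightarrow> complex) \<Rightarrow> bool" where
  "positive_analytic_weight c h \<longleftrightarrow>
     h analytic_on path_image c \<and> (\<forall>z\<in>path_image c. h z \<in> \<real> \<and> 0 < Re (h z))"

definition orthonormal_polys ::
  "(real \<Rightarrow> complex) \<Rightarrow> (complex \<Rightarrow> complex) \<Rightarrow> (nat \<Rightarrow> complex poly) \<Rightarrow> (nat \<Rightarrow> real) \<Rightarrow> bool" where
  "orthonormal_polys c h p lc \<longleftrightarrow>
     (\<forall>n. degree (p n) = n \<and> lead_coeff (p n) = of_real (lc n) \<and> 0 < lc n) \<and>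
     (\<forall>n m. 1 / (2 * of_real pi) *
              arclength_integral c (\<lambda>z. poly (p n) z * cnj (poly (p m) z) * h z)
            = (if n = m then 1 else 0))"

definition pos_at_inf :: "(complex \<Rightarrow> complex) \<Rightarrow> bool" where
  "pos_at_inf f \<longleftrightarrow> (\<exists>x::real. 0 < x \<and> (f \<longlongrightarrow> of_real x) at_infinity)"

text \<open>Only used for functions whose limit at \<open>\<infinity>\<close> exists and is real.\<close>
definition value_at_inf :: "(complex \<Rightarrow> complex) \<Rightarrow> real" where
  "value_at_inf f = Re (Lim at_infinity f)"

definition Ext :: "real \<Rightarrow> complex set" where
  "Ext s = {w. s < norm w}"

definition Om :: "(complex \<Rightarrow> complex) \<Rightarrow> real \<Rightarrow> complex set" where
  "Om \<psi> s = \<psi> ` Ext s"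

definition Gd :: "(complex \<Rightarrow> complex) \<Rightarrow> real \<Rightarrow> complex set" where
  "Gd \<psi> s = - closure (Om \<psi> s)"

text \<open>\<open>G\<close> at level \<open>1/s\<close>, with the conventions \<open>1/0 = \<infinity>\<close> and \<open>G\<^sub>\<infinity> = \<complex>\<close>.\<close>
definition Gd_recip :: "(complex \<Rightarrow> complex) \<Rightarrow> real \<Rightarrow> complex set" where
  "Gd_recip \<psi> s = (if s = 0 then UNIV else Gd \<psi> (1 / s))"

text \<open>The derivative at \<open>\<infinity>\<close> of a map fixing \<open>\<infinity>\<close> is the limit of its derivative.\<close>
definition exterior_map :: "(real \<Rightarrow> complex) \<Rightarrow> (complex \<Rightarrow> complex) \<Rightarrow> bool" where
  "exterior_map c \<psi> \<longleftrightarrow>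
     \<psi> holomorphic_on Ext 1 \<and> inj_on \<psi> (Ext 1) \<and> \<psi> ` Ext 1 = outside (path_image c) \<and>
     filterlim \<psi> at_infinity at_infinity \<and> pos_at_inf (deriv \<psi>)"

definition univalence_radius :: "(complex \<Rightarrow> complex) \<Rightarrow> real \<Rightarrow> bool" where
  "univalence_radius \<psi> \<rho>' \<longleftrightarrow>
     0 \<le> \<rho>' \<and> \<psi> holomorphic_on Ext \<rho>' \<and> inj_on \<psi> (Ext \<rho>') \<and>
     (\<forall>s\<ge>0. (\<exists>g. g holomorphic_on Ext s \<and> inj_on g (Ext s) \<and> (\<forall>w\<in>Ext s \<inter> Ext 1. g w = \<psi> w))
             \<longrightarrow> \<rho>' \<le> s)"

definition phi :: "(complex \<Rightarrow> complex) \<Rightarrow> real \<Rightarrow> complex \<Rightarrow> complex" where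
  "phi \<psi> \<rho>' = inv_into (Ext \<rho>') \<psi>"

definition sqrt_dphi :: "(complex \<Rightarrow> complex) \<Rightarrow> real \<Rightarrow> (complex \<Rightarrow> complex) \<Rightarrow> bool" where
  "sqrt_dphi \<psi> \<rho>' q \<longleftrightarrow>
     q holomorphic_on Om \<psi> \<rho>' \<and> (\<forall>z\<in>Om \<psi> \<rho>'. (q z)\<^sup>2 = deriv (phi \<psi> \<rho>') z) \<and> pos_at_inf q"

definition schwarz_reflection :: "(complex \<Rightarrow> complex) \<Rightarrow> real \<Rightarrow> complex \<Rightarrow> complex" where
  "schwarz_reflection \<psi> \<rho>' z = \<psi> (1 / cnj (phi \<psi> \<rho>' z))"

definition exterior_szego ::
  "(real \<Rightarrow> complex) \<Rightarrow> (complex \<Rightarrow> complex) \<Rightarrow> (complex \<Rightarrow> complex) \<Rightarrow> (complex \<Rightarrow> complex) \<Rightarrow> bool" where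
  "exterior_szego c h \<psi> De \<longleftrightarrow>
     De analytic_on closure (Om \<psi> 1) \<and> (\<forall>z\<in>closure (Om \<psi> 1). De z \<noteq> 0) \<and> pos_at_inf De \<and>
     (\<forall>z\<in>path_image c. of_real (1 / (norm (De z))\<^sup>2) = h z)"

definition interior_szego ::
  "(real \<Rightarrow> complex) \<Rightarrow> (complex \<Rightarrow> complex) \<Rightarrow> (complex \<Rightarrow> complex) \<Rightarrow> (complex \<Rightarrow> complex) \<Rightarrow> bool" where
  "interior_szego c h \<psi> Di \<longleftrightarrow>
     Di analytic_on closure (Gd \<psi> 1) \<and> (\<forall>z\<in>closure (Gd \<psi> 1). Di z \<noteq> 0) \<and>
     (\<forall>z\<in>path_image c. of_real ((norm (Di z))\<^sup>2) = h z)"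

text \<open>Only analyticity of \<open>De\<close> enters here: \<open>De\<close> may have zeros in \<open>\<Omega>\<^sub>\<rho> \<inter> G\<^sub>1\<close>.\<close>
definition szego_radius ::
  "(complex \<Rightarrow> complex) \<Rightarrow> real \<Rightarrow> (complex \<Rightarrow> complex) \<Rightarrow> real \<Rightarrow> bool" where
  "szego_radius \<psi> \<rho>' De \<rho> \<longleftrightarrow>
     \<rho>' \<le> \<rho> \<and> De holomorphic_on Om \<psi> \<rho> \<and>
     (\<forall>s\<ge>\<rho>'. (\<exists>g. g holomorphic_on Om \<psi> s \<and> (\<forall>z\<in>Om \<psi> s \<inter> Om \<psi> 1. g z = De z)) \<longrightarrow> \<rho> \<le> s)"

text \<open>\<open>f\<close> is a conformal map of \<open>G\<^sub>1\<close> onto the unit disk without zeros in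
  \<open>\<Omega>\<close> at level \<open>\<rho>'\<close>, extended across the curve by reflection, and \<open>q\<close> is a branch of
  the square root of its derivative.\<close>
definition interior_map ::
  "(complex \<Rightarrow> complex) \<Rightarrow> real \<Rightarrow> (complex \<Rightarrow> complex) \<Rightarrow> (complex \<Rightarrow> complex) \<Rightarrow> bool" where
  "interior_map \<psi> \<rho>' f q \<longleftrightarrow>
     f holomorphic_on Gd_recip \<psi> \<rho>' \<and> inj_on f (Gd_recip \<psi> \<rho>') \<and>
     f ` Gd \<psi> 1 = ball 0 1 \<and> (\<forall>z\<in>Om \<psi> \<rho>' \<inter> Gd \<psi> 1. f z \<noteq> 0) \<and>
     (\<forall>z\<in>Gd_recip \<psi> \<rho>' - closure (Gd \<psi> 1). f z = 1 / cnj (f (schwarz_reflection \<psi> \<rho>' z))) \<and>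
     q holomorphic_on Gd_recip \<psi> \<rho>' \<and> (\<forall>z\<in>Gd_recip \<psi> \<rho>'. (q z)\<^sup>2 = deriv f z)"

definition W_kernel ::
  "(complex \<Rightarrow> complex) \<Rightarrow> (complex \<Rightarrow> complex) \<Rightarrow> complex \<Rightarrow> complex \<Rightarrow> complex" where
  "W_kernel f q \<zeta> z = q z * q \<zeta> / (f \<zeta> - f z)"

definition uniform_bigo :: "complex set \<Rightarrow> (nat \<Rightarrow> complex \<Rightarrow> complex) \<Rightarrow> (nat \<Rightarrow> real) \<Rightarrow> bool" where
  "uniform_bigo A E g \<longleftrightarrow> (\<exists>C. \<forall>\<^sub>F n in sequentially. \<forall>z\<in>A. norm (E n z) \<le> C * g n)"

text \<open>
  Error terms in the expansion of \<open>P\<^sub>n\<close> on the closure of \<open>\<Omega>\<^sub>s\<close>, \<open>\<rho> < s\<close>.  For \<open>s < 1\<close>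
  the function \<open>De\<close> may vanish there, whereas \<open>P\<^sub>n\<close> need not vanish at the zeros of \<open>De\<close>.
  Example: on the unit circle with \<open>h = |z - b|\<^sup>2 / |z - a|\<^sup>2\<close> and \<open>0 < |b| < |a| < 1\<close>, one has
  \<open>De = (z - a) / (z - b)\<close> and \<open>\<rho> = |b|\<close>, but \<open>P\<^sub>n(a) \<noteq> 0\<close> for all \<open>n\<close>.  A multiplicative error
  \<open>De(z) (1 + O(\<dots>))\<close> is therefore correct only off the zeros of \<open>De\<close>, while
  \<open>De(z) + O(\<dots>)\<close> is correct on the whole closure.  The two forms agree uniformly on closed
  sets free of zeros of \<open>De\<close>, such as the whole closure of \<open>\<Omega>\<^sub>s\<close> when \<open>s \<ge> 1\<close>.
\<close>

end

(* Let B_n = De sqrt(phi') phi^n and let F_n be its polynomial part at infinity. On the curve the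
   weight and arc length are such that pairing a function u with B_n is the contour integral of
   u sqrt(phi') / (De phi^(n+1)), which for u analytic outside only sees u at infinity. Hence B_n is
   a unit vector orthogonal to all polynomials of lower degree, and R_n = F_n - B_n is orthogonal to
   every B_k. Cauchy's formula on a level curve inside the domain of De gives R_n = O(s^n) for every
   s > rho. Comparing norms of F_n and P_n yields the asymptotics of gamma_n and the distance
   O(s^k) between p_k and the line of B_k; therefore <R_n, p_k> = O(s^(n+k)), and expanding
   F_n in the p_k gives the exterior asymptotics. The interior formula is the Szego projection of
   B_n = F_n - R_n; it fixes F_n and maps R_n to the full series of <R_n, p_k> p_k, so its difference
   from the multiple of P_n is the tail of that series over k >= n. *)
theory Submission
  imports Defs
begin

subsection \<open>Holomorphic functions near infinity\<close>

text \<open>The \<open>p k\<close> have to be bounded before their asymptotics are known. Only their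
  norm on the curve is at hand; Cauchy's formula for \<open>p k / B k\<close> outside the curve
  turns it into growth \<open>t ^ k\<close> on a level \<open>t > 1\<close>. Against coefficients of
  size \<open>s ^ (n + k)\<close> the expansion of \<open>Fp n\<close> then converges geometrically
  once \<open>s * t < 1\<close>. The levels reached in this way are those below
  \<open>1 / \<rho>\<close>, whence the upper bound on the level in the theorem. The interior
  formula meets another obstacle: \<open>R n\<close> need not continue analytically to the whole
  inside of the curve, so its orthogonal series represents a projection of it and not
  \<open>R n\<close> itself. The difference is orthogonal to all polynomials, and the kernel must be
  shown not to see it. On the curve the kernel is, up to factors, the conjugate of a function
  analytic across the curve; pushing a Cauchy integral for that function outwards reaches the region
  where the transform of the difference vanishes. \<open>De\<close> may have zeros between the level
  \<open>\<rho>\<close> and the curve. Division by \<open>De\<close> is therefore confined to the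
  set where it does not vanish, which still contains the curve and its exterior.\<close>

lemma tendsto_at_infinity_cong_ne:
  fixes f g :: "complex \<Rightarrow> complex"
  assumes "(f \<longlongrightarrow> l) at_infinity" "\<And>z. z \<noteq> 0 \<Longrightarrow> z \<noteq> c \<Longrightarrow> f z = g z"
  shows "(g \<longlongrightarrow> l) at_infinity"
proof (rule Lim_transform_eventually[OF assms(1)])
  show "eventually (\<lambda>z. f z = g z) at_infinity"
    using eventually_conj[OF eventually_not_equal_at_infinity[of 0] eventually_not_equal_at_infinity[of c]]
    by (rule eventually_mono) (use assms(2) in auto)
qed

text \<open>In the coordinate \<open>1 / z\<close> the point at infinity is a removable singularity,
  and the limit is the derivative there: the next coefficient of the expansion at infinity.\<close>

lemma holomorphic_at_infinity_limit:
  assumes "H holomorphic_on {z. M < norm z}" and "(H \<longlongrightarrow> L) at_infinity"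
  shows "\<exists>L'. ((\<lambda>z. z * (H z - L)) \<longlongrightarrow> L') at_infinity"
proof -
  define m where "m = max M 1"
  define g where "g v = (if v = 0 then L else H (inverse v))" for v
  have m: "m > 0" by (simp add: m_def)
  have lim: "(g \<longlongrightarrow> L) (at 0)"
  proof -
    have "((H \<circ> inverse) \<longlongrightarrow> L) (at 0)"
      using assms(2) lim_at_infinity_0 by blast
    then show ?thesis
      by (rule Lim_transform_eventually) (auto simp: g_def eventually_at_filter)
  qed
  have "g holomorphic_on ball 0 (1/m)"
  proof (rule no_isolated_singularity'[where K = "{0}"])
    fix z :: complex assume "z \<in> {0}"
    then show "(g \<longlongrightarrow> g z) (at z within ball 0 (1/m))"
      using lim by (auto simp: g_def intro: tendsto_within_subset)
  next
    have big: "M < norm (inverse v)" if "v \<in> ball 0 (1/m) - {0}" for v :: complex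
    proof -
      have "norm v < 1/m" "norm v > 0" using that by auto
      then have "m < inverse (norm v)" using m by (simp add: field_simps)
      then show ?thesis by (simp add: m_def norm_inverse less_imp_le)
    qed
    have "(H \<circ> inverse) holomorphic_on ball 0 (1/m) - {0}"
      by (rule holomorphic_on_compose_gen[OF _ assms(1)]) (use big in \<open>auto intro!: holomorphic_intros\<close>)
    then show "g holomorphic_on ball 0 (1/m) - {0}"
      by (rule holomorphic_transform) (auto simp: g_def)
  qed auto
  then have "g field_differentiable at 0"
    using m by (auto intro: holomorphic_on_imp_differentiable_at)
  then have "((\<lambda>h. (g (0 + h) - g 0) / h) \<longlongrightarrow> deriv g 0) (at 0)"
    using DERIV_def DERIV_deriv_iff_field_differentiable by blast
  then have "(((\<lambda>z. z * (H z - L)) \<circ> inverse) \<longlongrightarrow> deriv g 0) (at 0)"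
    by (rule Lim_transform_eventually) (auto simp: g_def eventually_at_filter field_simps)
  then show ?thesis using lim_at_infinity_0 by blast
qed

text \<open>Subtracting the leading term lowers the order of growth by one, because
  \<open>B z / z ^ Suc n\<close> has a next coefficient at infinity. The recursion includes the
  constant term, so the difference tends to 0 and is not merely bounded.\<close>

lemma polynomial_part_at_infinity:
  assumes "B holomorphic_on {z. M < norm z}" and "((\<lambda>z. B z / z ^ n) \<longlongrightarrow> k) at_infinity"
  shows "\<exists>F. degree F \<le> n \<and> coeff F n = k \<and> ((\<lambda>z. poly F z - B z) \<longlongrightarrow> 0) at_infinity"
  using assms
proof (induction n arbitrary: B k)
  case 0
  then have "((\<lambda>z. poly [:k:] z - B z) \<longlongrightarrow> k - k) at_infinity"
    by (intro tendsto_diff) auto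
  then show ?case by (intro exI[of _ "[:k:]"]) auto
next
  case (Suc n)
  define H where "H z = B z / z ^ Suc n" for z
  have "H holomorphic_on {z. max M 0 < norm z}"
    unfolding H_def
    by (intro holomorphic_intros holomorphic_on_subset[OF Suc.prems(1)]) auto
  from holomorphic_at_infinity_limit[OF this Suc.prems(2)[folded H_def]]
  obtain L' where L': "((\<lambda>z. z * (H z - k)) \<longlongrightarrow> L') at_infinity" by blast
  define B2 where "B2 z = B z - k * z ^ Suc n" for z
  have B2: "B2 holomorphic_on {z. M < norm z}"
    unfolding B2_def by (intro holomorphic_intros Suc.prems)
  have "((\<lambda>z. B2 z / z ^ n) \<longlongrightarrow> L') at_infinity"
    by (rule tendsto_at_infinity_cong_ne[OF L']) (auto simp: B2_def H_def field_simps)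
  from Suc.IH[OF B2 this] obtain F where F: "degree F \<le> n" "((\<lambda>z. poly F z - B2 z) \<longlongrightarrow> 0) at_infinity"
    by blast
  have "degree (F + monom k (Suc n)) \<le> Suc n"
    using F(1) by (intro degree_add_le) (auto intro: degree_monom_le order_trans)
  moreover have "coeff (F + monom k (Suc n)) (Suc n) = k"
    using F(1) by (simp add: coeff_eq_0)
  moreover have "((\<lambda>z. poly (F + monom k (Suc n)) z - B z) \<longlongrightarrow> 0) at_infinity"
    using F(2) by (simp add: B2_def poly_monom algebra_simps)
  ultimately show ?case by blast
qed

text \<open>
  The substitution \<open>v = 1 / (z - z0)\<close> turns this into Cauchy's integral formula at \<open>v = 0\<close>.
\<close>
lemma contour_integral_exterior:
  assumes "open S" and vp: "valid_path \<gamma>" and loop: "pathfinish \<gamma> = pathstart \<gamma>"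
    and pS: "path_image \<gamma> \<subseteq> S" and wind: "\<And>x. x \<notin> S \<Longrightarrow> winding_number \<gamma> x = 1"
    and z0: "z0 \<notin> S" and bd: "bounded (- S)" and G: "G holomorphic_on S"
    and lim: "((\<lambda>z. z * G z) \<longlongrightarrow> L) at_infinity"
  shows "(G has_contour_integral 2 * of_real pi * \<i> * L) \<gamma>"
proof -
  define j where "j z = 1 / (z - z0)" for z
  \<comment> \<open>\<open>K v / v\<close> is the pullback of \<open>G\<close> under the
    substitution, as \<open>dz = - dv / v^2\<close>. The value at 0 is the limit of \<open>K\<close>
    there.\<close>
  define K where "K v = (if v = 0 then - L else - G (z0 + 1 / v) / v)" for v
  define T where "T = insert 0 {v. v \<noteq> 0 \<and> z0 + 1 / v \<in> S}"
  have z0p: "z0 \<notin> path_image \<gamma>" using z0 pS by auto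
  have jhol: "j holomorphic_on - {z0}" unfolding j_def by (intro holomorphic_intros) auto
  have jan: "j analytic_on - {z0}" using jhol by (simp add: analytic_on_open open_Compl)
  have vpj: "valid_path (j \<circ> \<gamma>)"
    by (rule valid_path_compose_holomorphic[OF vp jhol]) (use z0p in auto)
  have dj: "deriv j w = - 1 / (w - z0)\<^sup>2" if "w \<noteq> z0" for w
    unfolding j_def by (rule DERIV_imp_deriv) (use that in \<open>auto intro!: derivative_eq_intros simp: power2_eq_square\<close>)
  have comp: "contour_integral (j \<circ> \<gamma>) h = contour_integral \<gamma> (\<lambda>w. deriv j w * h (j w))" for h
    by (rule contour_integral_comp_analyticW[OF jan vp]) (use z0p in auto)
  have inS: "\<gamma> t \<in> S" if "t \<in> {0..1}" for t using pS that by (auto simp: path_image_def)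
  obtain M where M: "M > 0" "\<And>x. norm x > M \<Longrightarrow> x \<in> S"
    using bd unfolding bounded_pos by (metis ComplI not_le)
  have opT0: "open {v. v \<noteq> 0 \<and> z0 + 1 / v \<in> S}"
  proof -
    have "open ((\<lambda>v. z0 + 1 / v) -` S \<inter> (- {0}))"
      by (subst Int_commute, rule continuous_open_preimage) (auto intro!: continuous_intros \<open>open S\<close>)
    moreover have "(\<lambda>v. z0 + 1 / v) -` S \<inter> (- {0}) = {v. v \<noteq> 0 \<and> z0 + 1 / v \<in> S}" by auto
    ultimately show ?thesis by simp
  qed
  have near0: "ball 0 (1 / (M + norm z0)) \<subseteq> T"
  proof
    fix v :: complex assume v: "v \<in> ball 0 (1 / (M + norm z0))"
    show "v \<in> T"
    proof (cases "v = 0")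
      case False
      have pos: "M + norm z0 > 0" using M(1) by (simp add: add_pos_nonneg)
      have "norm v < 1 / (M + norm z0)" "norm v > 0" using v False by auto
      then have "M + norm z0 < 1 / norm v" using pos by (simp add: field_simps)
      moreover have "norm (1 / v) \<le> norm (z0 + 1 / v) + norm z0"
        by (metis add_diff_cancel_left' norm_triangle_ineq4)
      ultimately have "M < norm (z0 + 1 / v)" by (simp add: norm_divide)
      then show ?thesis using False M by (auto simp: T_def)
    qed (simp add: T_def)
  qed
  have Mz: "M + norm z0 > 0" using M(1) by (simp add: add_pos_nonneg)
  have opT: "open T"
  proof -
    have "T = {v. v \<noteq> 0 \<and> z0 + 1 / v \<in> S} \<union> ball 0 (1 / (M + norm z0))"
      using near0 Mz by (auto simp: T_def)
    then show ?thesis using opT0 by auto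
  qed
  have limG: "((\<lambda>z. (z - z0) * G z) \<longlongrightarrow> L) at_infinity"
  proof -
    have "((\<lambda>z. (1 - z0 / z) * (z * G z)) \<longlongrightarrow> (1 - 0) * L) at_infinity"
      by (intro tendsto_intros lim tendsto_divide_0[OF tendsto_const] filterlim_ident)
    then have "((\<lambda>z. (1 - z0 / z) * (z * G z)) \<longlongrightarrow> L) at_infinity" by simp
    then show ?thesis
      by (rule tendsto_at_infinity_cong_ne) (auto simp: field_simps)
  qed
  have fl: "filterlim (\<lambda>v. z0 + inverse v) at_infinity (at 0)"
    by (rule tendsto_add_filterlim_at_infinity[OF tendsto_const filterlim_inverse_at_infinity])
  have limK: "(K \<longlongrightarrow> - L) (at 0)"
  proof -
    have "((\<lambda>v. - ((z0 + inverse v - z0) * G (z0 + inverse v))) \<longlongrightarrow> - L) (at 0)"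
      by (intro tendsto_minus filterlim_compose[OF limG fl])
    then show ?thesis
      by (rule Lim_transform_eventually) (auto simp: K_def eventually_at_filter field_simps)
  qed
  have KT: "K holomorphic_on T"
  proof (rule no_isolated_singularity'[where K = "{0}"])
    fix z :: complex assume "z \<in> {0}"
    then show "(K \<longlongrightarrow> K z) (at z within T)"
      using limK by (auto simp: K_def intro: tendsto_within_subset)
  next
    have "(\<lambda>v. - G (z0 + 1 / v) / v) holomorphic_on T - {0}"
      by (intro holomorphic_intros holomorphic_on_compose_gen[OF _ G, unfolded o_def]) (auto simp: T_def)
    then show "K holomorphic_on T - {0}" by (rule holomorphic_transform) (auto simp: K_def)
  qed (auto simp: opT)
  have jT: "path_image (j \<circ> \<gamma>) \<subseteq> T - {0}"
  proof
    fix v assume "v \<in> path_image (j \<circ> \<gamma>)"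
    then obtain t where t: "t \<in> {0..1}" "v = j (\<gamma> t)" by (auto simp: path_image_def)
    then have "\<gamma> t \<noteq> z0" using inS z0 by blast
    then show "v \<in> T - {0}" using inS[OF t(1)] t(2) by (auto simp: j_def T_def)
  qed
  have loopj: "pathfinish (j \<circ> \<gamma>) = pathstart (j \<circ> \<gamma>)"
    using loop by (simp add: pathfinish_def pathstart_def)
  have ne: "w \<noteq> z0" if "w \<in> path_image \<gamma>" for w using that z0p by auto
  \<comment> \<open>Inversion reverses the direction in which the curve runs around the origin; this
    sign cancels the one in \<open>K 0 = - L\<close>.\<close>
  have w0: "winding_number (j \<circ> \<gamma>) 0 = - 1"
  proof -
    have "winding_number (j \<circ> \<gamma>) 0 = 1 / (2 * pi * \<i>) * contour_integral \<gamma> (\<lambda>w. deriv j w * (1 / (j w - 0)))"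
      using jT by (subst winding_number_valid_path[OF vpj]) (auto simp: comp)
    also have "contour_integral \<gamma> (\<lambda>w. deriv j w * (1 / (j w - 0))) = contour_integral \<gamma> (\<lambda>w. - (1 / (w - z0)))"
    proof (rule contour_integral_eq)
      fix w assume "w \<in> path_image \<gamma>"
      then have "w \<noteq> z0" using ne by auto
      then show "deriv j w * (1 / (j w - 0)) = - (1 / (w - z0))"
        by (simp add: dj j_def power2_eq_square)
    qed
    also have "\<dots> = - contour_integral \<gamma> (\<lambda>w. 1 / (w - z0))"
      by (rule contour_integral_neg)
    also have "1 / (2 * pi * \<i>) * \<dots> = - winding_number \<gamma> z0"
      by (subst winding_number_valid_path[OF vp z0p]) simp
    finally show ?thesis unfolding wind[OF z0] .
  qed
  \<comment> \<open>By partial fractions the winding number about \<open>1 / (x - z0)\<close> is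
    that about \<open>x\<close> minus that about \<open>z0\<close>; for \<open>x\<close> outside
    \<open>S\<close> both equal 1.\<close>
  have wT: "winding_number (j \<circ> \<gamma>) v = 0" if "v \<notin> T" for v
  proof -
    have v: "v \<noteq> 0" "z0 + 1 / v \<notin> S" using that by (auto simp: T_def)
    define x where "x = z0 + 1 / v"
    have x: "x \<notin> S" "x \<noteq> z0" "v = 1 / (x - z0)" using v by (auto simp: x_def)
    then have xp: "x \<notin> path_image \<gamma>" using pS by auto
    have "v \<notin> path_image (j \<circ> \<gamma>)" using jT that by auto
    then have "winding_number (j \<circ> \<gamma>) v = 1 / (2 * pi * \<i>) * contour_integral \<gamma> (\<lambda>w. deriv j w * (1 / (j w - v)))"
      by (subst winding_number_valid_path[OF vpj]) (auto simp: comp)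
    also have "contour_integral \<gamma> (\<lambda>w. deriv j w * (1 / (j w - v))) = contour_integral \<gamma> (\<lambda>w. 1 / (w - x) - 1 / (w - z0))"
    proof (rule contour_integral_eq)
      fix w assume w: "w \<in> path_image \<gamma>"
      have "w \<noteq> z0" "w \<noteq> x" using w ne xp by auto
      have jd: "j w - v = (x - w) / ((w - z0) * (x - z0))"
        using \<open>w \<noteq> z0\<close> x(2) unfolding x(3) j_def by (subst diff_frac_eq) auto
      show "deriv j w * (1 / (j w - v)) = 1 / (w - x) - 1 / (w - z0)"
        unfolding dj[OF \<open>w \<noteq> z0\<close>] jd using \<open>w \<noteq> z0\<close> \<open>w \<noteq> x\<close> x(2)
        by (simp add: divide_simps power2_eq_square) (simp add: algebra_simps)
    qed
    also have "\<dots> = contour_integral \<gamma> (\<lambda>w. 1 / (w - x)) - contour_integral \<gamma> (\<lambda>w. 1 / (w - z0))"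
      by (rule contour_integral_diff) (auto intro!: contour_integrable_inversediff vp xp z0p)
    also have "1 / (2 * pi * \<i>) * \<dots> = winding_number \<gamma> x - winding_number \<gamma> z0"
      unfolding winding_number_valid_path[OF vp xp] winding_number_valid_path[OF vp z0p]
      by (simp add: field_simps)
    finally show ?thesis unfolding wind[OF x(1)] wind[OF z0] by (simp only: diff_self)
  qed
  have "((\<lambda>w. K w / (w - 0)) has_contour_integral (2 * pi * \<i> * winding_number (j \<circ> \<gamma>) 0 * K 0)) (j \<circ> \<gamma>)"
    by (rule Cauchy_integral_formula_global[OF opT KT _ vpj jT loopj wT]) (auto simp: T_def)
  then have "contour_integral (j \<circ> \<gamma>) (\<lambda>w. K w / w) = 2 * pi * \<i> * L"
    using w0 by (simp add: K_def contour_integral_unique)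
  moreover have "contour_integral (j \<circ> \<gamma>) (\<lambda>w. K w / w) = contour_integral \<gamma> G"
    unfolding comp
  proof (rule contour_integral_eq)
    fix w assume "w \<in> path_image \<gamma>"
    then have "w \<noteq> z0" using ne by auto
    then show "deriv j w * (K (j w) / j w) = G w"
      by (simp add: dj K_def j_def power2_eq_square)
  qed
  moreover have "G contour_integrable_on \<gamma>"
    by (rule contour_integrable_holomorphic_simple[OF G \<open>open S\<close> vp pS])
  ultimately show ?thesis
    using has_contour_integral_integral by fastforce
qed

text \<open>The difference quotient \<open>G\<close> of \<open>R\<close> at \<open>z\<close> is
  holomorphic on \<open>S\<close>, and \<open>\<zeta> * G \<zeta>\<close> tends to
  \<open>L - R z\<close> at infinity. The term \<open>R z / (\<zeta> - z)\<close> that is split off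
  integrates to 0, because the curve does not wind around \<open>z\<close>.\<close>

lemma exterior_Cauchy_formula:
  assumes "open S" and vp: "valid_path \<gamma>" and loop: "pathfinish \<gamma> = pathstart \<gamma>"
    and pS: "path_image \<gamma> \<subseteq> S" and wind: "\<And>x. x \<notin> S \<Longrightarrow> winding_number \<gamma> x = 1"
    and z0: "z0 \<notin> S" and bd: "bounded (- S)" and R: "R holomorphic_on S"
    and lim: "(R \<longlongrightarrow> L) at_infinity"
    and z: "z \<in> S" "z \<notin> path_image \<gamma>" "winding_number \<gamma> z = 0"
  shows "contour_integral \<gamma> (\<lambda>\<zeta>. R \<zeta> / (\<zeta> - z)) = 2 * of_real pi * \<i> * (L - R z)"
proof -
  define G where "G \<zeta> = (if \<zeta> = z then deriv R z else (R \<zeta> - R z) / (\<zeta> - z))" for \<zeta>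
  have G: "G holomorphic_on S" unfolding G_def by (rule pole_lemma_open[OF R \<open>open S\<close>])
  have "((\<lambda>\<zeta>. (R \<zeta> - R z) / (1 - z / \<zeta>)) \<longlongrightarrow> (L - R z) / (1 - 0)) at_infinity"
    by (intro tendsto_intros lim tendsto_divide_0[OF tendsto_const] filterlim_ident) auto
  then have "((\<lambda>\<zeta>. (R \<zeta> - R z) / (1 - z / \<zeta>)) \<longlongrightarrow> L - R z) at_infinity" by simp
  then have "((\<lambda>\<zeta>. \<zeta> * G \<zeta>) \<longlongrightarrow> L - R z) at_infinity"
    by (rule tendsto_at_infinity_cong_ne[where c = z]) (auto simp: G_def field_simps)
  from contour_integral_exterior[OF assms(1-7) G this]
  have 1: "contour_integral \<gamma> G = 2 * of_real pi * \<i> * (L - R z)" by (rule contour_integral_unique)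
  have i1: "(\<lambda>\<zeta>. R \<zeta> / (\<zeta> - z)) contour_integrable_on \<gamma>"
    by (rule contour_integrable_holomorphic_simple[of _ "S - {z}"])
       (use assms z in \<open>auto intro!: holomorphic_intros holomorphic_on_subset[OF R]\<close>)
  have i2: "(\<lambda>\<zeta>. 1 / (\<zeta> - z)) contour_integrable_on \<gamma>"
    using contour_integrable_inversediff[OF vp z(2)] .
  have "contour_integral \<gamma> G = contour_integral \<gamma> (\<lambda>\<zeta>. R \<zeta> / (\<zeta> - z) - R z * (1 / (\<zeta> - z)))"
    by (rule contour_integral_eq) (use z in \<open>auto simp: G_def diff_divide_distrib\<close>)
  also have "\<dots> = contour_integral \<gamma> (\<lambda>\<zeta>. R \<zeta> / (\<zeta> - z)) - R z * contour_integral \<gamma> (\<lambda>\<zeta>. 1 / (\<zeta> - z))"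
    by (subst contour_integral_diff[OF i1 contour_integrable_lmul[OF i2]])
       (simp only: contour_integral_lmul[OF i2])
  also have "contour_integral \<gamma> (\<lambda>\<zeta>. 1 / (\<zeta> - z)) = 0"
    using winding_number_valid_path[OF vp z(2)] z(3) by simp
  finally show ?thesis using 1 by simp
qed

text \<open>
  The function \<open>1 / g (1 / v)\<close> is univalent near \<open>0\<close>. Its derivative \<open>D\<close> there is both the limit of
  \<open>w / g w\<close> and, by the chain rule, equal to \<open>a * D\<^sup>2\<close>.
\<close>
lemma univalent_at_infinity_quotient:
  assumes hol: "g holomorphic_on {w. M < norm w}" and inj: "inj_on g {w. M < norm w}"
    and inf: "filterlim g at_infinity at_infinity" and der: "(deriv g \<longlongrightarrow> a) at_infinity"
  shows "a \<noteq> 0 \<and> ((\<lambda>w. g w / w) \<longlongrightarrow> a) at_infinity"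
proof -
  have "eventually (\<lambda>w. g w \<noteq> 0) at_infinity"
    using filterlim_iff[THEN iffD1, OF inf, rule_format, OF eventually_not_equal_at_infinity] .
  then obtain b where b: "\<And>w. b \<le> norm w \<Longrightarrow> g w \<noteq> 0" unfolding eventually_at_infinity by blast
  define m where "m = max (max M b) 1"
  have m: "m > 0" by (simp add: m_def)
  define k where "k v = (if v = 0 then 0 else inverse (g (inverse v)))" for v
  have big: "M < norm (inverse v)" "g (inverse v) \<noteq> 0" if "v \<in> ball 0 (1/m)" "v \<noteq> 0" for v :: complex
  proof -
    have "norm v < 1/m" "norm v > 0" using that by auto
    then have "m < inverse (norm v)" using m by (simp add: field_simps)
    then show "M < norm (inverse v)" "g (inverse v) \<noteq> 0" using b by (auto simp: m_def norm_inverse)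
  qed
  have ig: "((\<lambda>w. inverse (g w)) \<longlongrightarrow> 0) at_infinity"
    by (rule filterlim_compose[OF tendsto_inverse_0 inf])
  have lim: "(k \<longlongrightarrow> 0) (at 0)"
  proof -
    have "(((\<lambda>w. inverse (g w)) \<circ> inverse) \<longlongrightarrow> 0) (at 0)"
      using ig lim_at_infinity_0 by blast
    then show ?thesis
      by (rule Lim_transform_eventually) (auto simp: k_def eventually_at_filter)
  qed
  have comp: "(g \<circ> inverse) holomorphic_on ball 0 (1/m) - {0}"
    by (rule holomorphic_on_compose_gen[OF _ hol]) (use big in \<open>auto intro!: holomorphic_intros\<close>)
  have kh: "k holomorphic_on ball 0 (1/m)"
  proof (rule no_isolated_singularity'[where K = "{0}"])
    fix z :: complex assume "z \<in> {0}"
    then show "(k \<longlongrightarrow> k z) (at z within ball 0 (1/m))"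
      using lim by (auto simp: k_def intro: tendsto_within_subset)
  next
    have "(\<lambda>v. inverse ((g \<circ> inverse) v)) holomorphic_on ball 0 (1/m) - {0}"
      by (intro holomorphic_intros comp) (use big in auto)
    then show "k holomorphic_on ball 0 (1/m) - {0}"
      by (rule holomorphic_transform) (auto simp: k_def)
  qed auto
  have kinj: "inj_on k (ball 0 (1/m))"
  proof (rule inj_onI)
    fix x y assume x: "x \<in> ball 0 (1/m)" and y: "y \<in> ball 0 (1/m)" and e: "k x = k y"
    show "x = y"
    proof (cases "x = 0 \<or> y = 0")
      case True
      then show ?thesis using e big[OF x] big[OF y] by (auto simp: k_def split: if_splits)
    next
      case False
      then have "g (inverse x) = g (inverse y)" using e by (simp add: k_def)
      then have "inverse x = inverse y"
        using inj big[OF x] big[OF y] False by (auto dest: inj_onD)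
      then show ?thesis by simp
    qed
  qed
  define D where "D = deriv k 0"
  have D0: "D \<noteq> 0" unfolding D_def
    by (rule holomorphic_injective_imp_regular[OF kh open_ball kinj]) (use m in auto)
  have "k field_differentiable at 0"
    using m by (auto intro: holomorphic_on_imp_differentiable_at kh)
  then have "((\<lambda>h. (k (0 + h) - k 0) / h) \<longlongrightarrow> D) (at 0)"
    unfolding D_def using DERIV_def DERIV_deriv_iff_field_differentiable by blast
  then have "(((\<lambda>w. w / g w) \<circ> inverse) \<longlongrightarrow> D) (at 0)"
    by (rule Lim_transform_eventually) (auto simp: k_def eventually_at_filter field_simps)
  then have q: "((\<lambda>w. w / g w) \<longlongrightarrow> D) at_infinity" using lim_at_infinity_0 by blast
  have "continuous_on (ball 0 (1/m)) (deriv k)"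
    by (intro holomorphic_on_imp_continuous_on holomorphic_deriv kh) auto
  then have "isCont (deriv k) 0" using m by (auto simp: continuous_on_eq_continuous_at)
  then have dk: "(deriv k \<longlongrightarrow> D) (at 0)" by (simp add: isCont_def D_def)
  have dkv: "deriv k v = deriv g (inverse v) * (inverse v / g (inverse v))\<^sup>2"
    if v: "v \<in> ball 0 (1/m)" "v \<noteq> 0" for v
  proof (rule DERIV_imp_deriv)
    have dg: "(g has_field_derivative deriv g (inverse v)) (at (inverse v))"
      by (rule holomorphic_derivI[OF hol]) (use big[OF v] in \<open>auto simp: open_Collect_less continuous_intros\<close>)
    have "((\<lambda>v. inverse (g (inverse v))) has_field_derivative
            deriv g (inverse v) * (inverse v / g (inverse v))\<^sup>2) (at v)"
      by (rule DERIV_cong[OF DERIV_inverse'[OF DERIV_chain2[OF dg DERIV_inverse[OF v(2)]]]])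
         (use big[OF v] in \<open>auto simp: field_simps power2_eq_square power_numeral_reduce\<close>)
    moreover have ev: "eventually (\<lambda>x. inverse (g (inverse x)) = k x) (nhds v)"
      using v(2) by (intro eventually_mono[OF t1_space_nhds[of v 0]]) (auto simp: k_def)
    ultimately show "(k has_field_derivative deriv g (inverse v) * (inverse v / g (inverse v))\<^sup>2) (at v)"
      using DERIV_cong_ev[OF refl ev refl] by blast
  qed
  have "(((\<lambda>w. deriv g w * (w / g w)\<^sup>2) \<circ> inverse) \<longlongrightarrow> D) (at 0)"
  proof (rule Lim_transform_eventually[OF dk])
    have "eventually (\<lambda>v. v \<in> ball 0 (1/m)) (nhds 0)" using m by (intro eventually_nhds_in_open) auto
    then show "eventually (\<lambda>v. deriv k v = ((\<lambda>w. deriv g w * (w / g w)\<^sup>2) \<circ> inverse) v) (at 0)"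
      unfolding eventually_at_filter by eventually_elim (auto simp: dkv)
  qed
  then have "((\<lambda>w. deriv g w * (w / g w)\<^sup>2) \<longlongrightarrow> D) at_infinity" using lim_at_infinity_0 by blast
  moreover have "((\<lambda>w. deriv g w * (w / g w)\<^sup>2) \<longlongrightarrow> a * D\<^sup>2) at_infinity"
    by (intro tendsto_intros der q)
  ultimately have "a * D\<^sup>2 = D" using tendsto_unique trivial_limit_at_infinity by blast
  then have aD: "a * D = 1" using D0 by (simp add: power2_eq_square)
  have "((\<lambda>w. inverse (w / g w)) \<longlongrightarrow> inverse D) at_infinity"
    by (intro tendsto_intros q D0)
  moreover have "inverse D = a" using aD D0 by (simp add: field_simps)
  ultimately show ?thesis using aD by auto
qed

text \<open>On a large annulus the maximum principle leaves only the two boundary circles, and on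
  the outer one \<open>e\<close> is below an arbitrary \<open>\<eta>\<close>. This gives
  \<open>B + \<eta>\<close> for every positive \<open>\<eta>\<close>.\<close>

lemma exterior_maximum_modulus:
  fixes e :: "complex \<Rightarrow> complex"
  assumes hol: "e holomorphic_on {w. s < norm w}" and "s < r" and lim: "(e \<longlongrightarrow> 0) at_infinity"
    and B: "\<And>w. norm w = r \<Longrightarrow> norm (e w) \<le> B" and "0 \<le> B" and w: "r \<le> norm w"
  shows "norm (e w) \<le> B"
proof (rule field_le_epsilon)
  fix \<eta> :: real assume \<eta>: "0 < \<eta>"
  have "eventually (\<lambda>w. norm (e w) < \<eta>) at_infinity"
    using lim \<eta> by (auto simp: tendsto_iff)
  then obtain T0 where T0: "\<And>w. T0 \<le> norm w \<Longrightarrow> norm (e w) < \<eta>" unfolding eventually_at_infinity by blast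
  define T where "T = max (max T0 (norm w)) r"
  define S where "S = cball (0::complex) T - ball 0 r"
  have cl: "closed S" unfolding S_def by (intro closed_Diff) auto
  have fr: "frontier S \<subseteq> sphere 0 T \<union> sphere 0 r"
  proof -
    have "S \<inter> - interior S \<subseteq> sphere 0 T \<union> sphere 0 r"
    proof -
      have "ball 0 T - cball 0 r \<subseteq> interior S"
        by (rule interior_maximal) (auto simp: S_def)
      then have "x \<in> interior S" if "norm x < T" "r < norm x" for x using that by auto
      then have "norm x = T \<or> norm x = r" if "x \<in> S" "x \<notin> interior S" for x
        using that by (force simp: S_def)
      then show ?thesis by fastforce
    qed
    then show ?thesis using cl by (auto simp: frontier_def)
  qed
  have holS: "e holomorphic_on S" by (rule holomorphic_on_subset[OF hol]) (use \<open>s < r\<close> in \<open>auto simp: S_def\<close>)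
  show "norm (e w) \<le> B + \<eta>"
  proof (rule maximum_modulus_frontier[where S = S and f = e and \<xi> = w])
    show "e holomorphic_on interior S" using holS interior_subset holomorphic_on_subset by blast
    show "continuous_on (closure S) e" using holS cl by (simp add: holomorphic_on_imp_continuous_on)
    show "bounded S" unfolding S_def by (auto intro: bounded_subset[OF bounded_cball])
    show "w \<in> S" using w by (auto simp: S_def T_def)
    fix z assume "z \<in> frontier S"
    then have "norm z = T \<or> norm z = r" using fr by auto
    moreover have "T0 \<le> T" by (simp add: T_def)
    ultimately show "norm (e z) \<le> B + \<eta>"
      using B[of z] T0[of z] \<eta> \<open>0 \<le> B\<close> by auto
  qed
qed

subsection \<open>Integrals along parametrized curves\<close>

text \<open>Near infinity the transform is a series in the moments, all of which vanish; the
  exterior is connected, so the identity theorem spreads the zero over all of it.\<close>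

lemma Cauchy_transform_eq_0_outside:
  fixes c n :: "real \<Rightarrow> complex"
  assumes c: "continuous_on {0..1} c" and n: "continuous_on {0..1} n"
    and moments: "\<And>k. integral {0..1} (\<lambda>t. n t * c t ^ k) = 0"
    and z: "z \<in> outside (path_image c)"
  shows "integral {0..1} (\<lambda>t. n t / (z - c t)) = 0"
proof -
  define U where "U z = integral {0..1} (\<lambda>t. n t / (z - c t))" for z
  have cK: "compact (path_image c)" unfolding path_image_def by (intro compact_continuous_image c compact_Icc)
  have inK: "c t \<in> path_image c" if "t \<in> {0..1}" for t using that by (auto simp: path_image_def)
  obtain M where M: "M > 0" "path_image c \<subseteq> cball 0 M"
    using compact_imp_bounded[OF cK] bounded_pos by (metis mem_cball_0 subsetI)
  have "bounded (n ` {0..1})"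
    by (intro compact_imp_bounded compact_continuous_image n compact_Icc)
  then obtain N where N: "N > 0" "\<And>t. t \<in> {0..1} \<Longrightarrow> norm (n t) \<le> N"
    unfolding bounded_pos by auto
  have hol: "U analytic_on - path_image c"
    unfolding analytic_on_def
  proof
    fix x assume "x \<in> - path_image c"
    moreover have "open (- path_image c)" using cK by (simp add: compact_imp_closed open_Compl)
    ultimately obtain e where e: "e > 0" "ball x e \<subseteq> - path_image c" by (meson openE)
    have ne: "z \<noteq> c t" if "z \<in> ball x e" "t \<in> {0..1}" for z t using inK e that by auto
    have "(\<lambda>z. integral (cbox 0 1) (\<lambda>t. n t / (z - c t))) holomorphic_on ball x e"
    proof (rule leibniz_rule_holomorphic)
      fix z t assume zt: "z \<in> ball x e" "t \<in> cbox (0::real) 1"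
      show "((\<lambda>z. n t / (z - c t)) has_field_derivative - n t / (z - c t)\<^sup>2) (at z within ball x e)"
        using ne[of z t] zt by (auto intro!: derivative_eq_intros simp: power2_eq_square)
    next
      fix z assume "z \<in> ball x e"
      then show "(\<lambda>t. n t / (z - c t)) integrable_on cbox 0 1"
        using ne by (intro integrable_continuous continuous_intros) (auto simp: n c)
    next
      have "continuous_on (ball x e \<times> cbox 0 1) (\<lambda>p. n (snd p))"
        by (rule continuous_on_compose2[OF n continuous_on_snd[OF continuous_on_id]]) auto
      moreover have "continuous_on (ball x e \<times> cbox 0 1) (\<lambda>p. c (snd p))"
        by (rule continuous_on_compose2[OF c continuous_on_snd[OF continuous_on_id]]) auto
      ultimately show "continuous_on (ball x e \<times> cbox 0 1) (\<lambda>(z, t). - n t / (z - c t)\<^sup>2)"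
        unfolding split_def using ne by (intro continuous_intros) auto
    qed auto
    then show "\<exists>e>0. U holomorphic_on ball x e" using e unfolding U_def by auto
  qed
  have far: "U z = 0" if zM: "norm z > M" for z
  proof -
    have dist: "norm (z - c t) \<ge> norm z - M" if "t \<in> {0..1}" for t
      using norm_triangle_ineq2[of z "c t"] M(2) inK[OF that] by (auto simp: subset_iff)
    have ne: "z - c t \<noteq> 0" if "t \<in> {0..1}" for t using dist[OF that] zM by auto
    \<comment> \<open>The geometric series enters through its remainder: inserting a factor
      \<open>c t / z\<close> into the integrand changes the integral only by a vanishing moment.
      Letting \<open>k\<close> grow then gives 0, since
      \<open>norm (c t) \<le> M < norm z\<close>.\<close>
    have rec: "integral {0..1} (\<lambda>t. n t * c t ^ k / (z - c t)) = z ^ k * U z" for k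
    proof (induction k)
      case (Suc k)
      have "integral {0..1} (\<lambda>t. n t * c t ^ Suc k / (z - c t))
          = integral {0..1} (\<lambda>t. z * (n t * c t ^ k / (z - c t)) - n t * c t ^ k)"
        using ne by (intro integral_cong) (simp add: field_simps)
      also have "\<dots> = integral {0..1} (\<lambda>t. z * (n t * c t ^ k / (z - c t))) - integral {0..1} (\<lambda>t. n t * c t ^ k)"
        using ne by (intro integral_diff integrable_continuous_interval continuous_intros n c) auto
      also have "\<dots> = z * (z ^ k * U z)"
        unfolding integral_mult_right Suc moments by simp
      also have "\<dots> = z ^ Suc k * U z" by simp
      finally show ?case .
    qed (simp add: U_def)
    have bnd: "norm (z ^ k * U z) \<le> N * M ^ k / (norm z - M) * (1 - 0)" for k
      unfolding rec[symmetric]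
    proof (rule integral_bound)
      show "continuous_on {0..1} (\<lambda>t. n t * c t ^ k / (z - c t))"
        using ne by (intro continuous_intros n c) auto
      fix t :: real assume t: "t \<in> {0..1}"
      have "norm (c t) \<le> M" using M(2) inK[OF t] by auto
      then show "norm (n t * c t ^ k / (z - c t)) \<le> N * M ^ k / (norm z - M)"
        unfolding norm_divide norm_mult norm_power
        using N(1) N(2)[OF t] M(1) zM dist[OF t] by (intro frac_le mult_mono power_mono) auto
    qed auto
    have "norm (U z) \<le> N / (norm z - M) * (M / norm z) ^ k" for k
    proof -
      have z0: "norm z > 0" using zM M(1) by linarith
      have "norm z ^ k * norm (U z) \<le> N * M ^ k / (norm z - M)"
        using bnd[of k] by (simp add: norm_mult norm_power)
      then have "norm (U z) \<le> (N * M ^ k / (norm z - M)) / norm z ^ k"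
        using z0 by (subst pos_le_divide_eq) (simp_all add: mult.commute)
      then show ?thesis using z0 by (simp add: power_divide)
    qed
    moreover have "M / norm z < 1" using zM M(1) by (subst divide_less_eq_1_pos) auto
    then have "(\<lambda>k. N / (norm z - M) * (M / norm z) ^ k) \<longlonglongrightarrow> N / (norm z - M) * 0"
      using M(1) by (intro tendsto_intros LIMSEQ_power_zero) auto
    ultimately have "norm (U z) \<le> 0"
      by (intro LIMSEQ_le_const) auto
    then show ?thesis by simp
  qed
  have sub: "- cball 0 M \<subseteq> outside (path_image c)"
    by (rule outside_subset_convex) (use M in auto)
  have "U z = 0"
  proof (rule analytic_continuation_open[where f = U and g = "\<lambda>_. 0" and s = "- cball 0 M"])
    show "open (- cball (0::complex) M)" by auto
    show "open (outside (path_image c))" using cK by (simp add: compact_imp_closed open_outside)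
    have "of_real (M + 1) \<in> - cball (0::complex) M" using M by auto
    then show "- cball (0::complex) M \<noteq> {}" by blast
    show "connected (outside (path_image c))"
      by (rule connected_outside) (use cK compact_imp_bounded in auto)
    show "U holomorphic_on outside (path_image c)"
      by (rule analytic_imp_holomorphic, rule analytic_on_subset[OF hol])
         (auto simp: outside_def)
  qed (use sub z far in auto)
  then show ?thesis by (simp add: U_def)
qed

text \<open>Differentiating \<open>g * cnj g = 1\<close> along the curve shows that the logarithmic
  derivative of \<open>g (c t)\<close> is purely imaginary, so its quotient by \<open>\<i>\<close>
  is real. That quotient is continuous and never zero on the connected real line, hence of constant
  sign; \<open>\<sigma>\<close> records the direction in which \<open>g (c t)\<close> runs around
  the unit circle.\<close>

lemma unimodular_tangent:
  fixes c c' :: "real \<Rightarrow> complex"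
  assumes der: "\<And>t. (c has_vector_derivative c' t) (at t)" and c': "continuous_on UNIV c'"
    and nz: "\<And>t. c' t \<noteq> 0" and S: "open S" "g holomorphic_on S" "\<And>t. c t \<in> S"
    and one: "\<And>t. norm (g (c t)) = 1" and dg: "\<And>t. deriv g (c t) \<noteq> 0"
  shows "\<exists>\<sigma>. (\<sigma> = 1 \<or> \<sigma> = -1) \<and>
    (\<forall>t. of_real (norm (deriv g (c t)) * norm (c' t)) = \<sigma> * deriv g (c t) * c' t / (\<i> * g (c t)))"
proof -
  define \<tau> where "\<tau> t = deriv g (c t) * c' t / (\<i> * g (c t))" for t
  have gnz: "g (c t) \<noteq> 0" for t using one[of t] by auto
  have nt: "norm (\<tau> t) = norm (deriv g (c t)) * norm (c' t)" for t
    by (simp add: \<tau>_def norm_mult norm_divide one)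
  have tnz: "\<tau> t \<noteq> 0" for t using nz dg gnz by (simp add: \<tau>_def)
  have real: "Im (\<tau> t) = 0" for t
  proof -
    have gd: "(g has_field_derivative deriv g (c t)) (at (c t))"
      by (rule holomorphic_derivI[OF S(2) S(1) S(3)])
    have "((g \<circ> c) has_vector_derivative (c' t * deriv g (c t))) (at t)"
      by (rule field_vector_diff_chain_at[OF der gd])
    then have v: "((\<lambda>t. g (c t)) has_vector_derivative (c' t * deriv g (c t))) (at t)"
      by (simp add: o_def)
    have "((\<lambda>t. g (c t) * cnj (g (c t))) has_vector_derivative
            (g (c t) * cnj (c' t * deriv g (c t)) + (c' t * deriv g (c t)) * cnj (g (c t)))) (at t)"
      by (rule has_vector_derivative_mult[OF v has_vector_derivative_cnj[OF v]])
    moreover have "(\<lambda>t. g (c t) * cnj (g (c t))) = (\<lambda>_. 1)"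
      by (simp add: complex_norm_square[symmetric] one)
    ultimately have "((\<lambda>t. 1) has_vector_derivative
            (g (c t) * cnj (c' t * deriv g (c t)) + (c' t * deriv g (c t)) * cnj (g (c t)))) (at t)" by simp
    then have z: "g (c t) * cnj (c' t * deriv g (c t)) + (c' t * deriv g (c t)) * cnj (g (c t)) = 0"
      using has_vector_derivative_const vector_derivative_unique_at by metis
    define w where "w = (c' t * deriv g (c t)) * cnj (g (c t))"
    have "w + cnj w = 0" using z by (simp add: w_def algebra_simps)
    then have "Re w = 0" by (simp add: complex_add_cnj)
    have "inverse (g (c t)) = cnj (g (c t))"
      by (rule inverse_unique) (simp add: complex_norm_square[symmetric] one)
    then have "\<tau> t = - \<i> * w" unfolding \<tau>_def w_def by (simp add: divide_inverse algebra_simps)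
    then show ?thesis using \<open>Re w = 0\<close> by simp
  qed
  have cc: "continuous_on UNIV c"
    by (intro continuous_at_imp_continuous_on ballI) (metis der has_vector_derivative_continuous)
  have "continuous_on UNIV (\<lambda>t. g (c t))"
    by (rule continuous_on_compose2[OF holomorphic_on_imp_continuous_on[OF S(2)] cc]) (use S in auto)
  moreover have "continuous_on UNIV (\<lambda>t. deriv g (c t))"
    by (rule continuous_on_compose2[OF holomorphic_on_imp_continuous_on[OF holomorphic_deriv[OF S(2,1)]] cc])
       (use S in auto)
  ultimately have "continuous_on UNIV (\<lambda>t. Re (\<tau> t))"
    unfolding \<tau>_def using c' gnz by (intro continuous_intros) auto
  then have conn: "connected ((\<lambda>t. Re (\<tau> t)) ` UNIV)"
    by (rule connected_continuous_image) auto
  have rnz: "Re (\<tau> t) \<noteq> 0" for t using tnz[of t] real[of t] complex_eqI by auto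
  have tr: "\<tau> t = of_real (Re (\<tau> t))" for t using real[of t] by (simp add: complex_eq_iff)
  show ?thesis
  proof (cases "Re (\<tau> 0) > 0")
    case True
    have "Re (\<tau> t) > 0" for t
    proof (rule ccontr)
      assume "\<not> ?thesis"
      then have "0 \<in> (\<lambda>t. Re (\<tau> t)) ` UNIV"
        using connectedD_interval[OF conn, of "Re (\<tau> t)" "Re (\<tau> 0)" 0] True by auto
      then show False using rnz by (metis imageE)
    qed
    then have "of_real (norm (\<tau> t)) = \<tau> t" for t
      by (metis tr abs_of_pos norm_of_real)
    then show ?thesis by (intro exI[of _ 1]) (simp add: nt[symmetric] \<tau>_def)
  next
    case False
    have "Re (\<tau> t) < 0" for t
    proof (rule ccontr)
      assume "\<not> ?thesis"
      then have "0 \<in> (\<lambda>t. Re (\<tau> t)) ` UNIV"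
        using connectedD_interval[OF conn, of "Re (\<tau> 0)" "Re (\<tau> t)" 0] False by auto
      then show False using rnz by (metis imageE)
    qed
    then have "of_real (norm (\<tau> t)) = - \<tau> t" for t
      by (metis tr abs_of_neg norm_of_real of_real_minus)
    then show ?thesis by (intro exI[of _ "-1"]) (simp add: nt[symmetric] \<tau>_def)
  qed
qed

subsection \<open>The exterior map\<close>

text \<open>
  The curve is parametrized on the whole real line with derivative \<open>c'\<close>, so that no one-sided
  derivatives at the endpoints of the unit interval occur.
\<close>
locale szego_setting =
  fixes c c' :: "real \<Rightarrow> complex"
    and h \<psi> \<phi> q De :: "complex \<Rightarrow> complex"
    and p :: "nat \<Rightarrow> complex poly"
    and lc :: "nat \<Rightarrow> real"
    and \<rho>' \<rho> b d :: real
  assumes c_der: "\<And>t. (c has_vector_derivative c' t) (at t)"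
    and c'_cont: "continuous_on UNIV c'" and c'_nz: "\<And>t. c' t \<noteq> 0"
    and c_per: "\<And>t. c t \<in> path_image c"
    and c_simple: "simple_path c" and c_loop: "pathfinish c = pathstart c"
    and orient: "positively_oriented c"
    and hpos: "\<And>z. z \<in> path_image c \<Longrightarrow> h z \<in> \<real> \<and> 0 < Re (h z)"
    and polys: "orthonormal_polys c h p lc"
    and ext_map: "exterior_map c \<psi>"
    and univ0: "0 \<le> \<rho>'" and univ_hol: "\<psi> holomorphic_on Ext \<rho>'" and univ_inj: "inj_on \<psi> (Ext \<rho>')"
    and phi_eq: "\<phi> = phi \<psi> \<rho>'" and b_eq: "b = value_at_inf (deriv \<phi>)"
    and q: "sqrt_dphi \<psi> \<rho>' q"
    and De: "exterior_szego c h \<psi> De" and rho_ge: "\<rho>' \<le> \<rho>" and De_hol: "De holomorphic_on Om \<psi> \<rho>"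
    and d_eq: "d = value_at_inf De"
    and rho1: "\<rho> < 1"
begin

abbreviation "L1 \<equiv> path_image c"

lemma rho_bounds: "0 \<le> \<rho>'" "\<rho>' < 1" "0 \<le> \<rho>" using univ0 rho_ge rho1 by auto

lemma open_Ext: "open (Ext s)"
  unfolding Ext_def by (intro open_Collect_less continuous_intros)

lemma Om_mono: "s \<le> t \<Longrightarrow> Om \<psi> t \<subseteq> Om \<psi> s"
  by (auto simp: Om_def Ext_def)

lemma Om1: "Om \<psi> 1 = outside L1"
  using ext_map by (auto simp: exterior_map_def Om_def)

lemma psi_hol: "\<rho>' \<le> s \<Longrightarrow> \<psi> holomorphic_on Ext s"
  by (rule holomorphic_on_subset[OF univ_hol]) (auto simp: Ext_def)

lemma psi_inj: "\<rho>' \<le> s \<Longrightarrow> inj_on \<psi> (Ext s)"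
  by (rule inj_on_subset[OF univ_inj]) (auto simp: Ext_def)

lemma psi_cont: "continuous_on (Ext \<rho>') \<psi>"
  by (rule holomorphic_on_imp_continuous_on[OF univ_hol])

lemma phi_psi: "\<rho>' < norm w \<Longrightarrow> \<phi> (\<psi> w) = w"
  unfolding phi_eq phi_def by (rule inv_into_f_f[OF univ_inj]) (auto simp: Ext_def)

lemma psi_phi: assumes "z \<in> Om \<psi> \<rho>'" shows "\<psi> (\<phi> z) = z" "\<rho>' < norm (\<phi> z)"
  using assms phi_psi by (auto simp: Om_def Ext_def)

lemma psi_in_Om_iff: "\<rho>' \<le> s \<Longrightarrow> \<rho>' < norm w \<Longrightarrow> \<psi> w \<in> Om \<psi> s \<longleftrightarrow> s < norm w"
  using phi_psi unfolding Om_def Ext_def by (metis (mono_tags, lifting) image_iff mem_Collect_eq order_le_less_trans)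

lemma in_Om_iff: "\<rho>' \<le> s \<Longrightarrow> z \<in> Om \<psi> s \<longleftrightarrow> z \<in> Om \<psi> \<rho>' \<and> s < norm (\<phi> z)"
  by (metis Om_mono psi_in_Om_iff psi_phi subsetD)

lemma open_Om: "\<rho>' \<le> s \<Longrightarrow> open (Om \<psi> s)"
  unfolding Om_def by (rule open_mapping_thm3[OF psi_hol open_Ext psi_inj])

lemma dpsi_nz: "\<rho>' < norm w \<Longrightarrow> deriv \<psi> w \<noteq> 0"
  by (rule holomorphic_injective_imp_regular[OF univ_hol open_Ext univ_inj]) (auto simp: Ext_def)

lemma phi_deriv: assumes "\<rho>' < norm w"
  shows "(\<phi> has_field_derivative inverse (deriv \<psi> w)) (at (\<psi> w))"
proof (rule has_field_derivative_inverse_strong[where S = "Ext \<rho>'" and f = \<psi>])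
  show "(\<psi> has_field_derivative deriv \<psi> w) (at w)"
    by (rule holomorphic_derivI[OF univ_hol open_Ext]) (use assms in \<open>auto simp: Ext_def\<close>)
qed (use assms dpsi_nz open_Ext psi_cont phi_psi in \<open>auto simp: Ext_def\<close>)

lemma phi_hol: "\<phi> holomorphic_on Om \<psi> \<rho>'"
  unfolding holomorphic_on_def field_differentiable_def
  using phi_deriv by (auto simp: Om_def Ext_def intro: has_field_derivative_at_within)

lemma dphi: "\<rho>' < norm w \<Longrightarrow> deriv \<phi> (\<psi> w) = inverse (deriv \<psi> w)"
  by (rule DERIV_imp_deriv[OF phi_deriv])

lemma q_hol: "q holomorphic_on Om \<psi> \<rho>'" using q by (simp add: sqrt_dphi_def)

lemma q_sq: "z \<in> Om \<psi> \<rho>' \<Longrightarrow> (q z)\<^sup>2 = deriv \<phi> z" using q phi_eq by (simp add: sqrt_dphi_def)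

lemma dphi_nz: assumes "z \<in> Om \<psi> \<rho>'" shows "deriv \<phi> z \<noteq> 0"
  using dphi[OF psi_phi(2)[OF assms]] dpsi_nz[OF psi_phi(2)[OF assms]] psi_phi(1)[OF assms] by simp

lemma q_nz: "z \<in> Om \<psi> \<rho>' \<Longrightarrow> q z \<noteq> 0"
  using q_sq dphi_nz by fastforce

lemma phi_nz: "z \<in> Om \<psi> \<rho>' \<Longrightarrow> \<phi> z \<noteq> 0"
  using psi_phi(2) rho_bounds by force

lemma psi_infinity: "filterlim \<psi> at_infinity at_infinity" using ext_map by (simp add: exterior_map_def)

subsection \<open>The level curves\<close>

lemma c_cont: "continuous_on UNIV c"
  by (intro continuous_at_imp_continuous_on ballI) (metis c_der has_vector_derivative_continuous)

lemma c_valid: "valid_path c"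
proof -
  have "c C1_differentiable_on {0..1}"
    unfolding C1_differentiable_on_def using c_der c'_cont continuous_on_subset by blast
  then show ?thesis by (simp add: valid_path_def C1_differentiable_imp_piecewise)
qed

lemma L1_compact: "compact L1" using c_simple by (simp add: compact_simple_path_image)

text \<open>Beyond the curve and its inside, the complement is covered by the image of the compact
  annulus between the radii 1 and \<open>t\<close>.\<close>

lemma bounded_Compl_Om: assumes "\<rho>' \<le> t" shows "bounded (- Om \<psi> t)"
proof -
  have b1: "bounded (- Om \<psi> 1)"
    unfolding Om1 by (rule cobounded_outside) (simp add: L1_compact compact_imp_bounded)
  have "- Om \<psi> t \<subseteq> - Om \<psi> 1 \<union> \<psi> ` {w. 1 \<le> norm w \<and> norm w \<le> t}"
    unfolding Om_def Ext_def by (fastforce simp: not_less)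
  moreover have "compact (\<psi> ` {w. 1 \<le> norm w \<and> norm w \<le> t})"
  proof (rule compact_continuous_image)
    show "continuous_on {w. 1 \<le> norm w \<and> norm w \<le> t} \<psi>"
      by (rule continuous_on_subset[OF psi_cont]) (use rho_bounds in \<open>auto simp: Ext_def\<close>)
    have "{w::complex. 1 \<le> norm w \<and> norm w \<le> t} = cball 0 t - ball 0 1" by auto
    then show "compact {w::complex. 1 \<le> norm w \<and> norm w \<le> t}" by (simp add: compact_diff)
  qed
  ultimately show ?thesis
    using b1 by (meson bounded_Un bounded_subset compact_imp_bounded)
qed

lemma eventually_in_Om: assumes "\<rho>' \<le> t" shows "eventually (\<lambda>z. z \<in> Om \<psi> t) at_infinity"
proof -
  obtain B where "\<And>x. x \<in> - Om \<psi> t \<Longrightarrow> norm x \<le> B"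
    using bounded_Compl_Om[OF assms] unfolding bounded_iff by blast
  then show ?thesis unfolding eventually_at_infinity by (intro exI[of _ "B + 1"]) force
qed

lemma Om_far: assumes "\<rho>' \<le> t" obtains M where "M > 0" "{z. M < norm z} \<subseteq> Om \<psi> t"
proof -
  obtain B where "B > 0" "\<And>x. x \<in> - Om \<psi> t \<Longrightarrow> norm x \<le> B"
    using bounded_Compl_Om[OF assms] unfolding bounded_pos by blast
  then show ?thesis by (intro that[of B]) force+
qed

lemma phi_infinity: "filterlim \<phi> at_infinity at_infinity"
  unfolding filterlim_at_infinity[OF order_refl]
proof (intro allI impI)
  fix r :: real assume "0 < r"
  have "eventually (\<lambda>z. z \<in> Om \<psi> (max r \<rho>')) at_infinity" by (rule eventually_in_Om) simp
  then show "eventually (\<lambda>z. r \<le> norm (\<phi> z)) at_infinity"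
    by (rule eventually_mono) (use in_Om_iff[of "max r \<rho>'"] in auto)
qed

text \<open>Since \<open>\<psi>\<close> tends to infinity, the image points near a given point all
  come from a compact annulus, and the image of that annulus is closed.\<close>

lemma closed_psi_image: assumes t: "\<rho>' < t" shows "closed (\<psi> ` {w. t \<le> norm w})"
proof -
  let ?A = "\<psi> ` {w. t \<le> norm w}"
  have "x \<in> ?A" if x: "x \<in> closure ?A" for x
  proof -
    have "eventually (\<lambda>w. norm x + 1 \<le> norm (\<psi> w)) at_infinity"
      using psi_infinity[unfolded filterlim_at_infinity[OF order_refl]]
      by (meson norm_ge_zero add_nonneg_pos zero_less_one)
    then obtain T where T: "\<And>w. T \<le> norm w \<Longrightarrow> norm x + 1 \<le> norm (\<psi> w)"
      unfolding eventually_at_infinity by blast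
    let ?K = "cball 0 T - ball (0::complex) t"
    have K: "compact (\<psi> ` ?K)"
      by (intro compact_continuous_image compact_diff compact_cball open_ball
          continuous_on_subset[OF psi_cont]) (use t in \<open>auto simp: Ext_def\<close>)
    have "ball x 1 \<inter> ?A \<subseteq> \<psi> ` ?K"
    proof
      fix y assume "y \<in> ball x 1 \<inter> ?A"
      then obtain w where w: "y = \<psi> w" "t \<le> norm w" "norm (y - x) < 1"
        by (auto simp: dist_norm norm_minus_commute)
      then have "norm (\<psi> w) < norm x + 1" using norm_triangle_ineq2[of y x] by simp
      then have "norm w < T" using T[of w] by (meson not_le)
      then show "y \<in> \<psi> ` ?K" using w by auto
    qed
    then have "closure (ball x 1 \<inter> ?A) \<subseteq> \<psi> ` ?K"
      using K by (simp add: closure_minimal compact_imp_closed)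
    moreover have "x \<in> closure (ball x 1 \<inter> ?A)"
      using open_Int_closure_subset[OF open_ball, of x 1 ?A] x by auto
    ultimately show ?thesis by auto
  qed
  then show ?thesis using closure_subset_eq by blast
qed

lemma closure_Om: assumes "\<rho>' < t" shows "closure (Om \<psi> t) \<subseteq> \<psi> ` {w. t \<le> norm w}"
  by (rule closure_minimal[OF _ closed_psi_image[OF assms]]) (auto simp: Om_def Ext_def)

lemma frontier_Om: assumes "\<rho>' < t" shows "frontier (Om \<psi> t) \<subseteq> \<psi> ` sphere 0 t"
proof
  fix z assume "z \<in> frontier (Om \<psi> t)"
  then have z: "z \<in> closure (Om \<psi> t)" "z \<notin> Om \<psi> t"
    using open_Om[of t] assms by (auto simp: frontier_def interior_open)
  then obtain w where w: "z = \<psi> w" "t \<le> norm w" using closure_Om[OF assms] by auto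
  then have "norm w = t" using z(2) psi_in_Om_iff[of t w] assms by auto
  then show "z \<in> \<psi> ` sphere 0 t" using w by auto
qed

lemma Jordan: "open (inside L1)" "open (outside L1)" "frontier (outside L1) = L1" "frontier (inside L1) = L1"
  "inside L1 \<noteq> {}"
  using Jordan_inside_outside[OF c_simple c_loop] by auto

text \<open>The curve is the frontier of \<open>Om \<psi> 1\<close>; as \<open>\<psi>\<close>
  continues across the unit circle, every frontier point is attained on that circle.\<close>

lemma L1_psi: "L1 \<subseteq> \<psi> ` sphere 0 1"
  using frontier_Om[of 1] rho_bounds Om1 Jordan(3) by auto

lemma phi_L1: assumes "z \<in> L1" shows "norm (\<phi> z) = 1"
proof -
  obtain w where "z = \<psi> w" "norm w = 1" using L1_psi assms by auto
  then show ?thesis using phi_psi rho_bounds by simp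
qed

lemma L1_Om: assumes "\<rho>' \<le> s" "s < 1" shows "L1 \<subseteq> Om \<psi> s"
proof
  fix z assume "z \<in> L1"
  then obtain w where "z = \<psi> w" "norm w = 1" using L1_psi by auto
  then show "z \<in> Om \<psi> s" using assms rho_bounds by (simp add: psi_in_Om_iff)
qed

lemma Compl_Om_inside: assumes "\<rho>' \<le> s" "s < 1" "z \<notin> Om \<psi> s" shows "z \<in> inside L1"
proof -
  have "z \<notin> L1" "z \<notin> outside L1"
    using L1_Om[OF assms(1,2)] Om_mono[of s 1] assms Om1 by auto
  then show ?thesis using inside_Un_outside[of L1] by blast
qed

lemma winding_inside: "z \<in> inside L1 \<Longrightarrow> winding_number c z = 1"
  using orient by (simp add: positively_oriented_def)

lemma winding_outside: "z \<in> outside L1 \<Longrightarrow> winding_number c z = 0"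
  by (rule winding_number_zero_in_outside[OF valid_path_imp_path[OF c_valid] c_loop])

lemma maximum_modulus_level:
  assumes t: "\<rho>' < t" and g: "g holomorphic_on UNIV"
    and B: "\<And>w. norm w = t \<Longrightarrow> norm (g (\<psi> w)) \<le> B" and z: "z \<notin> Om \<psi> t"
  shows "norm (g z) \<le> B"
proof (rule maximum_modulus_frontier[where S = "- Om \<psi> t" and f = g and \<xi> = z])
  show "g holomorphic_on interior (- Om \<psi> t)" using g by (rule holomorphic_on_subset) auto
  show "continuous_on (closure (- Om \<psi> t)) g"
    using g by (meson holomorphic_on_imp_continuous_on continuous_on_subset subset_UNIV)
  show "bounded (- Om \<psi> t)" using bounded_Compl_Om t by auto
  show "z \<in> - Om \<psi> t" using z by auto
  fix x assume "x \<in> frontier (- Om \<psi> t)"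
  then have "x \<in> \<psi> ` sphere 0 t" using frontier_Om[OF t] by (auto simp: frontier_complement)
  then show "norm (g x) \<le> B" using B by auto
qed

subsection \<open>Behaviour at infinity\<close>

text \<open>The limit of \<open>deriv \<psi>\<close> is also the limit of
  \<open>\<psi> w / w\<close>, and \<open>w = \<phi> z\<close> carries both over to
  \<open>\<phi>\<close>. The limit of \<open>q\<close> is the positive root of \<open>b\<close>
  because \<open>sqrt_dphi\<close> fixes the branch at infinity.\<close>

lemma asymptotics_at_infinity:
  "0 < b" "((\<lambda>z. \<phi> z / z) \<longlongrightarrow> of_real b) at_infinity" "(q \<longlongrightarrow> of_real (sqrt b)) at_infinity"
  "((\<lambda>z. z / \<phi> z) \<longlongrightarrow> of_real (1 / b)) at_infinity"
proof -
  obtain a :: real where a: "0 < a" "(deriv \<psi> \<longlongrightarrow> of_real a) at_infinity"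
    using ext_map by (auto simp: exterior_map_def pos_at_inf_def)
  have quot: "((\<lambda>w. \<psi> w / w) \<longlongrightarrow> of_real a) at_infinity"
    using univalent_at_infinity_quotient[OF _ _ psi_infinity a(2), of \<rho>'] univ_hol univ_inj
    by (auto simp: Ext_def)
  have ev: "eventually (\<lambda>z. z \<in> Om \<psi> \<rho>') at_infinity" by (rule eventually_in_Om) simp
  have "((\<lambda>z. inverse (deriv \<psi> (\<phi> z))) \<longlongrightarrow> inverse (of_real a)) at_infinity"
    using a(1) by (intro tendsto_inverse filterlim_compose[OF a(2) phi_infinity]) auto
  then have dl: "(deriv \<phi> \<longlongrightarrow> inverse (of_real a)) at_infinity"
    by (rule Lim_transform_eventually) (rule eventually_mono[OF ev], metis dphi psi_phi)
  then have "Lim at_infinity (deriv \<phi>) = inverse (of_real a)"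
    by (rule tendsto_Lim[OF trivial_limit_at_infinity])
  then have b: "b = inverse a" unfolding b_eq value_at_inf_def
    by (metis Re_complex_of_real of_real_inverse)
  then show "0 < b" using a(1) by simp
  have "((\<lambda>z. \<psi> (\<phi> z) / \<phi> z) \<longlongrightarrow> of_real a) at_infinity"
    by (rule filterlim_compose[OF quot phi_infinity])
  then have za: "((\<lambda>z. z / \<phi> z) \<longlongrightarrow> of_real a) at_infinity"
    by (rule Lim_transform_eventually) (rule eventually_mono[OF ev], metis psi_phi(1))
  have "1 / b = a" by (simp add: b divide_inverse)
  then show "((\<lambda>z. z / \<phi> z) \<longlongrightarrow> of_real (1 / b)) at_infinity" using za by (simp only:)
  have "((\<lambda>z. inverse (z / \<phi> z)) \<longlongrightarrow> inverse (of_real a)) at_infinity"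
    using a(1) by (intro tendsto_inverse za) auto
  then show "((\<lambda>z. \<phi> z / z) \<longlongrightarrow> of_real b) at_infinity" by (simp add: b)
  obtain x :: real where x: "0 < x" "(q \<longlongrightarrow> of_real x) at_infinity"
    using q by (auto simp: sqrt_dphi_def pos_at_inf_def)
  have "((\<lambda>z. (q z)\<^sup>2) \<longlongrightarrow> (of_real x)\<^sup>2) at_infinity" by (intro tendsto_intros x)
  then have "(deriv \<phi> \<longlongrightarrow> (of_real x)\<^sup>2) at_infinity"
    by (rule Lim_transform_eventually) (rule eventually_mono[OF ev q_sq])
  then have "(of_real x)\<^sup>2 = inverse (complex_of_real a)"
    using dl tendsto_unique trivial_limit_at_infinity by blast
  then have "of_real (x\<^sup>2) = complex_of_real b" by (simp add: b)
  then have "x\<^sup>2 = b" using of_real_eq_iff by blast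
  then have "sqrt b = x" using x(1) by (simp add: real_sqrt_unique)
  then show "(q \<longlongrightarrow> of_real (sqrt b)) at_infinity" using x(2) by simp
qed

lemma De_infinity: "0 < d" "(De \<longlongrightarrow> of_real d) at_infinity"
proof -
  obtain x :: real where x: "0 < x" "(De \<longlongrightarrow> of_real x) at_infinity"
    using De by (auto simp: exterior_szego_def pos_at_inf_def)
  then have "Lim at_infinity De = of_real x" by (intro tendsto_Lim[OF trivial_limit_at_infinity]) auto
  then have "d = x" by (simp add: d_eq value_at_inf_def)
  then show "0 < d" "(De \<longlongrightarrow> of_real d) at_infinity" using x by auto
qed

lemma closure_Om1: "closure (Om \<psi> 1) = outside L1 \<union> L1"
  using Jordan(3) closure_Un_frontier[of "outside L1"] by (simp add: Om1)

lemma De_nz: "z \<in> outside L1 \<union> L1 \<Longrightarrow> De z \<noteq> 0"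
  using De closure_Om1 by (auto simp: exterior_szego_def)

lemma De_h: "z \<in> L1 \<Longrightarrow> h z = of_real (1 / (norm (De z))\<^sup>2)"
  using De by (auto simp: exterior_szego_def)

subsection \<open>The weighted inner product\<close>

text \<open>The measure \<open>h(z) |dz| / (2 pi)\<close> on the curve, as a density in the
  parameter.\<close>

definition \<omega> where "\<omega> t = Re (h (c t)) * norm (c' t) / (2 * pi)"

definition ip where "ip u v = integral {0..1} (\<lambda>t. u (c t) * cnj (v (c t)) * of_real (\<omega> t))"

definition nsq where "nsq u = integral {0..1} (\<lambda>t. (norm (u (c t)))\<^sup>2 * \<omega> t)"

definition W where "W = integral {0..1} \<omega>"

lemma cont_c: "continuous_on L1 u \<Longrightarrow> continuous_on {0..1} (\<lambda>t. u (c t))"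
  by (rule continuous_on_compose2[of L1 u]) (auto intro: continuous_on_subset[OF c_cont] simp: c_per)

lemma h_eq: "z \<in> L1 \<Longrightarrow> Re (h z) = 1 / (norm (De z))\<^sup>2"
  using De_h by simp

text \<open>The zeros of \<open>De\<close> that are removed here all lie inside the curve.\<close>
definition S0 where "S0 = {z \<in> Om \<psi> \<rho>. De z \<noteq> 0}"

lemma S0_facts: "open S0" "L1 \<subseteq> S0" "outside L1 \<subseteq> S0" "S0 \<subseteq> Om \<psi> \<rho>" "S0 \<subseteq> Om \<psi> \<rho>'"
  "De holomorphic_on S0" "q holomorphic_on S0" "\<phi> holomorphic_on S0"
proof -
  have "open (Om \<psi> \<rho> \<inter> De -` (- {0}))"
    by (rule continuous_open_preimage[OF holomorphic_on_imp_continuous_on[OF De_hol] open_Om])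
       (use rho_ge in auto)
  moreover have "Om \<psi> \<rho> \<inter> De -` (- {0}) = S0" by (auto simp: S0_def)
  ultimately show "open S0" by simp
  show "L1 \<subseteq> S0" using L1_Om[of \<rho>] rho_ge rho1 De_nz by (auto simp: S0_def)
  show "outside L1 \<subseteq> S0" using Om_mono[of \<rho> 1] rho1 De_nz Om1 by (auto simp: S0_def)
  show 1: "S0 \<subseteq> Om \<psi> \<rho>" by (auto simp: S0_def)
  then show 2: "S0 \<subseteq> Om \<psi> \<rho>'" using Om_mono[OF rho_ge] by auto
  show "De holomorphic_on S0" "q holomorphic_on S0" "\<phi> holomorphic_on S0"
    using 1 2 De_hol q_hol phi_hol holomorphic_on_subset by blast+
qed

lemma S0_nz: assumes "z \<in> S0" shows "De z \<noteq> 0" "q z \<noteq> 0" "\<phi> z \<noteq> 0"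
proof -
  have "z \<in> Om \<psi> \<rho>'" using S0_facts(5) assms by auto
  then show "q z \<noteq> 0" "\<phi> z \<noteq> 0" by (auto simp: q_nz phi_nz)
  show "De z \<noteq> 0" using assms by (auto simp: S0_def)
qed

lemma hol_S0_cont: "u holomorphic_on S0 \<Longrightarrow> continuous_on L1 u"
  using S0_facts(2) continuous_on_subset holomorphic_on_imp_continuous_on by blast

lemma De_L1_cont: "continuous_on L1 De" by (rule hol_S0_cont) (rule S0_facts)

lemma omega_cont: "continuous_on {0..1} \<omega>"
proof -
  have "continuous_on {0..1} (\<lambda>t. 1 / (norm (De (c t)))\<^sup>2 * norm (c' t) / (2 * pi))"
    using De_nz c_per
    by (intro continuous_intros cont_c De_L1_cont continuous_on_subset[OF c'_cont]) auto
  then show ?thesis by (rule continuous_on_eq) (simp add: \<omega>_def h_eq c_per)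
qed

lemma omega_pos: "0 < \<omega> t"
  unfolding \<omega>_def using hpos[OF c_per] c'_nz by simp

lemma W_nonneg: "0 \<le> W" unfolding W_def
  by (rule integral_nonneg[OF integrable_continuous_interval[OF omega_cont]]) (simp add: omega_pos less_imp_le)

lemma ip_integrable:
  assumes "continuous_on L1 u" "continuous_on L1 v"
  shows "(\<lambda>t. u (c t) * cnj (v (c t)) * of_real (\<omega> t)) integrable_on {0..1}"
  by (intro integrable_continuous_interval continuous_intros omega_cont cont_c assms)

lemma ip_add: assumes "continuous_on L1 u" "continuous_on L1 v" "continuous_on L1 w"
  shows "ip (\<lambda>z. u z + v z) w = ip u w + ip v w"
  unfolding ip_def
  by (subst integral_add[OF ip_integrable[OF assms(1,3)] ip_integrable[OF assms(2,3)], symmetric])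
     (simp add: algebra_simps)

lemma ip_diff: assumes "continuous_on L1 u" "continuous_on L1 v" "continuous_on L1 w"
  shows "ip (\<lambda>z. u z - v z) w = ip u w - ip v w"
  unfolding ip_def
  by (subst integral_diff[OF ip_integrable[OF assms(1,3)] ip_integrable[OF assms(2,3)], symmetric])
     (simp add: algebra_simps)

lemma ip_cmult: "ip (\<lambda>z. k * u z) w = k * ip u w"
  unfolding ip_def by (subst integral_mult_right[symmetric]) (simp add: mult.assoc)

lemma ip_cnj: "ip v u = cnj (ip u v)"
  unfolding ip_def integral_cnj by (simp add: mult.commute)

lemma ip_sum: assumes "finite K" "\<And>k. k \<in> K \<Longrightarrow> continuous_on L1 (u k)" "continuous_on L1 w"
  shows "ip (\<lambda>z. \<Sum>k\<in>K. u k z) w = (\<Sum>k\<in>K. ip (u k) w)"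
  using assms
proof (induction K)
  case empty
  then show ?case by (simp add: ip_def)
next
  case (insert x K)
  then show ?case by (simp add: ip_add continuous_on_sum)
qed

lemma ip_self: assumes "continuous_on L1 u" shows "ip u u = of_real (nsq u)"
proof -
  have "((\<lambda>t. (norm (u (c t)))\<^sup>2 * \<omega> t) has_integral nsq u) {0..1}"
    unfolding nsq_def
    by (intro integrable_integral integrable_continuous_interval continuous_intros cont_c assms omega_cont)
  then have "((\<lambda>t. complex_of_real ((norm (u (c t)))\<^sup>2 * \<omega> t)) has_integral of_real (nsq u)) {0..1}"
    by (rule has_integral_of_real)
  moreover have "(\<lambda>t. complex_of_real ((norm (u (c t)))\<^sup>2 * \<omega> t))
      = (\<lambda>t. u (c t) * cnj (u (c t)) * of_real (\<omega> t))"
    by (simp add: complex_norm_square del: of_real_power)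
  ultimately show ?thesis unfolding ip_def by (simp add: integral_unique)
qed

lemma nsq_nonneg: assumes "continuous_on L1 u" shows "0 \<le> nsq u"
  unfolding nsq_def
  by (intro integral_nonneg integrable_continuous_interval continuous_intros cont_c assms omega_cont)
     (simp add: omega_pos less_imp_le)

lemma nsq_diff_cmult: assumes "continuous_on L1 u" "continuous_on L1 v"
  shows "nsq (\<lambda>z. u z - of_real k * v z) = nsq u - 2 * k * Re (ip u v) + k\<^sup>2 * nsq v"
proof -
  have cv: "continuous_on L1 (\<lambda>z. of_real k * v z)" by (intro continuous_intros assms)
  let ?w = "\<lambda>z. u z - of_real k * v z"
  have cw: "continuous_on L1 ?w" by (intro continuous_intros assms)
  have "ip ?w ?w = ip u ?w - of_real k * ip v ?w"
    using ip_diff[OF assms(1) cv cw] by (simp add: ip_cmult)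
  also have "ip u ?w = ip u u - of_real k * ip u v"
    unfolding ip_cnj[of u ?w] ip_diff[OF assms(1) cv assms(1)] ip_cmult
    by (simp add: ip_cnj[symmetric])
  also have "ip v ?w = ip v u - of_real k * ip v v"
    unfolding ip_cnj[of v ?w] ip_diff[OF assms(1) cv assms(2)] ip_cmult
    by (simp add: ip_cnj[symmetric])
  finally have "ip ?w ?w = of_real (nsq u) - of_real k * (ip u v + cnj (ip u v)) + of_real (k\<^sup>2 * nsq v)"
    unfolding ip_self[OF assms(1)] ip_self[OF assms(2)] ip_cnj[of v u] by (simp add: algebra_simps power2_eq_square)
  also have "\<dots> = of_real (nsq u - 2 * k * Re (ip u v) + k\<^sup>2 * nsq v)"
    by (simp add: complex_add_cnj)
  finally show ?thesis unfolding ip_self[OF cw] using of_real_eq_iff by blast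
qed

lemma nsq_bound: assumes "continuous_on L1 u" "\<And>z. z \<in> L1 \<Longrightarrow> norm (u z) \<le> C"
  shows "nsq u \<le> C\<^sup>2 * W"
proof -
  have "nsq u \<le> integral {0..1} (\<lambda>t. C\<^sup>2 * \<omega> t)"
    unfolding nsq_def
  proof (rule integral_le)
    fix t :: real
    have "(norm (u (c t)))\<^sup>2 \<le> C\<^sup>2" using assms(2)[OF c_per] by (intro power_mono) auto
    then show "(norm (u (c t)))\<^sup>2 * \<omega> t \<le> C\<^sup>2 * \<omega> t" using omega_pos[of t] by (intro mult_right_mono) auto
  qed (intro integrable_continuous_interval continuous_intros cont_c assms omega_cont)+
  then show ?thesis by (simp add: W_def)
qed

text \<open>Does the work of the Cauchy-Schwarz inequality, by the pointwise bound
  \<open>|v| <= |v|^2 / \<eta> + \<eta>\<close>. With \<open>\<eta>\<close> of the order of the norm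
  of \<open>v\<close>, both terms have that order.\<close>

lemma ip_bound: assumes "continuous_on L1 u" "continuous_on L1 v"
    and "\<And>z. z \<in> L1 \<Longrightarrow> norm (u z) \<le> C" and "0 < \<eta>" and "0 \<le> C"
  shows "norm (ip u v) \<le> C * (nsq v / \<eta> + \<eta> * W)"
proof -
  have "norm (ip u v) \<le> integral {0..1} (\<lambda>t. C * (1 / \<eta> * ((norm (v (c t)))\<^sup>2 * \<omega> t) + \<eta> * \<omega> t))"
    unfolding ip_def
  proof (rule integral_norm_bound_integral)
    fix t :: real
    have "norm (u (c t)) * norm (v (c t)) \<le> C * ((norm (v (c t)))\<^sup>2 / \<eta> + \<eta>)"
    proof (rule mult_mono[OF assms(3)[OF c_per]])
      let ?x = "norm (v (c t))"
      have "0 \<le> (?x - \<eta>)\<^sup>2 + ?x * \<eta>" using assms(4) by simp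
      then have "?x * \<eta> \<le> ?x\<^sup>2 + \<eta> * \<eta>" by (simp add: power2_eq_square algebra_simps)
      then have "?x \<le> (?x\<^sup>2 + \<eta> * \<eta>) / \<eta>" using assms(4) by (simp add: pos_le_divide_eq)
      also have "\<dots> = ?x\<^sup>2 / \<eta> + \<eta>" using assms(4) by (simp add: add_divide_distrib)
      finally show "?x \<le> ?x\<^sup>2 / \<eta> + \<eta>" .
    qed (use assms in auto)
    then have "norm (u (c t)) * norm (v (c t)) * \<omega> t \<le> C * ((norm (v (c t)))\<^sup>2 / \<eta> + \<eta>) * \<omega> t"
      using omega_pos[of t] by (intro mult_right_mono) auto
    also have "\<dots> = C * (1 / \<eta> * ((norm (v (c t)))\<^sup>2 * \<omega> t) + \<eta> * \<omega> t)" by (simp add: algebra_simps)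
    finally show "norm (u (c t) * cnj (v (c t)) * of_real (\<omega> t)) \<le> \<dots>"
      using omega_pos[of t] by (simp add: norm_mult)
  qed (intro integrable_continuous_interval continuous_intros cont_c assms omega_cont)+
  also have "\<dots> = C * (nsq v / \<eta> + \<eta> * W)"
  proof -
    have "integral {0..1} (\<lambda>t. 1 / \<eta> * ((norm (v (c t)))\<^sup>2 * \<omega> t) + \<eta> * \<omega> t)
        = integral {0..1} (\<lambda>t. 1 / \<eta> * ((norm (v (c t)))\<^sup>2 * \<omega> t)) + integral {0..1} (\<lambda>t. \<eta> * \<omega> t)"
      by (rule integral_add) (intro integrable_continuous_interval continuous_intros cont_c assms omega_cont)+
    also have "\<dots> = nsq v / \<eta> + \<eta> * W"
      unfolding integral_mult_right nsq_def W_def by simp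
    finally show ?thesis by simp
  qed
  finally show ?thesis .
qed

subsection \<open>Orthonormal polynomials and the exterior approximants\<close>

lemma poly_cont: "continuous_on A (poly (F :: complex poly))"
  by (intro continuous_intros)

lemma contour_c: "contour_integral c g = integral {0..1} (\<lambda>t. g (c t) * c' t)"
  unfolding contour_integral_integral using vector_derivative_at[OF c_der] by simp

lemma orthonormal: "ip (poly (p n)) (poly (p m)) = (if n = m then 1 else 0)"
proof -
  have vd: "vector_derivative c (at t within {0..1}) = c' t" if "t \<in> {0..1}" for t
    by (rule vector_derivative_at_within_ivl[OF c_der]) (use that in auto)
  let ?u = "\<lambda>z. poly (p n) z * cnj (poly (p m) z) * h z"
  have "1 / (2 * of_real pi) * arclength_integral c ?u
      = integral {0..1} (\<lambda>t. 1 / (2 * of_real pi) * (?u (c t) * of_real (norm (c' t))))"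
    unfolding arclength_integral_def integral_mult_right
    by (subst integral_cong[where g = "\<lambda>t. ?u (c t) * of_real (norm (c' t))"]) (simp_all add: vd)
  also have "\<dots> = ip (poly (p n)) (poly (p m))"
    unfolding ip_def
  proof (rule integral_cong)
    fix t :: real
    have "h (c t) = of_real (Re (h (c t)))" using hpos[OF c_per] by (simp add: complex_is_Real_iff complex_eq_iff)
    then show "1 / (2 * of_real pi) * (?u (c t) * of_real (norm (c' t)))
        = poly (p n) (c t) * cnj (poly (p m) (c t)) * of_real (\<omega> t)"
      unfolding \<omega>_def by (simp add: field_simps)
  qed
  finally show ?thesis using polys by (simp add: orthonormal_polys_def)
qed

lemma deg_p: "degree (p n) = n" and lead_p: "coeff (p n) n = of_real (lc n)" and lc_pos: "0 < lc n"
proof -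
  have "degree (p n) = n \<and> lead_coeff (p n) = of_real (lc n) \<and> 0 < lc n"
    using polys unfolding orthonormal_polys_def by blast
  then show "degree (p n) = n" "coeff (p n) n = of_real (lc n)" "0 < lc n" by auto
qed

text \<open>The expected values: \<open>\<kappa> n\<close> for \<open>lc n\<close>, and \<open>B n / \<kappa> n\<close> for the monic polynomial.\<close>
definition \<kappa> where "\<kappa> n = d * sqrt b * b ^ n"

definition B where "B n z = De z * q z * \<phi> z ^ n"

lemma b_pos: "0 < b" by (rule asymptotics_at_infinity)

lemma kappa_pos: "0 < \<kappa> n" unfolding \<kappa>_def using b_pos De_infinity by simp

lemma kappa_powr: "\<kappa> n = d * b powr (real n + 1 / 2)"
  using b_pos by (simp add: \<kappa>_def powr_add powr_realpow powr_half_sqrt)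

lemma B_hol: "B n holomorphic_on Om \<psi> \<rho>"
proof -
  have s: "Om \<psi> \<rho> \<subseteq> Om \<psi> \<rho>'" by (rule Om_mono[OF rho_ge])
  show ?thesis unfolding B_def
    by (intro holomorphic_intros De_hol holomorphic_on_subset[OF q_hol s] holomorphic_on_subset[OF phi_hol s])
qed

lemma B_cont: "continuous_on L1 (B n)"
  using B_hol S0_facts(2,4) by (meson continuous_on_subset holomorphic_on_imp_continuous_on order_trans)

lemma B_infinity: "((\<lambda>z. B n z / z ^ n) \<longlongrightarrow> of_real (\<kappa> n)) at_infinity"
proof -
  have "((\<lambda>z. De z * q z * (\<phi> z / z) ^ n) \<longlongrightarrow> of_real d * of_real (sqrt b) * of_real b ^ n) at_infinity"
    by (intro tendsto_intros De_infinity asymptotics_at_infinity)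
  then show ?thesis by (simp add: B_def \<kappa>_def power_divide)
qed

lemma poly_at_infinity:
  fixes F :: "complex poly"
  assumes "degree F \<le> n" shows "((\<lambda>z. poly F z / z ^ n) \<longlongrightarrow> coeff F n) at_infinity"
  using assms
proof (induction n arbitrary: F)
  case 0
  then obtain a where "F = [:a:]" using degree_eq_zeroE by auto
  then show ?case by simp
next
  case (Suc n)
  obtain a G where F: "F = pCons a G" by (cases F)
  have "degree G \<le> n" using Suc.prems by (auto simp: F split: if_splits)
  then have "((\<lambda>z. (a / z) * (1 / z) ^ n + poly G z / z ^ n) \<longlongrightarrow> 0 * 0 ^ n + coeff G n) at_infinity"
    by (intro tendsto_intros Suc.IH tendsto_divide_0[OF tendsto_const] filterlim_ident)
  then have "((\<lambda>z. (a / z) * (1 / z) ^ n + poly G z / z ^ n) \<longlongrightarrow> coeff F (Suc n)) at_infinity"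
    by (simp add: F)
  then show ?case
    by (rule tendsto_at_infinity_cong_ne) (simp add: F field_simps power_divide)
qed

lemma exterior_contour:
  assumes "G holomorphic_on S0" "((\<lambda>z. z * G z) \<longlongrightarrow> L) at_infinity"
  shows "contour_integral c G = 2 * of_real pi * \<i> * L"
proof -
  \<comment> \<open>An inside point is deleted from \<open>S0\<close>, so that a centre of inversion
    outside the domain is available.\<close>
  obtain z0 where z0: "z0 \<in> inside L1" using Jordan(5) by auto
  have ins: "x \<in> inside L1" if "x \<notin> S0 - {z0}" for x
    using that z0 S0_facts inside_Un_outside[of L1] by blast
  have bd: "bounded (- (S0 - {z0}))"
    by (rule bounded_subset[of "inside L1"])
       (use ins bounded_inside[of L1] L1_compact compact_imp_bounded in auto)
  have sub: "L1 \<subseteq> S0 - {z0}" using S0_facts(2) z0 inside_no_overlap[of L1] by blast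
  have "(G has_contour_integral 2 * of_real pi * \<i> * L) c"
    by (rule contour_integral_exterior[of "S0 - {z0}" _ z0])
       (use S0_facts(1) c_valid c_loop sub ins winding_inside bd assms(2)
          holomorphic_on_subset[OF assms(1)] in \<open>auto simp: open_delete\<close>)
  then show ?thesis by (rule contour_integral_unique)
qed

text \<open>The sign depends on the orientation of the curve; it is identified from \<open>0 \<le> nsq (B 0)\<close> below.\<close>
lemma ip_B_sign:
  obtains \<sigma> where "\<sigma> = 1 \<or> \<sigma> = - 1"
    "\<And>u n. ip u (B n) = \<sigma> / (2 * of_real pi * \<i>) * contour_integral c (\<lambda>z. u z * q z / (De z * \<phi> z ^ Suc n))"
proof -
  have Lp: "c t \<in> Om \<psi> \<rho>'" for t using c_per[of t] S0_facts(2,5) by auto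
  obtain \<sigma> where \<sigma>: "\<sigma> = 1 \<or> \<sigma> = - 1"
    "\<And>t. of_real (norm (deriv \<phi> (c t)) * norm (c' t)) = \<sigma> * deriv \<phi> (c t) * c' t / (\<i> * \<phi> (c t))"
    using unimodular_tangent[OF c_der c'_cont c'_nz open_Om[of \<rho>'] phi_hol Lp] phi_L1[OF c_per] dphi_nz[OF Lp]
    by auto
  have "ip u (B n) = \<sigma> / (2 * of_real pi * \<i>) * contour_integral c (\<lambda>z. u z * q z / (De z * \<phi> z ^ Suc n))" for u n
    unfolding ip_def contour_c integral_mult_right[symmetric]
  proof (rule integral_cong)
    fix t :: real
    define z where "z = c t"
    have z: "z \<in> L1" "z \<in> Om \<psi> \<rho>'" "z \<in> S0" using c_per Lp S0_facts by (auto simp: z_def)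
    have nz: "De z \<noteq> 0" "q z \<noteq> 0" "\<phi> z \<noteq> 0" using S0_nz z by auto
    \<comment> \<open>On the curve the conjugates become analytic expressions:
      \<open>1 / \<phi>\<close> for \<open>cnj \<phi>\<close>, \<open>1 / De\<close> for
      \<open>cnj De * h\<close>, and \<open>\<sigma> q c' / (i \<phi>)\<close> for
      \<open>cnj q |c'|\<close> by the tangent identity. This is what turns the pairing into a
      contour integral.\<close>
    have cq: "cnj (\<phi> z) = 1 / \<phi> z"
      using phi_L1[OF z(1)] nz(3) complex_norm_square[of "\<phi> z"] by (simp add: field_simps)
    have qq: "of_real (norm (deriv \<phi> z)) = q z * cnj (q z)"
      unfolding q_sq[OF z(2), symmetric] norm_power complex_norm_square by simp
    have "q z * cnj (q z) * of_real (norm (c' t)) = \<sigma> * (q z)\<^sup>2 * c' t / (\<i> * \<phi> z)"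
      using \<sigma>(2)[of t] unfolding z_def[symmetric] q_sq[OF z(2)] by (simp add: qq)
    then have cc: "cnj (q z) * of_real (norm (c' t)) = \<sigma> * q z * c' t / (\<i> * \<phi> z)"
      using nz by (simp add: power2_eq_square field_simps)
    have hh: "cnj (De z) * of_real (Re (h z)) = 1 / De z"
      unfolding h_eq[OF z(1)] using nz complex_norm_square[of "De z"] by (simp add: field_simps)
    have "u z * cnj (B n z) * of_real (\<omega> t)
        = u z * (cnj (De z) * of_real (Re (h z))) * (cnj (q z) * of_real (norm (c' t))) * (cnj (\<phi> z)) ^ n / (2 * of_real pi)"
      by (simp add: B_def \<omega>_def z_def)
    also have "\<dots> = \<sigma> / (2 * of_real pi * \<i>) * (u z * q z / (De z * \<phi> z ^ Suc n) * c' t)"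
      unfolding hh cc cq using nz by (simp add: field_simps power_divide)
    finally show "u (c t) * cnj (B n (c t)) * of_real (\<omega> t)
        = \<sigma> / (2 * of_real pi * \<i>) * (u (c t) * q (c t) / (De (c t) * \<phi> (c t) ^ Suc n) * c' t)"
      by (simp add: z_def)
  qed
  with \<sigma>(1) that show ?thesis by blast
qed

text \<open>The residue at infinity collects the limits of \<open>q\<close>, \<open>De\<close> and
  \<open>z / \<phi> z\<close>; since \<open>sqrt b * sqrt b = b\<close>, the quotient
  \<open>sqrt b / (d * b ^ Suc n)\<close> is exactly \<open>1 / \<kappa> n\<close>.\<close>

lemma ip_B_aux:
  assumes "u holomorphic_on S0" "((\<lambda>z. u z / z ^ n) \<longlongrightarrow> a) at_infinity"
  shows "contour_integral c (\<lambda>z. u z * q z / (De z * \<phi> z ^ Suc n)) = 2 * of_real pi * \<i> * (a / of_real (\<kappa> n))"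
proof (rule exterior_contour)
  show "(\<lambda>z. u z * q z / (De z * \<phi> z ^ Suc n)) holomorphic_on S0"
    by (intro holomorphic_intros assms S0_facts) (use S0_nz in auto)
  have "((\<lambda>z. u z / z ^ n * q z / De z * (z / \<phi> z) ^ Suc n)
      \<longlongrightarrow> a * of_real (sqrt b) / of_real d * of_real (1 / b) ^ Suc n) at_infinity"
    using De_infinity(1) by (intro tendsto_intros assms asymptotics_at_infinity De_infinity) auto
  moreover have "a * of_real (sqrt b) / of_real d * of_real (1 / b) ^ Suc n = a / of_real (\<kappa> n)"
  proof -
    have "sqrt b / d * (1 / b) ^ Suc n = 1 / \<kappa> n"
      using b_pos real_sqrt_mult_self[of b] De_infinity(1) by (simp add: \<kappa>_def field_simps)
    then have "of_real (sqrt b / d * (1 / b) ^ Suc n) = complex_of_real (1 / \<kappa> n)" by (rule arg_cong)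
    then have "of_real (sqrt b) / of_real d * of_real (1 / b) ^ Suc n = 1 / complex_of_real (\<kappa> n)"
      by (simp only: of_real_mult of_real_divide of_real_power of_real_1)
    then have "a * (of_real (sqrt b) / of_real d * of_real (1 / b) ^ Suc n) = a * (1 / complex_of_real (\<kappa> n))"
      by (rule arg_cong)
    then show ?thesis by (simp only: times_divide_eq_left times_divide_eq_right mult_1_right mult.assoc)
  qed
  ultimately have "((\<lambda>z. u z / z ^ n * q z / De z * (z / \<phi> z) ^ Suc n) \<longlongrightarrow> a / of_real (\<kappa> n)) at_infinity"
    by simp
  then show "((\<lambda>z. z * (u z * q z / (De z * \<phi> z ^ Suc n))) \<longlongrightarrow> a / of_real (\<kappa> n)) at_infinity"
    by (rule tendsto_at_infinity_cong_ne) (simp add: field_simps power_divide)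
qed

lemma B_hol_S0: "B n holomorphic_on S0" using B_hol S0_facts(4) holomorphic_on_subset by blast

lemma ip_B:
  assumes "u holomorphic_on S0" "((\<lambda>z. u z / z ^ n) \<longlongrightarrow> a) at_infinity"
  shows "ip u (B n) = a / of_real (\<kappa> n)"
proof -
  obtain \<sigma> where \<sigma>: "\<sigma> = 1 \<or> \<sigma> = - 1"
    "\<And>u n. ip u (B n) = \<sigma> / (2 * of_real pi * \<i>) * contour_integral c (\<lambda>z. u z * q z / (De z * \<phi> z ^ Suc n))"
    by (rule ip_B_sign) (rule that)
  have cancel: "\<sigma> / K * (K * x) = \<sigma> * x" if "K \<noteq> 0" for K x :: complex using that by simp
  have *: "ip u (B n) = \<sigma> * (a / of_real (\<kappa> n))"
    if "u holomorphic_on S0" "((\<lambda>z. u z / z ^ n) \<longlongrightarrow> a) at_infinity" for u n a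
    unfolding \<sigma>(2) ip_B_aux[OF that] by (rule cancel) simp
  have "of_real (nsq (B 0)) = \<sigma>"
    using *[OF B_hol_S0 B_infinity, of 0] kappa_pos[of 0] by (simp add: ip_self[OF B_cont])
  moreover have "0 \<le> nsq (B 0)" by (rule nsq_nonneg[OF B_cont])
  ultimately have "\<sigma> = 1" using \<sigma>(1)
    by (metis Re_complex_of_real neg_0_le_iff_le not_one_le_zero of_real_1 of_real_minus)
  then show ?thesis using *[OF assms] by simp
qed

lemma ip_poly_B:
  assumes "degree F \<le> n" shows "ip (poly F) (B n) = coeff F n / of_real (\<kappa> n)"
  by (rule ip_B[OF _ poly_at_infinity[OF assms]]) (intro holomorphic_intros)

lemma nsq_B: "nsq (B n) = 1"
  using ip_B[OF B_hol_S0 B_infinity, of n] kappa_pos[of n] by (simp add: ip_self[OF B_cont])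

lemma ip_vanish_B:
  assumes "u holomorphic_on S0" "(u \<longlongrightarrow> 0) at_infinity" shows "ip u (B n) = 0"
proof -
  have "((\<lambda>z. u z * (1 / z) ^ n) \<longlongrightarrow> 0 * 0 ^ n) at_infinity"
    by (intro tendsto_intros assms tendsto_divide_0[OF tendsto_const] filterlim_ident)
  then have "((\<lambda>z. u z / z ^ n) \<longlongrightarrow> 0) at_infinity" by (simp add: power_divide)
  from ip_B[OF assms(1) this] show ?thesis by simp
qed

text \<open>A generalized Faber polynomial: that of \<open>\<phi> ^ n\<close> with the factor
  \<open>De * q\<close>. Asking for the limit 0 fixes its constant term as well.\<close>

definition Fp where
  "Fp n = (SOME F. degree F \<le> n \<and> coeff F n = of_real (\<kappa> n) \<and> ((\<lambda>z. poly F z - B n z) \<longlongrightarrow> 0) at_infinity)"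

definition R where "R n z = poly (Fp n) z - B n z"

lemma Fp: "degree (Fp n) \<le> n" "coeff (Fp n) n = of_real (\<kappa> n)" "(R n \<longlongrightarrow> 0) at_infinity"
proof -
  obtain M where "M > 0" "{z. M < norm z} \<subseteq> Om \<psi> \<rho>" using Om_far[OF rho_ge] .
  then have "B n holomorphic_on {z. M < norm z}" using B_hol holomorphic_on_subset by blast
  from polynomial_part_at_infinity[OF this B_infinity]
  have "degree (Fp n) \<le> n \<and> coeff (Fp n) n = of_real (\<kappa> n) \<and> ((\<lambda>z. poly (Fp n) z - B n z) \<longlongrightarrow> 0) at_infinity"
    unfolding Fp_def by (rule someI_ex)
  then show "degree (Fp n) \<le> n" "coeff (Fp n) n = of_real (\<kappa> n)" "(R n \<longlongrightarrow> 0) at_infinity"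
    by (auto simp: R_def[abs_def])
qed

lemma R_hol: "R n holomorphic_on Om \<psi> \<rho>"
  unfolding R_def by (intro holomorphic_intros B_hol)

lemma R_hol_S0: "R n holomorphic_on S0" using R_hol S0_facts(4) holomorphic_on_subset by blast

lemma R_cont: "continuous_on L1 (R n)" by (rule hol_S0_cont[OF R_hol_S0])

subsection \<open>The level curves as contours\<close>

abbreviation "level s \<equiv> \<psi> \<circ> circlepath 0 s"

lemma psi_asymptotics:
  "((\<lambda>w. w / \<psi> w) \<longlongrightarrow> of_real b) at_infinity" "(deriv \<psi> \<longlongrightarrow> of_real (1 / b)) at_infinity"
proof -
  have ev: "eventually (\<lambda>w::complex. \<rho>' < norm w) at_infinity"
    unfolding eventually_at_infinity by (intro exI[of _ "\<rho>' + 1"]) auto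
  have "((\<lambda>w. \<phi> (\<psi> w) / \<psi> w) \<longlongrightarrow> of_real b) at_infinity"
    by (rule filterlim_compose[OF asymptotics_at_infinity(2) psi_infinity])
  then show "((\<lambda>w. w / \<psi> w) \<longlongrightarrow> of_real b) at_infinity"
    by (rule Lim_transform_eventually) (rule eventually_mono[OF ev], simp add: phi_psi)
  have "((\<lambda>w. inverse ((q (\<psi> w))\<^sup>2)) \<longlongrightarrow> inverse ((of_real (sqrt b))\<^sup>2)) at_infinity"
    using b_pos by (intro tendsto_intros filterlim_compose[OF asymptotics_at_infinity(3) psi_infinity]) auto
  moreover have "inverse ((of_real (sqrt b))\<^sup>2) = complex_of_real (1 / b)"
    using b_pos by (simp add: of_real_power[symmetric] inverse_eq_divide del: of_real_power)
  ultimately have "((\<lambda>w. inverse ((q (\<psi> w))\<^sup>2)) \<longlongrightarrow> of_real (1 / b)) at_infinity" by simp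
  then show "(deriv \<psi> \<longlongrightarrow> of_real (1 / b)) at_infinity"
  proof (rule Lim_transform_eventually)
    show "eventually (\<lambda>w. inverse ((q (\<psi> w))\<^sup>2) = deriv \<psi> w) at_infinity"
    proof (rule eventually_mono[OF ev])
      fix w :: complex assume w: "\<rho>' < norm w"
      then have "\<psi> w \<in> Om \<psi> \<rho>'" by (auto simp: Om_def Ext_def)
      then show "inverse ((q (\<psi> w))\<^sup>2) = deriv \<psi> w" using w by (simp add: q_sq dphi)
    qed
  qed
qed

lemma psi_analytic: "\<psi> analytic_on Ext \<rho>'"
  using univ_hol open_Ext by (simp add: analytic_on_open)

lemma level_contour:
  assumes "\<rho>' < s" shows "contour_integral (level s) g = contour_integral (circlepath 0 s) (\<lambda>w. deriv \<psi> w * g (\<psi> w))"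
  by (rule contour_integral_comp_analyticW[OF psi_analytic]) (use assms rho_bounds in \<open>auto simp: Ext_def\<close>)

lemma level_path: assumes "\<rho>' < s"
  shows "valid_path (level s)" "pathfinish (level s) = pathstart (level s)" "path_image (level s) = \<psi> ` sphere 0 s"
proof -
  show "valid_path (level s)"
    by (rule valid_path_compose_holomorphic[OF valid_path_circlepath univ_hol open_Ext])
       (use assms rho_bounds in \<open>auto simp: Ext_def\<close>)
  show "pathfinish (level s) = pathstart (level s)"
    by (simp add: pathfinish_compose pathstart_compose)
  show "path_image (level s) = \<psi> ` sphere 0 s"
    using assms rho_bounds by (simp add: path_image_compose)
qed

text \<open>Pulled back by \<open>\<psi>\<close>, the level curve is a circle with explicit winding
  numbers. The limits \<open>1 / b\<close> of \<open>deriv \<psi>\<close> and \<open>b\<close> of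
  \<open>w / \<psi> w\<close> cancel, so the residue at infinity survives the change of
  variable.\<close>

lemma exterior_contour_level:
  assumes t: "\<rho>' \<le> t" "t < s" and G: "G holomorphic_on Om \<psi> t"
    and lim: "((\<lambda>z. z * G z) \<longlongrightarrow> L) at_infinity"
  shows "contour_integral (level s) G = 2 * of_real pi * \<i> * L"
proof -
  have t0: "0 \<le> t" using t rho_bounds by simp
  have "((\<lambda>w. deriv \<psi> w * G (\<psi> w)) has_contour_integral 2 * of_real pi * \<i> * L) (circlepath 0 s)"
  proof (rule contour_integral_exterior[of "Ext t" _ 0])
    show "open (Ext t)" by (rule open_Ext)
    show "path_image (circlepath 0 s) \<subseteq> Ext t" using t t0 by (auto simp: Ext_def)
    show "winding_number (circlepath 0 s) x = 1" if "x \<notin> Ext t" for x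
      using winding_number_circlepath[of x 0 s] that t by (auto simp: Ext_def)
    show "(0::complex) \<notin> Ext t" using t0 by (auto simp: Ext_def)
    have "- Ext t = cball 0 t" by (auto simp: Ext_def)
    then show "bounded (- Ext t)" by simp
    show "(\<lambda>w. deriv \<psi> w * G (\<psi> w)) holomorphic_on Ext t"
      by (intro holomorphic_intros holomorphic_deriv psi_hol open_Ext
          holomorphic_on_compose_gen[OF psi_hol G, unfolded o_def]) (use t in \<open>auto simp: Om_def\<close>)
    have "((\<lambda>w. deriv \<psi> w * (w / \<psi> w) * (\<psi> w * G (\<psi> w))) \<longlongrightarrow> of_real (1 / b) * of_real b * L) at_infinity"
      by (intro tendsto_intros psi_asymptotics filterlim_compose[OF lim psi_infinity])
    then have lim': "((\<lambda>w. deriv \<psi> w * (w / \<psi> w) * (\<psi> w * G (\<psi> w))) \<longlongrightarrow> L) at_infinity" using b_pos by simp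
    have "eventually (\<lambda>w. \<psi> w \<noteq> 0) at_infinity"
      using filterlim_iff[THEN iffD1, OF psi_infinity, rule_format, OF eventually_not_equal_at_infinity] .
    then have "eventually (\<lambda>w. deriv \<psi> w * (w / \<psi> w) * (\<psi> w * G (\<psi> w)) = w * (deriv \<psi> w * G (\<psi> w))) at_infinity"
      by (rule eventually_mono) simp
    then show "((\<lambda>w. w * (deriv \<psi> w * G (\<psi> w))) \<longlongrightarrow> L) at_infinity"
      by (rule Lim_transform_eventually[OF lim'])
  qed simp_all
  then show ?thesis using level_contour[of s] t by (simp add: contour_integral_unique)
qed

text \<open>\<open>Om \<psi> s\<close> is connected, unbounded and disjoint from the level curve, so
  it lies in an unbounded component of the complement.\<close>

lemma winding_level_outside:
  assumes s: "\<rho>' < s" and z: "z \<in> Om \<psi> s"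
  shows "winding_number (level s) z = 0"
proof -
  have "connected (Om \<psi> s)" unfolding Om_def
  proof (rule connected_continuous_image)
    show "continuous_on (Ext s) \<psi>" using s psi_hol holomorphic_on_imp_continuous_on less_imp_le by blast
    have "Ext s = - cball 0 s" by (auto simp: Ext_def)
    then show "connected (Ext s)" by (simp add: connected_complement_bounded_convex)
  qed
  moreover have "Om \<psi> s \<subseteq> - path_image (level s)"
  proof
    fix x assume x: "x \<in> Om \<psi> s"
    show "x \<in> - path_image (level s)"
    proof
      assume "x \<in> path_image (level s)"
      then obtain w where "norm w = s" "x = \<psi> w" using level_path(3)[OF s] by auto
      then show False using x psi_in_Om_iff[of s w] s by simp
    qed
  qed
  ultimately have "Om \<psi> s \<subseteq> connected_component_set (- path_image (level s)) z"
    using z connected_component_maximal by blast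
  moreover have "\<not> bounded (Om \<psi> s)"
  proof
    assume "bounded (Om \<psi> s)"
    then have "bounded (Om \<psi> s \<union> - Om \<psi> s)" using bounded_Compl_Om[of s] s by (simp only: bounded_Un less_imp_le)
    then show False using not_bounded_UNIV by (simp add: Compl_partition)
  qed
  ultimately have "z \<in> outside (path_image (level s))"
    unfolding outside using bounded_subset by blast
  then show ?thesis
    by (intro winding_number_zero_in_outside valid_path_imp_path level_path s)
qed

text \<open>For \<open>z\<close> outside the level curve the entire part \<open>F\<close>
  contributes nothing to the Cauchy integral, while \<open>u - F\<close>, which vanishes at
  infinity, is reproduced up to sign. The values of \<open>u\<close> on the level curve alone thus
  control the remainder \<open>F - u\<close> far outside.\<close>

lemma level_Cauchy_exterior:
  assumes F: "F holomorphic_on UNIV" and U: "u holomorphic_on Om \<psi> t" and t: "\<rho>' \<le> t" "t < s"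
    and lim: "((\<lambda>z. F z - u z) \<longlongrightarrow> 0) at_infinity" and z: "z \<in> Om \<psi> s"
  shows "contour_integral (level s) (\<lambda>\<zeta>. u \<zeta> / (\<zeta> - z)) = 2 * of_real pi * \<i> * (F z - u z)"
proof -
  have s: "\<rho>' < s" using t by simp
  note vp = level_path(1,2)[OF s] and pim = level_path(3)[OF s]
  have zt: "z \<in> Om \<psi> t" using z Om_mono[of t s] t by auto
  have opt: "open (Om \<psi> t)" by (rule open_Om[OF t(1)])
  have psub: "path_image (level s) \<subseteq> Om \<psi> t - {z}"
    using z psi_in_Om_iff t s by (auto simp: pim)
  then have zp: "z \<notin> path_image (level s)" by auto
  define r where "r \<zeta> = F \<zeta> - u \<zeta>" for \<zeta>
  have r: "r holomorphic_on Om \<psi> t" unfolding r_def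
    by (intro holomorphic_intros U holomorphic_on_subset[OF F]) auto
  define G where "G \<zeta> = (if \<zeta> = z then deriv r z else (r \<zeta> - r z) / (\<zeta> - z))" for \<zeta>
  have G: "G holomorphic_on Om \<psi> t" unfolding G_def by (rule pole_lemma_open[OF r opt])
  have "((\<lambda>\<zeta>. (r \<zeta> - r z) / (1 - z / \<zeta>)) \<longlongrightarrow> (0 - r z) / (1 - 0)) at_infinity"
    unfolding r_def by (intro tendsto_intros lim tendsto_divide_0[OF tendsto_const] filterlim_ident) auto
  then have "((\<lambda>\<zeta>. (r \<zeta> - r z) / (1 - z / \<zeta>)) \<longlongrightarrow> - r z) at_infinity" by simp
  then have "((\<lambda>\<zeta>. \<zeta> * G \<zeta>) \<longlongrightarrow> - r z) at_infinity"
    by (rule tendsto_at_infinity_cong_ne[where c = z]) (auto simp: G_def field_simps)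
  from exterior_contour_level[OF t G this]
  have 1: "contour_integral (level s) G = 2 * of_real pi * \<i> * (- r z)" .
  have iu: "(\<lambda>\<zeta>. u \<zeta> / (\<zeta> - z)) contour_integrable_on level s"
    by (rule contour_integrable_holomorphic_simple[of _ "Om \<psi> t - {z}"])
       (use vp psub opt in \<open>auto intro!: holomorphic_intros holomorphic_on_subset[OF U]\<close>)
  have "((\<lambda>\<zeta>. (F \<zeta> - r z) / (\<zeta> - z)) has_contour_integral
      2 * pi * \<i> * winding_number (level s) z * (F z - r z)) (level s)"
    by (rule Cauchy_integral_formula_global[of UNIV])
       (use vp zp in \<open>auto intro!: holomorphic_intros F\<close>)
  then have iF: "((\<lambda>\<zeta>. (F \<zeta> - r z) / (\<zeta> - z)) has_contour_integral 0) (level s)"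
    by (simp add: winding_level_outside[OF s z])
  have "contour_integral (level s) G = contour_integral (level s) (\<lambda>\<zeta>. (F \<zeta> - r z) / (\<zeta> - z) - u \<zeta> / (\<zeta> - z))"
  proof (rule contour_integral_eq)
    fix x assume "x \<in> path_image (level s)"
    then have "x \<noteq> z" using zp by auto
    then show "G x = (F x - r z) / (x - z) - u x / (x - z)"
      by (simp add: G_def r_def diff_divide_distrib)
  qed
  also have "\<dots> = 0 - contour_integral (level s) (\<lambda>\<zeta>. u \<zeta> / (\<zeta> - z))"
    by (subst contour_integral_diff[OF has_contour_integral_integrable[OF iF] iu])
       (simp add: contour_integral_unique[OF iF])
  finally have "contour_integral (level s) (\<lambda>\<zeta>. u \<zeta> / (\<zeta> - z)) = - (2 * of_real pi * \<i> * (- r z))"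
    unfolding 1 by simp
  then show ?thesis by (simp only: r_def mult_minus_right minus_minus)
qed

lemma compact_level: assumes "\<rho>' < s" shows "compact (\<psi> ` sphere 0 s)"
  by (intro compact_continuous_image continuous_on_subset[OF psi_cont]) (use assms in \<open>auto simp: Ext_def\<close>)

lemma bounded_on_level:
  assumes s: "\<rho>' \<le> t" "t < s" and u: "continuous_on (Om \<psi> t) u"
  obtains M where "0 < M" "\<And>w. norm w = s \<Longrightarrow> norm (u (\<psi> w)) \<le> M"
proof -
  have "\<psi> ` sphere 0 s \<subseteq> Om \<psi> t" using s by (auto simp: psi_in_Om_iff)
  then have "compact (u ` \<psi> ` sphere 0 s)"
    using compact_level[of s] s u by (intro compact_continuous_image[of "\<psi> ` sphere 0 s"]) (auto intro: continuous_on_subset)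
  from compact_imp_bounded[OF this, unfolded bounded_pos]
  obtain M where "0 < M" "\<forall>x\<in>u ` \<psi> ` sphere 0 s. norm x \<le> M" by (elim exE conjE)
  then show ?thesis by (intro that[of M]) auto
qed

lemma B_level_bound:
  assumes s: "\<rho> < s"
  obtains M where "0 < M" "\<And>n w. norm w = s \<Longrightarrow> norm (B n (\<psi> w)) \<le> M * s ^ n"
proof -
  obtain M where M: "0 < M" "\<And>w. norm w = s \<Longrightarrow> norm (B 0 (\<psi> w)) \<le> M"
    by (rule bounded_on_level[OF rho_ge s holomorphic_on_imp_continuous_on[OF B_hol]]) (rule that)
  have "norm (B n (\<psi> w)) \<le> M * s ^ n" if "norm w = s" for n w
  proof -
    have "\<phi> (\<psi> w) = w" using phi_psi rho_ge s that by simp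
    then have "norm (B n (\<psi> w)) = norm (B 0 (\<psi> w)) * s ^ n"
      by (simp add: B_def norm_mult norm_power that)
    also have "\<dots> \<le> M * s ^ n" using M(2)[OF that] s rho_bounds by (intro mult_right_mono) auto
    finally show ?thesis .
  qed
  with M(1) that show ?thesis by blast
qed

text \<open>\<open>B n\<close> is of order \<open>s ^ n\<close> on the level \<open>s\<close>, and
  Cauchy's formula carries this outwards to the remainder. The gap between \<open>s\<close> and
  \<open>s'\<close> keeps the denominator away from 0 uniformly: the level curve is compact and the
  set of targets, though unbounded, is closed.\<close>

lemma R_bound:
  assumes s: "\<rho> < s" "s < s'"
  obtains C where "0 < C" "\<And>n w. s' \<le> norm w \<Longrightarrow> norm (R n (\<psi> w)) \<le> C * s ^ n"
proof -
  have s0: "0 < s" "\<rho>' < s" using s rho_ge rho_bounds by auto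
  obtain M where M: "0 < M" "\<And>n w. norm w = s \<Longrightarrow> norm (B n (\<psi> w)) \<le> M * s ^ n"
    by (rule B_level_bound[OF s(1)]) (rule that)
  have "compact (deriv \<psi> ` sphere 0 s)"
    by (intro compact_continuous_image continuous_on_subset[OF holomorphic_on_imp_continuous_on[OF holomorphic_deriv[OF univ_hol open_Ext]]])
       (use s0 in \<open>auto simp: Ext_def\<close>)
  from compact_imp_bounded[OF this, unfolded bounded_pos]
  obtain N where "0 < N" "\<forall>x\<in>deriv \<psi> ` sphere 0 s. norm x \<le> N" by (elim exE conjE)
  then have N: "0 < N" "\<And>w. norm w = s \<Longrightarrow> norm (deriv \<psi> w) \<le> N" by auto
  have "\<psi> ` sphere 0 s \<inter> \<psi> ` {w. s' \<le> norm w} = {}"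
  proof -
    have False if "norm v = s" "s' \<le> norm w" "\<psi> v = \<psi> w" for v w
    proof -
      have "\<phi> (\<psi> v) = v" using that s0 by (intro phi_psi) simp
      moreover have "\<phi> (\<psi> w) = w" using that s s0 by (intro phi_psi) simp
      ultimately have "v = w" using that(3) by metis
      then show False using that(1,2) s by simp
    qed
    then show ?thesis by fastforce
  qed
  moreover have "\<rho>' < s'" using s0 s by simp
  ultimately obtain \<delta> where "0 < \<delta>" "\<forall>x\<in>\<psi> ` sphere 0 s. \<forall>y\<in>\<psi> ` {w. s' \<le> norm w}. \<delta> \<le> dist x y"
    using separate_compact_closed[OF compact_level[OF s0(2)] closed_psi_image] by metis
  then have \<delta>: "0 < \<delta>" "\<And>x y. x \<in> \<psi> ` sphere 0 s \<Longrightarrow> y \<in> \<psi> ` {w. s' \<le> norm w} \<Longrightarrow> \<delta> \<le> dist x y"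
    by auto
  have "norm (R n (\<psi> w0)) \<le> N * M / \<delta> * s * s ^ n" if w0: "s' \<le> norm w0" for n w0
  proof -
    define z where "z = \<psi> w0"
    have z: "z \<in> Om \<psi> s" unfolding z_def using w0 s s0 by (simp add: psi_in_Om_iff)
    have dz: "\<delta> \<le> norm (\<psi> w - z)" if "norm w = s" for w
      using \<delta>(2)[of "\<psi> w" z] that w0 by (auto simp: z_def dist_norm)
    have "contour_integral (level s) (\<lambda>\<zeta>. B n \<zeta> / (\<zeta> - z)) = 2 * of_real pi * \<i> * R n z"
      unfolding R_def
      by (rule level_Cauchy_exterior[OF _ B_hol rho_ge s(1) Fp(3)[of n, unfolded R_def] z]) (intro holomorphic_intros)
    then have ci: "contour_integral (circlepath 0 s) (\<lambda>w. deriv \<psi> w * (B n (\<psi> w) / (\<psi> w - z))) = 2 * of_real pi * \<i> * R n z"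
      using level_contour[OF s0(2)] by simp
    have "continuous_on (sphere 0 s) (\<lambda>w. deriv \<psi> w * (B n (\<psi> w) / (\<psi> w - z)))"
    proof (intro continuous_intros)
      show "continuous_on (sphere 0 s) (deriv \<psi>)"
        by (rule continuous_on_subset[OF holomorphic_on_imp_continuous_on[OF holomorphic_deriv[OF univ_hol open_Ext]]])
           (use s0 in \<open>auto simp: Ext_def\<close>)
      show pc: "continuous_on (sphere 0 s) \<psi>"
        by (rule continuous_on_subset[OF psi_cont]) (use s0 in \<open>auto simp: Ext_def\<close>)
      show "continuous_on (sphere 0 s) (\<lambda>w. B n (\<psi> w))"
        by (rule continuous_on_compose2[OF holomorphic_on_imp_continuous_on[OF B_hol] pc])
           (use s s0 rho_ge in \<open>auto simp: psi_in_Om_iff\<close>)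
      show "\<forall>w\<in>sphere 0 s. \<psi> w - z \<noteq> 0" using dz \<delta>(1) by fastforce
    qed
    then have "(\<lambda>w. deriv \<psi> w * (B n (\<psi> w) / (\<psi> w - z))) contour_integrable_on circlepath 0 s"
      using s0 by (intro contour_integrable_continuous_circlepath) simp
    then have "((\<lambda>w. deriv \<psi> w * (B n (\<psi> w) / (\<psi> w - z))) has_contour_integral 2 * of_real pi * \<i> * R n z) (circlepath 0 s)"
      using ci has_contour_integral_integral by fastforce
    then have "norm (2 * of_real pi * \<i> * R n z) \<le> N * (M * s ^ n / \<delta>) * (2 * pi * s)"
    proof (rule has_contour_integral_bound_circlepath)
      fix w :: complex assume "norm (w - 0) = s"
      then have w: "norm w = s" by simp
      show "norm (deriv \<psi> w * (B n (\<psi> w) / (\<psi> w - z))) \<le> N * (M * s ^ n / \<delta>)"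
        unfolding norm_mult norm_divide
        using N M \<delta>(1) s0 dz[OF w] by (intro mult_mono frac_le) (auto simp: w)
    qed (use N M \<delta> s0 in auto)
    then have "2 * pi * norm (R n z) \<le> 2 * pi * (N * M / \<delta> * s * s ^ n)"
      by (simp add: norm_mult mult_ac)
    then show ?thesis unfolding z_def
      by (subst (asm) mult_le_cancel_left_pos) simp_all
  qed
  moreover have "0 < N * M / \<delta> * s" using N M \<delta> s0 by simp
  ultimately show ?thesis using that by blast
qed

subsection \<open>Estimates for the orthonormal polynomials\<close>

text \<open>The ratio of \<open>lc n\<close> to its expected value. It is also the coefficient of
  \<open>p n\<close> along the unit vector \<open>B n\<close>, so a bound for
  \<open>1 - \<xi> n\<close> measures the angle between the two.\<close>

definition \<xi> where "\<xi> n = lc n / \<kappa> n"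

lemma xi_pos: "0 < \<xi> n" unfolding \<xi>_def using kappa_pos lc_pos by simp

lemma ip_p_B: "ip (poly (p n)) (B n) = of_real (\<xi> n)"
  using ip_poly_B[of "p n" n] deg_p lead_p by (simp add: \<xi>_def)

lemma ip_p_B_less: "k < n \<Longrightarrow> ip (poly (p k)) (B n) = 0"
  using ip_poly_B[of "p k" n] deg_p[of k] by (simp add: coeff_eq_0)

lemma nsq_p: "nsq (poly (p n)) = 1"
  using orthonormal[of n n] by (simp add: ip_self[OF poly_cont])

lemma nsq_p_minus_B: "nsq (\<lambda>z. poly (p n) z - of_real (\<xi> n) * B n z) = 1 - (\<xi> n)\<^sup>2"
  by (subst nsq_diff_cmult[OF poly_cont B_cont]) (simp add: nsq_p nsq_B ip_p_B power2_eq_square)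

lemma xi_le_1: "\<xi> n \<le> 1"
proof -
  have "continuous_on L1 (\<lambda>z. poly (p n) z - of_real (\<xi> n) * B n z)"
    by (intro continuous_intros B_cont)
  from nsq_nonneg[OF this] have "(\<xi> n)\<^sup>2 \<le> 1" by (simp add: nsq_p_minus_B)
  then show ?thesis using xi_pos[of n] by (simp add: power_le_one_iff)
qed

lemma poly_orthonormal_expansion:
  assumes "degree F < N" shows "poly F z = (\<Sum>k<N. ip (poly F) (poly (p k)) * poly (p k) z)"
proof -
  have "\<exists>\<alpha>. F = (\<Sum>k<N. smult (\<alpha> k) (p k))"
    using assms
  proof (induction N arbitrary: F)
    case (Suc N)
    define a where "a = coeff F N / of_real (lc N)"
    define G where "G = F - smult a (p N)"
    have cG: "coeff G i = 0" if "i \<ge> N" for i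
    proof (cases "i = N")
      case True
      then show ?thesis using lc_pos[of N] by (simp add: G_def a_def lead_p)
    next
      case False
      then show ?thesis using that Suc.prems by (simp add: G_def coeff_eq_0 deg_p)
    qed
    show ?case
    proof (cases "N = 0")
      case True
      then have "G = 0" using cG by (intro poly_eqI) auto
      then show ?thesis using True by (intro exI[of _ "\<lambda>_. a"]) (simp add: G_def)
    next
      case False
      then have "degree G < N" using cG by (intro degree_lessI) auto
      from Suc.IH[OF this] obtain \<alpha> where "G = (\<Sum>k<N. smult (\<alpha> k) (p k))" by blast
      then have "F = (\<Sum>k<Suc N. smult ((\<alpha>(N := a)) k) (p k))" by (simp add: G_def algebra_simps)
      then show ?thesis by blast
    qed
  qed simp
  then obtain \<alpha> where \<alpha>: "F = (\<Sum>k<N. smult (\<alpha> k) (p k))" by blast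
  have pF: "poly F = (\<lambda>z. \<Sum>k<N. \<alpha> k * poly (p k) z)"
    by (rule ext) (simp add: \<alpha> poly_sum)
  have "ip (poly F) (poly (p j)) = \<alpha> j" if "j < N" for j
  proof -
    have "ip (poly F) (poly (p j)) = (\<Sum>k<N. \<alpha> k * ip (poly (p k)) (poly (p j)))"
      unfolding pF by (subst ip_sum) (auto intro!: continuous_intros simp: ip_cmult)
    also have "\<dots> = (\<Sum>k<N. if k = j then \<alpha> j else 0)"
      by (intro sum.cong) (auto simp: orthonormal)
    finally show ?thesis using that by simp
  qed
  then show ?thesis unfolding pF by (intro sum.cong) auto
qed

text \<open>In the expansion of \<open>Fp n\<close> only \<open>p n\<close> contributes to the
  coefficient of \<open>z ^ n\<close>, which is \<open>\<kappa> n\<close> on one side and a multiple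
  of \<open>lc n\<close> on the other.\<close>

lemma ip_Fp_p: "ip (poly (Fp n)) (poly (p n)) = of_real (1 / \<xi> n)"
proof -
  have e: "poly (Fp n) = poly (\<Sum>k<Suc n. smult (ip (poly (Fp n)) (poly (p k))) (p k))"
    by (rule ext, subst poly_orthonormal_expansion[of _ "Suc n"]) (use Fp(1)[of n] in \<open>auto simp: poly_sum\<close>)
  then have "Fp n = (\<Sum>k<Suc n. smult (ip (poly (Fp n)) (poly (p k))) (p k))"
    by (simp only: poly_eq_poly_eq_iff)
  then have "coeff (Fp n) n = coeff (\<Sum>k<Suc n. smult (ip (poly (Fp n)) (poly (p k))) (p k)) n" by (rule arg_cong)
  also have "\<dots> = ip (poly (Fp n)) (poly (p n)) * of_real (lc n)"
    by (simp add: coeff_sum lead_p coeff_eq_0 deg_p)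
  finally show ?thesis using lc_pos[of n] by (simp add: Fp(2) \<xi>_def field_simps)
qed

lemma ip_Fp_p_less: "k < n \<Longrightarrow> ip (poly (Fp n)) (poly (p k)) = ip (R n) (poly (p k))"
proof -
  assume k: "k < n"
  have "ip (R n) (poly (p k)) = ip (poly (Fp n)) (poly (p k)) - ip (B n) (poly (p k))"
    unfolding R_def[abs_def] by (rule ip_diff[OF poly_cont B_cont poly_cont])
  also have "ip (B n) (poly (p k)) = 0" unfolding ip_cnj[of "B n"] by (simp add: ip_p_B_less[OF k])
  finally show ?thesis by simp
qed

text \<open>\<open>B n\<close> is orthogonal to the lower \<open>p k\<close>, so the coefficients of
  \<open>Fp n\<close> below the top one are those of the small remainder \<open>R n\<close>. Read
  backwards, this exhibits \<open>p n / \<xi> n\<close> as a perturbation of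
  \<open>Fp n\<close>.\<close>

lemma Fp_expansion:
  "poly (Fp n) z = (\<Sum>k<n. ip (R n) (poly (p k)) * poly (p k) z) + of_real (1 / \<xi> n) * poly (p n) z"
  by (subst poly_orthonormal_expansion[of _ "Suc n"])
     (use Fp(1)[of n] in \<open>simp_all add: ip_Fp_p ip_Fp_p_less\<close>)

lemma nsq_Fp: "nsq (poly (Fp n)) = 1 + nsq (R n)"
proof -
  have "nsq (\<lambda>z. poly (Fp n) z - of_real 1 * B n z) = nsq (poly (Fp n)) - 2 * 1 * Re (ip (poly (Fp n)) (B n)) + 1\<^sup>2 * nsq (B n)"
    by (rule nsq_diff_cmult[OF poly_cont B_cont])
  moreover have "ip (poly (Fp n)) (B n) = 1"
    using ip_poly_B[OF Fp(1)[of n]] Fp(2)[of n] kappa_pos[of n] by simp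
  ultimately show ?thesis by (simp add: nsq_B R_def[abs_def])
qed

text \<open>Bessel's inequality for \<open>Fp n\<close> and the unit vector \<open>p n\<close>, the
  counterpart of \<open>xi_le_1\<close>: there \<open>p n\<close> is projected onto
  \<open>B n\<close>, here \<open>Fp n\<close> onto \<open>p n\<close>.\<close>

lemma xi_lower: "1 / (\<xi> n)\<^sup>2 \<le> 1 + nsq (R n)"
proof -
  have c: "continuous_on L1 (\<lambda>z. poly (Fp n) z - of_real (1 / \<xi> n) * poly (p n) z)"
    by (intro continuous_intros)
  from nsq_nonneg[OF c] show ?thesis
    unfolding nsq_diff_cmult[OF poly_cont poly_cont] ip_Fp_p nsq_p nsq_Fp
    by (simp add: power2_eq_square power_divide)
qed

end

section \<open>Decay of the coefficients and the exterior asymptotics\<close>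

lemma sum_power_le:
  fixes x :: real
  assumes "0 \<le> x" "x < 1" shows "(\<Sum>k<n. x ^ k) \<le> 1 / (1 - x)"
proof -
  have "(\<Sum>k<n. x ^ k) = (1 - x ^ n) / (1 - x)" using assms by (simp add: sum_gp_strict)
  also have "\<dots> \<le> 1 / (1 - x)" using assms by (intro divide_right_mono) auto
  finally show ?thesis .
qed

text \<open>
  Errors decay at the rate \<open>s\<close> on levels between \<open>s'\<close> and \<open>t\<close>; the condition \<open>s * t < 1\<close> makes the
  orthogonal expansions converge up to the level \<open>t\<close> outside the curve.
\<close>
locale szego_levels = szego_setting +
  fixes s s' t :: real
  assumes s: "\<rho> < s" "s < s'" "s' < 1" and t: "1 < t" "s * t < 1"
begin

lemma s_bounds: "0 < s" "s < 1" "\<rho>' < s" "\<rho>' < s'" "\<rho>' < t" "\<rho> < t"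
  using s t rho_ge rho_bounds by auto

lemma R_L1_bound:
  assumes "\<And>n w. s' \<le> norm w \<Longrightarrow> norm (R n (\<psi> w)) \<le> C * s ^ n" and z: "z \<in> L1"
  shows "norm (R n z) \<le> C * s ^ n"
proof -
  obtain w where "z = \<psi> w" "norm w = 1" using L1_psi z by auto
  then show ?thesis using assms(1)[of w n] s by simp
qed

text \<open>Bessel's inequality compares squared norms, so the order \<open>s ^ n\<close> of
  \<open>R n\<close> on the curve enters as \<open>s ^ (2 * n)\<close>. The summand 1 in the
  constant makes it positive.\<close>

lemma xi_error:
  obtains C where "0 < C" "\<And>n. 1 - (\<xi> n)\<^sup>2 \<le> C * s ^ (2 * n)"
proof -
  obtain C where C: "0 < C" "\<And>n w. s' \<le> norm w \<Longrightarrow> norm (R n (\<psi> w)) \<le> C * s ^ n"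
    by (rule R_bound[OF s(1,2)]) (rule that)
  have main: "1 - (\<xi> n)\<^sup>2 \<le> (C\<^sup>2 * W + 1) * s ^ (2 * n)" for n
  proof -
    have "nsq (R n) \<le> (C * s ^ n)\<^sup>2 * W"
      by (rule nsq_bound[OF R_cont]) (rule R_L1_bound[OF C(2)])
    also have "\<dots> = C\<^sup>2 * W * s ^ (2 * n)" by (simp add: power_mult_distrib power_even_eq)
    finally have "1 / (\<xi> n)\<^sup>2 \<le> 1 + C\<^sup>2 * W * s ^ (2 * n)" using xi_lower[of n] by simp
    then have "1 \<le> (1 + C\<^sup>2 * W * s ^ (2 * n)) * (\<xi> n)\<^sup>2"
      using xi_pos[of n] by (simp add: divide_le_eq)
    then have "1 - (\<xi> n)\<^sup>2 \<le> C\<^sup>2 * W * s ^ (2 * n) * (\<xi> n)\<^sup>2" by (simp add: algebra_simps)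
    also have "\<dots> \<le> C\<^sup>2 * W * s ^ (2 * n) * 1"
      using xi_pos[of n] xi_le_1[of n] W_nonneg s_bounds by (intro mult_left_mono) (auto simp: power_le_one_iff)
    also have "\<dots> \<le> (C\<^sup>2 * W + 1) * s ^ (2 * n)" using s_bounds by (simp add: algebra_simps)
    finally show ?thesis .
  qed
  have pos: "0 < C\<^sup>2 * W + 1" using W_nonneg by (simp add: add_nonneg_pos)
  show ?thesis by (rule that[OF pos main])
qed

text \<open>
  Since \<open>R n\<close> is orthogonal to \<open>B k\<close>, only the deviation \<open>p k - \<xi> k * B k\<close> of size \<open>s ^ k\<close> contributes.
\<close>
lemma ip_R_p_bound:
  obtains C where "0 < C" "\<And>n k. norm (ip (R n) (poly (p k))) \<le> C * s ^ (n + k)"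
proof -
  obtain C1 where C1: "0 < C1" "\<And>n w. s' \<le> norm w \<Longrightarrow> norm (R n (\<psi> w)) \<le> C1 * s ^ n"
    by (rule R_bound[OF s(1,2)]) (rule that)
  obtain C2 where C2: "0 < C2" "\<And>n. 1 - (\<xi> n)\<^sup>2 \<le> C2 * s ^ (2 * n)"
    by (rule xi_error) (rule that)
  have main: "norm (ip (R n) (poly (p k))) \<le> C1 * (C2 + W) * s ^ (n + k)" for n k
  proof -
    let ?E = "\<lambda>z. poly (p k) z - of_real (\<xi> k) * B k z"
    have cE: "continuous_on L1 ?E" by (intro continuous_intros B_cont)
    have cB: "continuous_on L1 (\<lambda>z. of_real (\<xi> k) * B k z)" by (intro continuous_intros B_cont)
    have RB: "ip (R n) (B k) = 0" by (rule ip_vanish_B[OF R_hol_S0 Fp(3)])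
    have "ip (B k) (R n) = 0" unfolding ip_cnj[of "B k"] RB by simp
    then have "ip ?E (R n) = ip (poly (p k)) (R n)"
      unfolding ip_diff[OF poly_cont cB R_cont] ip_cmult by simp
    then have eq: "ip (R n) (poly (p k)) = ip (R n) ?E" unfolding ip_cnj[of "R n"] by simp
    \<comment> \<open>The free parameter is taken as \<open>s ^ k\<close>, the order of the norm of
      \<open>?E\<close>, whose square is \<open>1 - (\<xi> k)^2\<close>.\<close>
    have "norm (ip (R n) (poly (p k))) \<le> (C1 * s ^ n) * (nsq ?E / s ^ k + s ^ k * W)"
      unfolding eq by (rule ip_bound[OF R_cont cE R_L1_bound[OF C1(2)]]) (use s_bounds(1) C1(1) in auto)
    also have "\<dots> \<le> (C1 * s ^ n) * (C2 * s ^ k + s ^ k * W)"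
    proof -
      have "nsq ?E / s ^ k \<le> C2 * s ^ (2 * k) / s ^ k"
        unfolding nsq_p_minus_B by (rule divide_right_mono[OF C2(2)]) (use s_bounds(1) in simp)
      also have "\<dots> = C2 * s ^ k" using s_bounds(1) by (simp add: mult_2 power_add)
      finally have "nsq ?E / s ^ k + s ^ k * W \<le> C2 * s ^ k + s ^ k * W" by (rule add_right_mono)
      then show ?thesis by (rule mult_left_mono) (use C1(1) s_bounds(1) in simp)
    qed
    also have "\<dots> = C1 * (C2 + W) * s ^ (n + k)" by (simp add: power_add algebra_simps)
    finally show ?thesis .
  qed
  have pos: "0 < C1 * (C2 + W)" using C1(1) C2(1) W_nonneg by (intro mult_pos_pos) auto
  show ?thesis by (rule that[OF pos main])
qed

lemma p_over_B_infinity: "((\<lambda>z. poly (p k) z / B k z) \<longlongrightarrow> of_real (\<xi> k)) at_infinity"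
proof -
  have "((\<lambda>z. (poly (p k) z / z ^ k) / (B k z / z ^ k)) \<longlongrightarrow> of_real (lc k) / of_real (\<kappa> k)) at_infinity"
    using poly_at_infinity[of "p k" k] kappa_pos[of k]
    by (intro tendsto_intros B_infinity) (auto simp: deg_p lead_p)
  then have "((\<lambda>z. (poly (p k) z / z ^ k) / (B k z / z ^ k)) \<longlongrightarrow> of_real (\<xi> k)) at_infinity"
    by (simp add: \<xi>_def)
  then show ?thesis by (rule tendsto_at_infinity_cong_ne) simp
qed

lemma level_t_outside: "norm w = t \<Longrightarrow> \<psi> w \<in> outside L1"
  using psi_in_Om_iff[of 1 w] Om1 t s_bounds rho_bounds by simp

text \<open>A first bound that uses only the unit norm of \<open>p k\<close>. The quotient
  \<open>p k / B k\<close> is analytic outside the curve with value \<open>\<xi> k\<close> at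
  infinity, so a Cauchy integral over the curve bounds it on the level \<open>t\<close>, which has
  positive distance from the curve. Multiplying by \<open>B k\<close> gives \<open>t ^ k\<close>,
  and the maximum principle extends this inwards.\<close>

lemma p_bound:
  obtains C where "0 < C" "\<And>k z. z \<notin> Om \<psi> t \<Longrightarrow> norm (poly (p k) z) \<le> C * t ^ k"
proof -
  have t0: "\<rho>' < t" using s_bounds by simp
  obtain M where M: "0 < M" "\<And>n w. norm w = t \<Longrightarrow> norm (B n (\<psi> w)) \<le> M * t ^ n"
    by (rule B_level_bound[OF s_bounds(6)]) (rule that)
  have "continuous_on L1 (\<lambda>z. De z / q z)"
    by (rule hol_S0_cont) (intro holomorphic_intros S0_facts, use S0_nz in auto)
  then have "bounded ((\<lambda>z. De z / q z) ` L1)"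
    by (intro compact_imp_bounded compact_continuous_image L1_compact)
  then obtain K where K: "0 < K" "\<forall>x\<in>(\<lambda>z. De z / q z) ` L1. norm x \<le> K"
    unfolding bounded_pos by (elim exE conjE)
  have "\<psi> ` sphere 0 t \<inter> L1 = {}"
    using level_t_outside outside_no_overlap[of L1] by fastforce
  then obtain \<delta> where \<delta>: "0 < \<delta>" "\<forall>x\<in>\<psi> ` sphere 0 t. \<forall>y\<in>L1. \<delta> \<le> dist x y"
    using separate_compact_closed[OF compact_level[OF t0] compact_imp_closed[OF L1_compact]] by metis
  obtain z0 where z0: "z0 \<in> inside L1" using Jordan(5) by auto
  have ins: "x \<in> inside L1" if "x \<notin> S0 - {z0}" for x
    using that z0 S0_facts inside_Un_outside[of L1] by blast
  have bd: "bounded (- (S0 - {z0}))"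
    by (rule bounded_subset[of "inside L1"])
       (use ins bounded_inside[of L1] L1_compact compact_imp_bounded in auto)
  have sub: "L1 \<subseteq> S0 - {z0}" using S0_facts(2) z0 inside_no_overlap[of L1] by blast
  \<comment> \<open>The 1 bounds the value \<open>\<xi> k\<close> at infinity; the rest bounds the
    Cauchy integral, where \<open>nsq (p k) = 1\<close> and \<open>W\<close> come from
    \<open>y \<le> y^2 + 1\<close>.\<close>
  define Q where "Q = 1 + K * (W + 1) / \<delta>"
  have Q: "0 < Q" using K \<delta> W_nonneg by (simp add: Q_def add_pos_nonneg)
  have level: "norm (poly (p k) (\<psi> w)) \<le> Q * M * t ^ k" if w: "norm w = t" for k w
  proof -
    define z where "z = \<psi> w"
    have z: "z \<in> outside L1" unfolding z_def by (rule level_t_outside[OF w])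
    have zS: "z \<in> S0 - {z0}" using z z0 S0_facts(3) inside_Int_outside[of L1] by blast
    have Bn: "B k x \<noteq> 0" if "x \<in> S0" for x using S0_nz[OF that] by (simp add: B_def)
    have zL: "z \<notin> L1" using z outside_no_overlap[of L1] by blast
    have dist: "\<delta> \<le> norm (c \<tau> - z)" for \<tau>
    proof -
      have "\<delta> \<le> dist (\<psi> w) (c \<tau>)" using \<delta>(2) w c_per[of \<tau>] by auto
      then show ?thesis by (simp add: z_def dist_norm norm_minus_commute)
    qed
    let ?g = "\<lambda>\<zeta>. poly (p k) \<zeta> / B k \<zeta>"
    have gh: "?g holomorphic_on S0" by (intro holomorphic_intros B_hol_S0) (use Bn in auto)
    have "contour_integral c (\<lambda>\<zeta>. ?g \<zeta> / (\<zeta> - z)) = 2 * of_real pi * \<i> * (of_real (\<xi> k) - ?g z)"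
      by (rule exterior_Cauchy_formula[of "S0 - {z0}" _ z0])
         (use S0_facts(1) c_valid c_loop sub ins winding_inside bd p_over_B_infinity[of k]
            zS zL winding_outside[OF z] in \<open>auto simp: open_delete intro: holomorphic_on_subset[OF gh]\<close>)
    then have gz: "2 * of_real pi * \<i> * (of_real (\<xi> k) - ?g z) = integral {0..1} (\<lambda>\<tau>. ?g (c \<tau>) / (c \<tau> - z) * c' \<tau>)"
      by (simp add: contour_c)
    have cg: "continuous_on {0..1} (\<lambda>\<tau>. ?g (c \<tau>) / (c \<tau> - z) * c' \<tau>)"
    proof -
      have "c \<tau> - z \<noteq> 0" for \<tau> using dist[of \<tau>] \<delta>(1) by auto
      then show ?thesis
        using continuous_on_subset[OF c_cont subset_UNIV] continuous_on_subset[OF c'_cont subset_UNIV]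
        by (intro continuous_on_mult[OF continuous_on_divide] cont_c[OF hol_S0_cont[OF gh]] continuous_intros) auto
    qed
    have "norm (integral {0..1} (\<lambda>\<tau>. ?g (c \<tau>) / (c \<tau> - z) * c' \<tau>))
        \<le> integral {0..1} (\<lambda>\<tau>. 2 * pi * K / \<delta> * ((norm (poly (p k) (c \<tau>)))\<^sup>2 * \<omega> \<tau> + \<omega> \<tau>))"
    proof (rule integral_norm_bound_integral)
      fix \<tau> :: real
      define x where "x = c \<tau>"
      have x: "x \<in> L1" "x \<in> S0" using c_per S0_facts by (auto simp: x_def)
      have nz: "De x \<noteq> 0" "q x \<noteq> 0" using S0_nz[OF x(2)] by auto
      \<comment> \<open>Arc length is traded for the weight, so that the bound becomes a weighted
        norm of \<open>p k\<close>. As \<open>|\<phi>| = 1\<close> on the curve,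
        \<open>|B k|\<close> does not depend on \<open>k\<close> there.\<close>
      have c'w: "norm (c' \<tau>) = 2 * pi * (norm (De x))\<^sup>2 * \<omega> \<tau>"
        unfolding \<omega>_def x_def[symmetric] h_eq[OF x(1)] using nz by simp
      have "norm (?g x / (x - z) * c' \<tau>) = norm (poly (p k) x) / (norm (De x) * norm (q x)) / norm (x - z) * norm (c' \<tau>)"
        by (simp add: norm_mult norm_divide B_def norm_power phi_L1[OF x(1)])
      also have "\<dots> = 2 * pi * (norm (De x / q x) / norm (x - z)) * (norm (poly (p k) x) * \<omega> \<tau>)"
        unfolding c'w using nz by (simp add: norm_divide power2_eq_square)
      also have "\<dots> \<le> 2 * pi * (K / \<delta>) * (((norm (poly (p k) x))\<^sup>2 + 1) * \<omega> \<tau>)"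
      proof (intro mult_mono frac_le)
        show "norm (De x / q x) \<le> K" using K(2) x(1) by auto
        show "\<delta> \<le> norm (x - z)" unfolding x_def by (rule dist)
        let ?y = "norm (poly (p k) x)"
        have "0 \<le> (?y - 1)\<^sup>2 + ?y" by simp
        then show "?y \<le> ?y\<^sup>2 + 1" by (simp add: power2_eq_square algebra_simps)
      qed (use K \<delta> omega_pos[of \<tau>] in auto)
      also have "\<dots> = 2 * pi * K / \<delta> * ((norm (poly (p k) x))\<^sup>2 * \<omega> \<tau> + \<omega> \<tau>)" by (simp add: algebra_simps)
      finally show "norm (?g (c \<tau>) / (c \<tau> - z) * c' \<tau>) \<le> 2 * pi * K / \<delta> * ((norm (poly (p k) (c \<tau>)))\<^sup>2 * \<omega> \<tau> + \<omega> \<tau>)"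
        unfolding x_def .
    next
      show "(\<lambda>\<tau>. ?g (c \<tau>) / (c \<tau> - z) * c' \<tau>) integrable_on {0..1}"
        by (rule integrable_continuous_interval[OF cg])
    qed (intro integrable_continuous_interval continuous_intros cont_c omega_cont continuous_on_subset[OF c_cont]; auto)
    also have "\<dots> = 2 * pi * K / \<delta> * (nsq (poly (p k)) + W)"
    proof -
      have "integral {0..1} (\<lambda>\<tau>. (norm (poly (p k) (c \<tau>)))\<^sup>2 * \<omega> \<tau> + \<omega> \<tau>)
          = integral {0..1} (\<lambda>\<tau>. (norm (poly (p k) (c \<tau>)))\<^sup>2 * \<omega> \<tau>) + integral {0..1} \<omega>"
        by (rule integral_add)
           (intro integrable_continuous_interval continuous_intros cont_c omega_cont continuous_on_subset[OF c_cont]; auto)+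
      then show ?thesis unfolding integral_mult_right nsq_def W_def by simp
    qed
    finally have "norm (2 * of_real pi * \<i> * (of_real (\<xi> k) - ?g z)) \<le> 2 * pi * (K / \<delta> * (1 + W))"
      unfolding gz nsq_p by (simp add: mult.assoc)
    then have "2 * pi * norm (of_real (\<xi> k) - ?g z) \<le> 2 * pi * (K / \<delta> * (1 + W))" by (simp add: norm_mult)
    then have "norm (of_real (\<xi> k) - ?g z) \<le> K / \<delta> * (1 + W)"
      by (subst (asm) mult_le_cancel_left_pos) simp_all
    moreover have "norm (?g z) \<le> norm (of_real (\<xi> k) - ?g z) + norm (complex_of_real (\<xi> k))"
      using norm_triangle_ineq4[of "of_real (\<xi> k)" "of_real (\<xi> k) - ?g z"] by simp
    ultimately have "norm (?g z) \<le> Q" using xi_le_1[of k] xi_pos[of k] by (simp add: Q_def algebra_simps add_divide_distrib)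
    then have "norm (poly (p k) z) \<le> Q * norm (B k z)"
      using Bn[of z] zS by (simp add: norm_divide divide_le_eq)
    also have "\<dots> \<le> Q * (M * t ^ k)" unfolding z_def using M(2)[OF w] Q by (intro mult_left_mono) auto
    finally show ?thesis by (simp add: z_def mult.assoc)
  qed
  have main: "norm (poly (p k) z) \<le> Q * M * t ^ k" if "z \<notin> Om \<psi> t" for k z
  proof (rule maximum_modulus_level[OF t0 _ _ that])
    show "norm (poly (p k) (\<psi> w)) \<le> Q * M * t ^ k" if "norm w = t" for w by (rule level[OF that])
  qed (intro holomorphic_intros)
  have pos: "0 < Q * M" using Q M by simp
  show ?thesis by (rule that[OF pos main])
qed

text \<open>Coefficients of size \<open>s ^ (n + k)\<close> meet polynomials of size
  \<open>t ^ k\<close>; the factor \<open>s ^ n\<close> comes out and a geometric series in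
  \<open>s * t\<close> remains.\<close>

lemma p_minus_Fp_bound:
  obtains C where "0 < C"
    "\<And>n z. z \<notin> Om \<psi> t \<Longrightarrow> norm (of_real (1 / \<xi> n) * poly (p n) z - poly (Fp n) z) \<le> C * s ^ n"
proof -
  obtain C1 where C1: "0 < C1" "\<And>n k. norm (ip (R n) (poly (p k))) \<le> C1 * s ^ (n + k)"
    by (rule ip_R_p_bound) (rule that)
  obtain C2 where C2: "0 < C2" "\<And>k z. z \<notin> Om \<psi> t \<Longrightarrow> norm (poly (p k) z) \<le> C2 * t ^ k"
    by (rule p_bound) (rule that)
  have st: "0 \<le> s * t" "s * t < 1" using s_bounds t by auto
  have main: "norm (of_real (1 / \<xi> n) * poly (p n) z - poly (Fp n) z) \<le> C1 * C2 / (1 - s * t) * s ^ n"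
    if z: "z \<notin> Om \<psi> t" for n z
  proof -
    have "of_real (1 / \<xi> n) * poly (p n) z - poly (Fp n) z = - (\<Sum>k<n. ip (R n) (poly (p k)) * poly (p k) z)"
      unfolding Fp_expansion by simp
    then have "norm (of_real (1 / \<xi> n) * poly (p n) z - poly (Fp n) z)
        = norm (\<Sum>k<n. ip (R n) (poly (p k)) * poly (p k) z)" by simp
    also have "\<dots> \<le> (\<Sum>k<n. C1 * C2 * s ^ n * (s * t) ^ k)"
    proof (rule sum_norm_le)
      fix k
      have "norm (ip (R n) (poly (p k)) * poly (p k) z) \<le> (C1 * s ^ (n + k)) * (C2 * t ^ k)"
        unfolding norm_mult using C1 C2 z s_bounds by (intro mult_mono) auto
      also have "\<dots> = C1 * C2 * s ^ n * (s * t) ^ k" by (simp add: power_add power_mult_distrib)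
      finally show "norm (ip (R n) (poly (p k)) * poly (p k) z) \<le> C1 * C2 * s ^ n * (s * t) ^ k" .
    qed
    also have "\<dots> = C1 * C2 * s ^ n * (\<Sum>k<n. (s * t) ^ k)" by (simp add: sum_distrib_left)
    also have "\<dots> \<le> C1 * C2 * s ^ n * (1 / (1 - s * t))"
      using C1 C2 s_bounds by (intro mult_left_mono sum_power_le st) auto
    finally show ?thesis by simp
  qed
  have pos: "0 < C1 * C2 / (1 - s * t)" using C1 C2 st by simp
  show ?thesis by (rule that[OF pos main])
qed

lemma p_minus_B_bound:
  obtains C where "0 < C"
    "\<And>n w. s' \<le> norm w \<Longrightarrow> norm w \<le> t \<Longrightarrow> norm (of_real (1 / \<xi> n) * poly (p n) (\<psi> w) - B n (\<psi> w)) \<le> C * s ^ n"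
proof -
  obtain C1 where C1: "0 < C1"
    "\<And>n z. z \<notin> Om \<psi> t \<Longrightarrow> norm (of_real (1 / \<xi> n) * poly (p n) z - poly (Fp n) z) \<le> C1 * s ^ n"
    by (rule p_minus_Fp_bound) (rule that)
  obtain C2 where C2: "0 < C2" "\<And>n w. s' \<le> norm w \<Longrightarrow> norm (R n (\<psi> w)) \<le> C2 * s ^ n"
    by (rule R_bound[OF s(1,2)]) (rule that)
  have main: "norm (of_real (1 / \<xi> n) * poly (p n) (\<psi> w) - B n (\<psi> w)) \<le> (C1 + C2) * s ^ n"
    if w: "s' \<le> norm w" "norm w \<le> t" for n w
  proof -
    have "\<psi> w \<notin> Om \<psi> t" using psi_in_Om_iff[of t w] w s_bounds by auto
    then have "norm (of_real (1 / \<xi> n) * poly (p n) (\<psi> w) - poly (Fp n) (\<psi> w)) \<le> C1 * s ^ n" by (rule C1)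
    moreover have "of_real (1 / \<xi> n) * poly (p n) (\<psi> w) - B n (\<psi> w)
        = (of_real (1 / \<xi> n) * poly (p n) (\<psi> w) - poly (Fp n) (\<psi> w)) + R n (\<psi> w)" by (simp add: R_def)
    ultimately show ?thesis using C2(2)[OF w(1), of n]
      by (metis (no_types, lifting) add_mono distrib_right norm_triangle_le)
  qed
  have pos: "0 < C1 + C2" using C1 C2 by simp
  show ?thesis by (rule that[OF pos main])
qed

text \<open>After division by \<open>q * \<phi> ^ n\<close> the error is of order
  \<open>s ^ n / r ^ n\<close> on the level \<open>r\<close>; it is analytic outside that level and
  vanishes at infinity, so the maximum principle carries the bound outwards. Dividing by
  \<open>De\<close> as well would create poles at its zeros.\<close>

lemma exterior_asymptotics:
  assumes r: "s' \<le> r" "r \<le> t"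
  obtains C where "0 < C"
    "\<And>n w. r \<le> norm w \<Longrightarrow>
       norm (of_real (1 / \<xi> n) * poly (p n) (\<psi> w) / (q (\<psi> w) * w ^ n) - De (\<psi> w)) \<le> C * (s ^ n / r ^ n)"
proof -
  have r0: "0 < r" "\<rho>' < r" "\<rho> < r" using r s s_bounds by auto
  obtain C where C: "0 < C"
    "\<And>n w. s' \<le> norm w \<Longrightarrow> norm w \<le> t \<Longrightarrow> norm (of_real (1 / \<xi> n) * poly (p n) (\<psi> w) - B n (\<psi> w)) \<le> C * s ^ n"
    by (rule p_minus_B_bound) (rule that)
  obtain K where K: "0 < K" "\<And>w. norm w = r \<Longrightarrow> norm (inverse (q (\<psi> w))) \<le> K"
  proof (rule bounded_on_level[of \<rho>' r "\<lambda>z. inverse (q z)"])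
    show "continuous_on (Om \<psi> \<rho>') (\<lambda>z. inverse (q z))"
      by (intro continuous_intros holomorphic_on_imp_continuous_on q_hol) (use q_nz in auto)
  qed (use r0 that in auto)
  have main: "norm (of_real (1 / \<xi> n) * poly (p n) (\<psi> w) / (q (\<psi> w) * w ^ n) - De (\<psi> w)) \<le> K * C * (s ^ n / r ^ n)"
    if w: "r \<le> norm w" for n w
  proof (rule exterior_maximum_modulus[where e = "\<lambda>w. of_real (1 / \<xi> n) * poly (p n) (\<psi> w) / (q (\<psi> w) * w ^ n) - De (\<psi> w)"
        and s = \<rho> and r = r])
    let ?e = "\<lambda>w. of_real (1 / \<xi> n) * poly (p n) (\<psi> w) / (q (\<psi> w) * w ^ n) - De (\<psi> w)"
    have E: "{w. \<rho> < norm w} = Ext \<rho>" by (auto simp: Ext_def)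
    have sub: "\<psi> w \<in> Om \<psi> \<rho>" "\<psi> w \<in> Om \<psi> \<rho>'" if "w \<in> Ext \<rho>" for w
      using that rho_ge by (auto simp: Om_def Ext_def)
    have ph: "\<psi> holomorphic_on Ext \<rho>" by (rule psi_hol[OF rho_ge])
    show "?e holomorphic_on {w. \<rho> < norm w}"
    proof -
      have h1: "(\<lambda>w. q (\<psi> w)) holomorphic_on Ext \<rho>"
        by (rule holomorphic_on_compose_gen[OF ph q_hol, unfolded o_def]) (use sub in auto)
      have h2: "(\<lambda>w. De (\<psi> w)) holomorphic_on Ext \<rho>"
        by (rule holomorphic_on_compose_gen[OF ph De_hol, unfolded o_def]) (use sub in auto)
      have "q (\<psi> w) * w ^ n \<noteq> 0" if "w \<in> Ext \<rho>" for w
      proof -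
        have "w \<noteq> 0" using that rho_bounds by (auto simp: Ext_def)
        then show ?thesis using q_nz[OF sub(2)[OF that]] by simp
      qed
      then show ?thesis unfolding E by (intro holomorphic_intros ph h1 h2) auto
    qed
    show "(?e \<longlongrightarrow> 0) at_infinity"
    proof -
      have "((\<lambda>z. of_real (1 / \<xi> n) * (poly (p n) z / z ^ n) / (q z) * (z / \<phi> z) ^ n - De z) \<longlongrightarrow>
          of_real (1 / \<xi> n) * of_real (lc n) / of_real (sqrt b) * of_real (1 / b) ^ n - of_real d) at_infinity"
        using poly_at_infinity[of "p n" n] b_pos
        by (intro tendsto_intros asymptotics_at_infinity De_infinity) (auto simp: deg_p lead_p)
      \<comment> \<open>The factor \<open>1 / \<xi> n\<close> turns the leading coefficient
        \<open>lc n\<close> into \<open>\<kappa> n\<close>, so that the two limits at infinity agree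
        exactly.\<close>
      moreover have "of_real (1 / \<xi> n) * of_real (lc n) / of_real (sqrt b) * of_real (1 / b) ^ n - of_real d = (0::complex)"
      proof -
        have "1 / \<xi> n * lc n / sqrt b * (1 / b) ^ n - d = 0"
          using b_pos lc_pos[of n] kappa_pos[of n] by (simp add: \<xi>_def \<kappa>_def field_simps)
        then have "complex_of_real (1 / \<xi> n * lc n / sqrt b * (1 / b) ^ n - d) = of_real 0" by (rule arg_cong)
        then show ?thesis by (simp only: of_real_mult of_real_divide of_real_power of_real_diff of_real_0)
      qed
      ultimately have "((\<lambda>z. of_real (1 / \<xi> n) * (poly (p n) z / z ^ n) / (q z) * (z / \<phi> z) ^ n - De z) \<longlongrightarrow> 0) at_infinity"
        by simp
      then have "((\<lambda>w. of_real (1 / \<xi> n) * (poly (p n) (\<psi> w) / \<psi> w ^ n) / (q (\<psi> w)) * (\<psi> w / \<phi> (\<psi> w)) ^ n - De (\<psi> w)) \<longlongrightarrow> 0) at_infinity"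
        by (rule filterlim_compose[OF _ psi_infinity])
      then show ?thesis
      proof (rule Lim_transform_eventually)
        have "eventually (\<lambda>w. \<psi> w \<noteq> 0) at_infinity"
          using filterlim_iff[THEN iffD1, OF psi_infinity, rule_format, OF eventually_not_equal_at_infinity] .
        moreover have "eventually (\<lambda>w::complex. \<rho>' < norm w) at_infinity"
          unfolding eventually_at_infinity by (intro exI[of _ "\<rho>' + 1"]) auto
        ultimately show "eventually (\<lambda>w. of_real (1 / \<xi> n) * (poly (p n) (\<psi> w) / \<psi> w ^ n) / (q (\<psi> w)) * (\<psi> w / \<phi> (\<psi> w)) ^ n - De (\<psi> w) = ?e w) at_infinity"
          by eventually_elim (simp add: phi_psi power_divide)
      qed
    qed
    fix v :: complex assume v: "norm v = r"
    have vS: "\<psi> v \<in> Om \<psi> \<rho>'" using v r0 by (auto simp: Om_def Ext_def)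
    have nz: "q (\<psi> v) \<noteq> 0" "v \<noteq> 0" using q_nz[OF vS] v r0 by auto
    have "?e v = (of_real (1 / \<xi> n) * poly (p n) (\<psi> v) - B n (\<psi> v)) * inverse (q (\<psi> v)) / v ^ n"
      using nz phi_psi[of v] v r0 by (simp add: B_def field_simps)
    then have "norm (?e v) = norm (of_real (1 / \<xi> n) * poly (p n) (\<psi> v) - B n (\<psi> v)) * norm (inverse (q (\<psi> v))) / r ^ n"
      by (simp add: norm_mult norm_divide norm_power v)
    also have "\<dots> \<le> (C * s ^ n) * K / r ^ n"
      using C K v r r0 s_bounds by (intro divide_right_mono mult_mono) auto
    finally show "norm (?e v) \<le> K * C * (s ^ n / r ^ n)" by (simp add: mult_ac)
  qed (use r0 w K C s_bounds in auto)
  have pos: "0 < K * C" using K C by simp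
  show ?thesis by (rule that[OF pos main])
qed

end

section \<open>Functions orthogonal to all polynomials\<close>

context szego_setting
begin

lemma inside_facts: "Gd \<psi> 1 = inside L1" "closure (inside L1) = inside L1 \<union> L1"
proof -
  show "Gd \<psi> 1 = inside L1"
    unfolding Gd_def closure_Om1 using union_with_outside[of L1] by blast
  show "closure (inside L1) = inside L1 \<union> L1"
    using Jordan(4) closure_Un_frontier[of "inside L1"] by simp
qed

lemma ip_uniform_limit:
  assumes u: "\<And>m. continuous_on L1 (u m)" and v: "continuous_on L1 v"
    and lim: "uniform_limit L1 u g sequentially"
  shows "(\<lambda>m. ip (u m) v) \<longlonglongrightarrow> ip g v"
proof (rule tendstoI)
  fix e :: real assume e: "0 < e"
  have g: "continuous_on L1 g"
    by (rule uniform_limit_theorem[OF _ lim]) (use u in auto)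
  define K where "K = nsq v / 1 + 1 * W + 1"
  have K: "0 < K" using nsq_nonneg[OF v] W_nonneg by (simp add: K_def)
  have "\<forall>\<^sub>F m in sequentially. \<forall>x\<in>L1. dist (u m x) (g x) < e / K"
    using lim e K unfolding uniform_limit_iff by simp
  then show "\<forall>\<^sub>F m in sequentially. dist (ip (u m) v) (ip g v) < e"
  proof (rule eventually_mono)
    fix m assume m: "\<forall>x\<in>L1. dist (u m x) (g x) < e / K"
    have "norm (ip (\<lambda>x. u m x - g x) v) \<le> e / K * (nsq v / 1 + 1 * W)"
    proof (rule ip_bound)
      show "continuous_on L1 (\<lambda>x. u m x - g x)" by (intro continuous_intros u g)
      show "norm (u m z - g z) \<le> e / K" if "z \<in> L1" for z
        using m that by (auto simp: dist_norm less_imp_le)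
    qed (use v e K in auto)
    also have "\<dots> < e / K * K" using e K by (intro mult_strict_left_mono) (auto simp: K_def)
    also have "\<dots> = e" using K by simp
    finally show "dist (ip (u m) v) (ip g v) < e"
      by (simp add: ip_diff[OF u g v] dist_norm)
  qed
qed

lemma ip_eq_0_polynomials:
  assumes N: "continuous_on L1 N" and orth: "\<And>k. ip N (poly (p k)) = 0"
  shows "ip N (poly F) = 0"
proof -
  have eq: "poly F = (\<lambda>z. \<Sum>k<Suc (degree F). ip (poly F) (poly (p k)) * poly (p k) z)"
    by (rule ext, rule poly_orthonormal_expansion) simp
  have "ip (poly (p k)) N = 0" for k unfolding ip_cnj[of "poly (p k)"] orth by simp
  then have "ip (\<lambda>z. \<Sum>k<Suc (degree F). ip (poly F) (poly (p k)) * poly (p k) z) N = 0"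
    by (subst ip_sum) (auto intro!: continuous_intros N simp: ip_cmult)
  then have "ip (poly F) N = 0" using eq by metis
  then show ?thesis unfolding ip_cnj[of N] by simp
qed

text \<open>By compactness \<open>\<psi>\<close> maps an \<open>e\<close>-neighbourhood of the unit
  circle into \<open>V\<close>. A point of modulus between 1 and \<open>\<tau> = 1 + e / 2\<close>
  lies within \<open>e / 2\<close> of its radial projection, hence in that neighbourhood.\<close>

lemma level_in_neighbourhood:
  assumes V: "open V" "L1 \<subseteq> V" "inside L1 \<subseteq> V"
  obtains \<tau> where "1 < \<tau>" "\<And>x. x \<notin> V \<Longrightarrow> x \<in> Om \<psi> \<tau>"
proof -
  have op: "open (Ext \<rho>' \<inter> \<psi> -` V)"
    by (rule continuous_open_preimage[OF psi_cont open_Ext V(1)])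
  have "sphere 0 1 \<subseteq> Ext \<rho>' \<inter> \<psi> -` V"
  proof
    fix w :: complex assume w: "w \<in> sphere 0 1"
    then have "\<psi> w \<notin> outside L1" using psi_in_Om_iff[of 1 w] rho_bounds Om1 by auto
    then have "\<psi> w \<in> V" using V inside_Un_outside[of L1] by blast
    then show "w \<in> Ext \<rho>' \<inter> \<psi> -` V" using w rho_bounds by (auto simp: Ext_def)
  qed
  then obtain e where e: "0 < e" "(\<Union>w\<in>sphere 0 1. ball w e) \<subseteq> Ext \<rho>' \<inter> \<psi> -` V"
    using compact_subset_open_imp_ball_epsilon_subset[OF compact_sphere op] by metis
  define \<tau> where "\<tau> = 1 + e / 2"
  have "x \<in> Om \<psi> \<tau>" if x: "x \<notin> V" for x
  proof -
    have "x \<in> Om \<psi> 1" using x V inside_Un_outside[of L1] Om1 by blast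
    then obtain w where w: "x = \<psi> w" "1 < norm w" by (auto simp: Om_def Ext_def)
    have "\<not> norm w \<le> \<tau>"
    proof
      assume le: "norm w \<le> \<tau>"
      have "w / norm w - w = (1 / norm w - 1) * w" by (simp add: algebra_simps)
      then have "norm (w / norm w - w) = \<bar>1 / norm w - 1\<bar> * norm w"
        by (metis norm_mult norm_of_real of_real_1 of_real_diff of_real_divide)
      also have "\<dots> = norm w - 1"
      proof -
        have "0 < norm w" using w(2) by linarith
        then show ?thesis using w(2) by (simp add: abs_if field_simps)
      qed
      finally have "w \<in> ball (w / norm w) e" using le e(1) by (simp add: dist_norm \<tau>_def)
      moreover have "w / norm w \<in> sphere 0 1"
      proof -
        have "w \<noteq> 0" using w(2) by force
        then show ?thesis by (simp add: norm_divide)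
      qed
      ultimately have "w \<in> Ext \<rho>' \<inter> \<psi> -` V" using e(2) by blast
      then show False using x w(1) by auto
    qed
    then show ?thesis using w by (auto simp: Om_def Ext_def)
  qed
  then show ?thesis using e(1) by (intro that[of \<tau>]) (auto simp: \<tau>_def)
qed

lemma contour_circlepath:
  "contour_integral (circlepath 0 r) g = integral {0..1} (\<lambda>x. g (circlepath 0 r x) * (2 * of_real pi * \<i> * circlepath 0 r x))"
  unfolding contour_integral_integral vector_derivative_circlepath
  by (simp add: circlepath mult_ac)

text \<open>
  The Cauchy transform of a function orthogonal to all polynomials vanishes near infinity, hence on
  the whole exterior, and pairing with an analytic function is an integral of that transform
  along an exterior level curve.
\<close>
lemma orthogonal_polynomials_analytic:
  assumes N: "continuous_on L1 N" and orth: "\<And>k. ip N (poly (p k)) = 0"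
    and V: "open V" "L1 \<subseteq> V" "inside L1 \<subseteq> V" and M: "M holomorphic_on V"
  shows "ip N M = 0"
proof -
  define n where "n \<theta> = cnj (N (c \<theta>)) * of_real (\<omega> \<theta>)" for \<theta>
  have nc: "continuous_on {0..1} n" unfolding n_def by (intro continuous_intros cont_c N omega_cont)
  have cc: "continuous_on {0..1} c" by (rule continuous_on_subset[OF c_cont]) auto
  have mom: "integral {0..1} (\<lambda>\<theta>. n \<theta> * c \<theta> ^ k) = 0" for k
  proof -
    have "integral {0..1} (\<lambda>\<theta>. n \<theta> * c \<theta> ^ k) = ip (poly (monom 1 k)) N"
      unfolding ip_def n_def by (simp add: poly_monom mult_ac)
    also have "\<dots> = cnj (ip N (poly (monom 1 k)))" by (rule ip_cnj)
    finally show ?thesis using ip_eq_0_polynomials[OF N orth] by simp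
  qed
  obtain \<tau> where \<tau>: "1 < \<tau>" "\<And>x. x \<notin> V \<Longrightarrow> x \<in> Om \<psi> \<tau>"
    by (rule level_in_neighbourhood[OF V]) (rule that)
  have t': "\<rho>' < \<tau>" using \<tau> rho_bounds by simp
  have lev: "\<psi> ` sphere 0 \<tau> \<subseteq> outside L1 \<inter> V"
  proof
    fix x assume "x \<in> \<psi> ` sphere 0 \<tau>"
    then obtain w where w: "x = \<psi> w" "norm w = \<tau>" by auto
    have "x \<notin> Om \<psi> \<tau>" "x \<in> Om \<psi> 1"
      using psi_in_Om_iff[of \<tau> w] psi_in_Om_iff[of 1 w] w \<tau>(1) t' rho_bounds by auto
    then show "x \<in> outside L1 \<inter> V" using \<tau>(2) Om1 by blast
  qed
  define A where "A x = deriv \<psi> (circlepath 0 \<tau> x) * M (\<psi> (circlepath 0 \<tau> x)) * (2 * of_real pi * \<i> * circlepath 0 \<tau> x)" for x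
  define Z where "Z x = \<psi> (circlepath 0 \<tau> x)" for x
  have circ: "circlepath 0 \<tau> x \<in> sphere 0 \<tau>" for x
    using \<tau>(1) by (simp add: circlepath norm_mult norm_exp_eq_Re)
  have Zout: "Z x \<in> outside L1" "Z x \<in> V" for x using lev circ[of x] by (auto simp: Z_def)
  have circ_cont: "continuous_on UNIV (circlepath 0 \<tau>)" unfolding circlepath by (intro continuous_intros)
  have circ_Ext: "circlepath 0 \<tau> x \<in> Ext \<rho>'" for x using circ[of x] t' by (auto simp: Ext_def)
  have Zc: "continuous_on UNIV Z" unfolding Z_def
    by (rule continuous_on_compose2[OF psi_cont circ_cont]) (use circ_Ext in auto)
  have Ac: "continuous_on UNIV A"
  proof -
    have "continuous_on UNIV (\<lambda>x. deriv \<psi> (circlepath 0 \<tau> x))"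
      by (rule continuous_on_compose2[OF holomorphic_on_imp_continuous_on[OF holomorphic_deriv[OF univ_hol open_Ext]] circ_cont])
         (use circ_Ext in auto)
    moreover have "continuous_on UNIV (\<lambda>x. M (\<psi> (circlepath 0 \<tau> x)))"
      by (rule continuous_on_compose2[OF holomorphic_on_imp_continuous_on[OF M] Zc[unfolded Z_def]])
         (use Zout in \<open>auto simp: Z_def\<close>)
    ultimately show ?thesis unfolding A_def by (intro continuous_intros circ_cont)
  qed
  have Mc: "2 * of_real pi * \<i> * M z = integral {0..1} (\<lambda>x. A x / (Z x - z))" if z: "z \<in> L1" for z
  proof -
    \<comment> \<open>The winding number is computed as the integral of
      \<open>1 / (\<zeta> - z)\<close>, which is analytic outside the curve and has residue 1 at
      infinity.\<close>
    have wind: "winding_number (level \<tau>) z = 1"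
    proof -
      have zout: "z \<notin> Om \<psi> 1" using z Om1 outside_no_overlap[of L1] by blast
      have zp: "z \<notin> path_image (level \<tau>)"
        using lev z outside_no_overlap[of L1] level_path(3)[OF t'] by blast
      have "((\<lambda>\<zeta>. 1 / (1 - z / \<zeta>)) \<longlongrightarrow> 1 / (1 - 0)) at_infinity"
        by (intro tendsto_intros tendsto_divide_0[OF tendsto_const] filterlim_ident) auto
      then have "((\<lambda>\<zeta>. 1 / (1 - z / \<zeta>)) \<longlongrightarrow> 1) at_infinity" by simp
      then have "((\<lambda>\<zeta>. \<zeta> * (1 / (\<zeta> - z))) \<longlongrightarrow> 1) at_infinity"
        by (rule tendsto_at_infinity_cong_ne[where c = z]) (auto simp: field_simps)
      then have "contour_integral (level \<tau>) (\<lambda>\<zeta>. 1 / (\<zeta> - z)) = 2 * of_real pi * \<i> * 1"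
        by (intro exterior_contour_level[of 1]) (use \<tau>(1) rho_bounds zout in \<open>auto intro!: holomorphic_intros\<close>)
      then show ?thesis using winding_number_valid_path[OF level_path(1)[OF t'] zp] by simp
    qed
    have "((\<lambda>\<zeta>. M \<zeta> / (\<zeta> - z)) has_contour_integral 2 * pi * \<i> * winding_number (level \<tau>) z * M z) (level \<tau>)"
    proof (rule Cauchy_integral_formula_global[OF V(1) M])
      show "z \<in> V" using V z by auto
      show "path_image (level \<tau>) \<subseteq> V - {z}"
        using lev level_path(3)[OF t'] z outside_no_overlap[of L1] by blast
      show "winding_number (level \<tau>) w = 0" if "w \<notin> V" for w
        by (rule winding_level_outside[OF t' \<tau>(2)[OF that]])
    qed (use level_path t' in auto)
    then have "contour_integral (level \<tau>) (\<lambda>\<zeta>. M \<zeta> / (\<zeta> - z)) = 2 * of_real pi * \<i> * M z"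
      by (simp add: wind contour_integral_unique)
    then show ?thesis
      unfolding level_contour[OF t'] contour_circlepath by (simp add: A_def Z_def mult_ac)
  qed
  have Zne: "Z x - c \<theta> \<noteq> 0" for x \<theta>
    using Zout(1)[of x] c_per[of \<theta>] outside_no_overlap[of L1] by (metis IntI empty_iff eq_iff_diff_eq_0)
  have inner0: "integral {0..1} (\<lambda>\<theta>. n \<theta> / (Z x - c \<theta>)) = 0" for x
    by (rule Cauchy_transform_eq_0_outside[OF cc nc mom Zout(1)])
  have "2 * of_real pi * \<i> * cnj (ip N M) = integral {0..1} (\<lambda>\<theta>. n \<theta> * (2 * of_real pi * \<i> * M (c \<theta>)))"
  proof -
    have e: "cnj (ip N M) = ip M N" by (rule ip_cnj[symmetric])
    show ?thesis unfolding e unfolding ip_def n_def integral_mult_right[symmetric]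
      by (rule integral_cong) (simp add: mult_ac)
  qed
  also have "\<dots> = integral {0..1} (\<lambda>\<theta>. integral {0..1} (\<lambda>x. n \<theta> * A x / (Z x - c \<theta>)))"
    unfolding Mc[OF c_per] integral_mult_right[symmetric] by simp
  \<comment> \<open>The level curve lies strictly outside, so the double integrand is continuous and
    the order of integration may be exchanged.\<close>
  also have "\<dots> = integral {0..1} (\<lambda>x. integral {0..1} (\<lambda>\<theta>. n \<theta> * A x / (Z x - c \<theta>)))"
  proof -
    have "continuous_on ({0..1} \<times> {0..1}) (\<lambda>y. n (fst y))"
      by (rule continuous_on_compose2[OF nc continuous_on_fst[OF continuous_on_id]]) auto
    moreover have "continuous_on ({0..1} \<times> {0..1}) (\<lambda>y. c (fst y))"
      by (rule continuous_on_compose2[OF cc continuous_on_fst[OF continuous_on_id]]) auto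
    moreover have "continuous_on ({0..1} \<times> {0..1}) (\<lambda>y. A (snd y))"
      by (rule continuous_on_compose2[OF Ac continuous_on_snd[OF continuous_on_id]]) auto
    moreover have "continuous_on ({0..1} \<times> {0..1}) (\<lambda>y. Z (snd y))"
      by (rule continuous_on_compose2[OF Zc continuous_on_snd[OF continuous_on_id]]) auto
    ultimately have "continuous_on ({0..1} \<times> {0..1}) (\<lambda>(\<theta>, x). n \<theta> * A x / (Z x - c \<theta>))"
      unfolding split_def using Zne by (intro continuous_intros) auto
    then have "continuous_on (cbox (0, 0) (1, 1)) (\<lambda>(\<theta>, x). n \<theta> * A x / (Z x - c \<theta>))"
      by (simp add: cbox_Pair_eq)
    from integral_swap_continuous[OF this] show ?thesis by simp
  qed
  also have "\<dots> = integral {0..1} (\<lambda>x. A x * integral {0..1} (\<lambda>\<theta>. n \<theta> / (Z x - c \<theta>)))"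
    unfolding integral_mult_right[symmetric] by (simp add: mult_ac)
  also have "\<dots> = 0" unfolding inner0 by simp
  finally show ?thesis by simp
qed

end

subsection \<open>The interior kernel\<close>

locale szego_kernel = szego_setting +
  fixes Di f qf :: "complex \<Rightarrow> complex"
  assumes Di: "interior_szego c h \<psi> Di" and kern: "interior_map \<psi> \<rho>' f qf"
begin

definition G1 where "G1 = inside L1 \<union> L1"

lemma Gd_recip_facts: "open (Gd_recip \<psi> \<rho>')" "G1 \<subseteq> Gd_recip \<psi> \<rho>'"
proof -
  show "open (Gd_recip \<psi> \<rho>')" by (auto simp: Gd_recip_def Gd_def)
  show "G1 \<subseteq> Gd_recip \<psi> \<rho>'"
  proof (cases "\<rho>' = 0")
    case False
    then have r: "0 < \<rho>'" "1 < 1 / \<rho>'" using rho_bounds by auto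
    have "closure (Om \<psi> (1 / \<rho>')) \<subseteq> \<psi> ` {w. 1 / \<rho>' \<le> norm w}"
      by (rule closure_Om) (use r rho_bounds in linarith)
    also have "\<dots> \<subseteq> outside L1" unfolding Om1[symmetric] Om_def
      by (rule image_mono) (use less_le_trans[OF r(2)] in \<open>auto simp: Ext_def\<close>)
    finally show ?thesis using False union_with_inside[of L1] by (auto simp: Gd_recip_def Gd_def G1_def)
  qed (simp add: Gd_recip_def)
qed

lemma f_hol: "f holomorphic_on Gd_recip \<psi> \<rho>'" and qf_hol: "qf holomorphic_on Gd_recip \<psi> \<rho>'"
  and f_inj: "inj_on f (Gd_recip \<psi> \<rho>')" and qf_sq: "z \<in> Gd_recip \<psi> \<rho>' \<Longrightarrow> (qf z)\<^sup>2 = deriv f z"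
  and f_image: "f ` inside L1 = ball 0 1"
  using kern unfolding interior_map_def inside_facts(1) by blast+

lemma df_nz: "z \<in> Gd_recip \<psi> \<rho>' \<Longrightarrow> deriv f z \<noteq> 0"
  by (rule holomorphic_injective_imp_regular[OF f_hol Gd_recip_facts(1) f_inj])

lemma f_inside: "z \<in> inside L1 \<Longrightarrow> norm (f z) < 1"
  using f_image by (metis imageI mem_ball_0)

text \<open>By continuity the value lies in the closed disk. It cannot lie in the open disk: each
  value there is already taken inside the curve, and \<open>f\<close> is injective on a domain
  containing the curve.\<close>

lemma f_L1: assumes "z \<in> L1" shows "norm (f z) = 1"
proof -
  have "f ` closure (inside L1) \<subseteq> cball 0 1"
  proof (rule image_closure_subset)
    show "continuous_on (closure (inside L1)) f"
      unfolding inside_facts(2) using Gd_recip_facts(2) G1_def f_hol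
      by (metis continuous_on_subset holomorphic_on_imp_continuous_on)
  qed (use f_inside in \<open>auto simp: less_imp_le\<close>)
  then have le: "norm (f z) \<le> 1" using assms inside_facts(2) by auto
  have "f z \<notin> ball 0 1"
  proof
    assume "f z \<in> ball 0 1"
    then obtain x where x: "x \<in> inside L1" "f x = f z" using f_image by (metis imageE)
    then have "x = z" using inj_onD[OF f_inj x(2)] assms Gd_recip_facts(2) by (auto simp: G1_def)
    then show False using x(1) assms inside_no_overlap[of L1] by blast
  qed
  then show ?thesis using le by simp
qed

lemma Di_neighbourhood:
  obtains V where "open V" "G1 \<subseteq> V" "V \<subseteq> Gd_recip \<psi> \<rho>'" "Di holomorphic_on V" "\<And>z. z \<in> V \<Longrightarrow> Di z \<noteq> 0"
proof -
  have cl: "closure (Gd \<psi> 1) = G1" using inside_facts by (simp add: G1_def)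
  obtain T where T: "open T" "G1 \<subseteq> T" "Di holomorphic_on T"
    using Di unfolding interior_szego_def cl analytic_on_holomorphic by blast
  have op: "open (T \<inter> Di -` (- {0}))"
    by (rule continuous_open_preimage[OF holomorphic_on_imp_continuous_on[OF T(3)] T(1)]) auto
  show ?thesis
  proof (rule that)
    show "open (T \<inter> Di -` (- {0}) \<inter> Gd_recip \<psi> \<rho>')" using op Gd_recip_facts by auto
    show "G1 \<subseteq> T \<inter> Di -` (- {0}) \<inter> Gd_recip \<psi> \<rho>'"
      using T Gd_recip_facts Di unfolding interior_szego_def cl by auto
    show "Di holomorphic_on T \<inter> Di -` (- {0}) \<inter> Gd_recip \<psi> \<rho>'"
      using T(3) by (rule holomorphic_on_subset) auto
  qed auto
qed

text \<open>The Szego projection written with the kernel. Applied to \<open>B n\<close> it is the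
  main term of the interior expansion.\<close>

definition transform where
  "transform g z = inverse (Di z) / (2 * of_real pi * \<i>) * contour_integral c (\<lambda>\<zeta>. g \<zeta> * Di \<zeta> * W_kernel f qf \<zeta> z)"

text \<open>The kernel is a Cauchy kernel in disguise: \<open>f \<zeta> - f z\<close> is
  \<open>\<zeta> - z\<close> times the difference quotient \<open>e\<close>, which has no zeros by
  univalence of \<open>f\<close>. At \<open>\<zeta> = z\<close> the remaining factor is
  \<open>(qf z)^2 / deriv f z = 1\<close>, and Cauchy's formula applies.\<close>

lemma transform_entire:
  assumes F: "F holomorphic_on UNIV" and z: "z \<in> inside L1"
  shows "transform F z = F z"
proof -
  obtain V where V: "open V" "G1 \<subseteq> V" "V \<subseteq> Gd_recip \<psi> \<rho>'" "Di holomorphic_on V" "\<And>z. z \<in> V \<Longrightarrow> Di z \<noteq> 0"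
    by (rule Di_neighbourhood) (rule that)
  have zV: "z \<in> V" using V(2) z by (auto simp: G1_def)
  define e where "e \<zeta> = (if \<zeta> = z then deriv f z else (f \<zeta> - f z) / (\<zeta> - z))" for \<zeta>
  have fV: "f holomorphic_on V" "qf holomorphic_on V" using V(3) f_hol qf_hol holomorphic_on_subset by blast+
  have e: "e holomorphic_on V" unfolding e_def by (rule pole_lemma_open[OF fV(1) V(1)])
  have enz: "e \<zeta> \<noteq> 0" if "\<zeta> \<in> V" for \<zeta>
  proof (cases "\<zeta> = z")
    case True
    then show ?thesis using df_nz[of z] zV V(3) by (auto simp: e_def)
  next
    case False
    then have "f \<zeta> \<noteq> f z" using inj_onD[OF f_inj, of \<zeta> z] that zV V(3) by auto
    then show ?thesis using False by (simp add: e_def)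
  qed
  define g where "g \<zeta> = F \<zeta> * Di \<zeta> * (qf z * qf \<zeta> / e \<zeta>)" for \<zeta>
  have g: "g holomorphic_on V" unfolding g_def
    by (intro holomorphic_intros V fV e holomorphic_on_subset[OF F]) (use enz in auto)
  have "((\<lambda>\<zeta>. g \<zeta> / (\<zeta> - z)) has_contour_integral 2 * pi * \<i> * winding_number c z * g z) c"
  proof (rule Cauchy_integral_formula_global[OF V(1) g zV c_valid _ c_loop])
    show "L1 \<subseteq> V - {z}" using V(2) z inside_no_overlap[of L1] unfolding G1_def by blast
    show "winding_number c w = 0" if "w \<notin> V" for w
      by (rule winding_outside) (use that V(2) inside_Un_outside[of L1] in \<open>unfold G1_def, blast\<close>)
  qed
  then have "contour_integral c (\<lambda>\<zeta>. g \<zeta> / (\<zeta> - z)) = 2 * of_real pi * \<i> * g z"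
    by (simp add: winding_inside[OF z] contour_integral_unique)
  moreover have "g z = F z * Di z"
    using qf_sq[of z] df_nz[of z] zV V(3) by (auto simp: g_def e_def power2_eq_square)
  moreover have "contour_integral c (\<lambda>\<zeta>. g \<zeta> / (\<zeta> - z)) = contour_integral c (\<lambda>\<zeta>. F \<zeta> * Di \<zeta> * W_kernel f qf \<zeta> z)"
  proof (rule contour_integral_eq)
    fix \<zeta> assume \<zeta>: "\<zeta> \<in> L1"
    then have "\<zeta> \<noteq> z" using z inside_no_overlap[of L1] by blast
    then show "g \<zeta> / (\<zeta> - z) = F \<zeta> * Di \<zeta> * W_kernel f qf \<zeta> z"
      by (simp add: g_def e_def W_kernel_def)
  qed
  ultimately show ?thesis unfolding transform_def using V(5)[OF zV] by (simp add: field_simps)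
qed

text \<open>
  On the curve the kernel is the Szego kernel of the interior, so the contour integral is a
  weighted inner product with a function analytic across the curve.
\<close>
lemma transform_as_ip:
  assumes z: "z \<in> inside L1"
  obtains k M V where "open V" "L1 \<subseteq> V" "inside L1 \<subseteq> V" "M holomorphic_on V"
    "\<And>g. transform g z = k * ip g M"
proof -
  obtain V where V: "open V" "G1 \<subseteq> V" "V \<subseteq> Gd_recip \<psi> \<rho>'" "Di holomorphic_on V" "\<And>z. z \<in> V \<Longrightarrow> Di z \<noteq> 0"
    by (rule Di_neighbourhood) (rule that)
  have fV: "f holomorphic_on V" "qf holomorphic_on V" using V(3) f_hol qf_hol holomorphic_on_subset by blast+
  \<comment> \<open>The zeros of \<open>1 - cnj (f z) * f \<zeta>\<close> are removed. None lies on
    the curve or inside it, since \<open>norm (f z) < 1\<close> and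
    \<open>norm (f \<zeta>) \<le> 1\<close> there.\<close>
  define V' where "V' = V \<inter> (\<lambda>\<zeta>. 1 - cnj (f z) * f \<zeta>) -` (- {0})"
  have fz: "norm (f z) < 1" by (rule f_inside[OF z])
  have opV': "open V'" unfolding V'_def
    by (rule continuous_open_preimage[OF _ V(1)])
       (intro continuous_intros holomorphic_on_imp_continuous_on[OF fV(1)], auto)
  have "1 - cnj (f z) * f \<zeta> \<noteq> 0" if "\<zeta> \<in> G1" for \<zeta>
  proof
    assume "1 - cnj (f z) * f \<zeta> = 0"
    then have "norm (f z) * norm (f \<zeta>) = 1"
      by (metis complex_mod_cnj eq_iff_diff_eq_0 norm_mult norm_one)
    moreover have "norm (f \<zeta>) \<le> 1" using that f_inside f_L1 by (force simp: G1_def)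
    then have "norm (f z) * norm (f \<zeta>) \<le> norm (f z) * 1" by (intro mult_left_mono) auto
    ultimately show False using fz by simp
  qed
  then have G1V': "G1 \<subseteq> V'" using V(2) by (auto simp: V'_def)
  define M where "M \<zeta> = qf \<zeta> / (Di \<zeta> * (1 - cnj (f z) * f \<zeta>))" for \<zeta>
  have sV: "V' \<subseteq> V" by (auto simp: V'_def)
  have M: "M holomorphic_on V'" unfolding M_def
    by (intro holomorphic_intros holomorphic_on_subset[OF fV(1) sV] holomorphic_on_subset[OF fV(2) sV]
          holomorphic_on_subset[OF V(4) sV]) (use V(5) in \<open>auto simp: V'_def\<close>)
  have cV: "c t \<in> V" for t using c_per[of t] V(2) by (auto simp: G1_def)
  have cR: "c t \<in> Gd_recip \<psi> \<rho>'" for t using cV V(3) by auto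
  obtain \<sigma> where \<sigma>: "\<sigma> = 1 \<or> \<sigma> = - 1"
    "\<And>t. of_real (norm (deriv f (c t)) * norm (c' t)) = \<sigma> * deriv f (c t) * c' t / (\<i> * f (c t))"
    using unimodular_tangent[OF c_der c'_cont c'_nz V(1) fV(1) cV] f_L1[OF c_per] df_nz[OF cR] by auto
  \<comment> \<open>The constant absorbs the sign \<open>\<sigma>\<close>, whose value may stay
    open: later arguments use only that the transform is a fixed multiple of the pairing.\<close>
  define k where "k = inverse (Di z) / (2 * of_real pi * \<i>) * (2 * of_real pi * \<i> * \<sigma> * qf z)"
  have "transform g z = k * ip g M" for g
  proof -
    have "contour_integral c (\<lambda>\<zeta>. g \<zeta> * Di \<zeta> * W_kernel f qf \<zeta> z) = (2 * of_real pi * \<i> * \<sigma> * qf z) * ip g M"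
      unfolding ip_def contour_c integral_mult_right[symmetric]
    proof (rule integral_cong)
      fix t :: real
      define \<zeta> where "\<zeta> = c t"
      have \<zeta>: "\<zeta> \<in> L1" "\<zeta> \<in> V" "\<zeta> \<in> Gd_recip \<psi> \<rho>'" using c_per cV cR by (auto simp: \<zeta>_def)
      have f1: "norm (f \<zeta>) = 1" by (rule f_L1[OF \<zeta>(1)])
      have nz: "f \<zeta> \<noteq> 0" "Di \<zeta> \<noteq> 0" "qf \<zeta> \<noteq> 0" "f \<zeta> - f z \<noteq> 0"
        using f1 V(5)[OF \<zeta>(2)] qf_sq[OF \<zeta>(3)] df_nz[OF \<zeta>(3)] fz by auto
      have cf: "cnj (f \<zeta>) = 1 / f \<zeta>"
        using f1 nz(1) complex_norm_square[of "f \<zeta>"] by (simp add: field_simps)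
      have qq: "of_real (norm (deriv f \<zeta>)) = qf \<zeta> * cnj (qf \<zeta>)"
        unfolding qf_sq[OF \<zeta>(3), symmetric] norm_power complex_norm_square by simp
      have "qf \<zeta> * cnj (qf \<zeta>) * of_real (norm (c' t)) = \<sigma> * (qf \<zeta>)\<^sup>2 * c' t / (\<i> * f \<zeta>)"
        using \<sigma>(2)[of t] unfolding \<zeta>_def[symmetric] qf_sq[OF \<zeta>(3)] by (simp add: qq)
      then have "cnj (qf \<zeta>) * of_real (norm (c' t)) = \<sigma> * qf \<zeta> * c' t / (\<i> * f \<zeta>)"
        using nz by (simp add: power2_eq_square field_simps)
      then have "\<sigma> * \<sigma> * (qf \<zeta> * c' t) = \<sigma> * \<i> * f \<zeta> * (cnj (qf \<zeta>) * of_real (norm (c' t)))"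
        using nz by (simp add: field_simps)
      moreover have "\<sigma> * \<sigma> = 1" using \<sigma>(1) by auto
      ultimately have qc: "qf \<zeta> * c' t = \<sigma> * \<i> * f \<zeta> * (cnj (qf \<zeta>) * of_real (norm (c' t)))" by simp
      have "h \<zeta> = of_real ((norm (Di \<zeta>))\<^sup>2)" using Di \<zeta>(1) by (simp add: interior_szego_def)
      then have "Re (h \<zeta>) = (norm (Di \<zeta>))\<^sup>2" by simp
      then have hD: "of_real (Re (h \<zeta>)) = Di \<zeta> * cnj (Di \<zeta>)" by (simp only: complex_norm_square)
      \<comment> \<open>Where \<open>norm (f \<zeta>) = 1\<close>, the conjugate of the Szego
        denominator is the Cauchy denominator of \<open>W_kernel\<close> up to the factor
        \<open>f \<zeta>\<close>.\<close>
      have ff: "1 / (1 - f z * cnj (f \<zeta>)) = f \<zeta> / (f \<zeta> - f z)"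
        unfolding cf using nz by (simp add: divide_simps)
      have Mc: "cnj (M \<zeta>) = cnj (qf \<zeta>) / cnj (Di \<zeta>) * (f \<zeta> / (f \<zeta> - f z))"
        unfolding ff[symmetric] by (simp add: M_def)
      have "g \<zeta> * Di \<zeta> * W_kernel f qf \<zeta> z * c' t = g \<zeta> * Di \<zeta> * (qf z / (f \<zeta> - f z)) * (qf \<zeta> * c' t)"
        by (simp add: W_kernel_def)
      also have "\<dots> = 2 * of_real pi * \<i> * \<sigma> * qf z * (g \<zeta> * cnj (M \<zeta>) * (of_real (Re (h \<zeta>)) * of_real (norm (c' t)) / (2 * of_real pi)))"
        unfolding qc Mc hD using nz by (simp add: field_simps)
      finally show "g (c t) * Di (c t) * W_kernel f qf (c t) z * c' t
          = 2 * of_real pi * \<i> * \<sigma> * qf z * (g (c t) * cnj (M (c t)) * of_real (\<omega> t))"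
        by (simp add: \<zeta>_def \<omega>_def)
    qed
    then show ?thesis unfolding transform_def k_def by simp
  qed
  then show ?thesis using G1V' that[OF opV' _ _ M] by (auto simp: G1_def)
qed

end

section \<open>The interior asymptotics\<close>

locale szego_full =
  szego_levels c c' h \<psi> \<phi> q De p lc \<rho>' \<rho> b d s s' t +
  szego_kernel c c' h \<psi> \<phi> q De p lc \<rho>' \<rho> b d Di f qf
  for c c' :: "real \<Rightarrow> complex"
    and h \<psi> \<phi> q De :: "complex \<Rightarrow> complex"
    and p :: "nat \<Rightarrow> complex poly"
    and lc :: "nat \<Rightarrow> real"
    and \<rho>' \<rho> b d s s' t :: real
    and Di f qf :: "complex \<Rightarrow> complex"
begin

lemma L1_inside_not_Om: assumes "z \<in> L1 \<union> inside L1" shows "z \<notin> Om \<psi> t"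
proof -
  have "Om \<psi> t \<subseteq> outside L1" using Om_mono[of 1 t] t(1) Om1 by simp
  then show ?thesis using assms outside_no_overlap[of L1] inside_Int_outside[of L1] by blast
qed

text \<open>
  The difference of \<open>R n\<close> and its orthogonal series is orthogonal to all polynomials, so the
  transform, which fixes polynomials, annihilates it.
\<close>
lemma transform_R_sums:
  assumes z: "z \<in> inside L1"
  shows "(\<lambda>k. ip (R n) (poly (p k)) * poly (p k) z) sums transform (R n) z"
proof -
  obtain C1 where C1: "0 < C1" "\<And>n k. norm (ip (R n) (poly (p k))) \<le> C1 * s ^ (n + k)"
    by (rule ip_R_p_bound) (rule that)
  obtain C2 where C2: "0 < C2" "\<And>k z. z \<notin> Om \<psi> t \<Longrightarrow> norm (poly (p k) z) \<le> C2 * t ^ k"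
    by (rule p_bound) (rule that)
  define a where "a k = ip (R n) (poly (p k))" for k
  define S where "S m x = (\<Sum>k<m. a k * poly (p k) x)" for m x
  define S' where "S' x = (\<Sum>k. a k * poly (p k) x)" for x
  have st: "norm (s * t) < 1" using s_bounds t by (simp add: abs_mult)
  \<comment> \<open>The level \<open>t > 1\<close> encloses the curve, so the bound
    \<open>t ^ k\<close> from \<open>p_bound\<close> holds on the curve and inside it; the majorant
    is geometric in \<open>s * t\<close>.\<close>
  have ul: "uniform_limit (L1 \<union> inside L1) S S' sequentially"
    unfolding S_def S'_def
  proof (rule Weierstrass_m_test)
    fix k x assume x: "x \<in> L1 \<union> inside L1"
    have "norm (a k * poly (p k) x) \<le> (C1 * s ^ (n + k)) * (C2 * t ^ k)"
      unfolding norm_mult a_def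
      by (rule mult_mono[OF C1(2) C2(2)[OF L1_inside_not_Om[OF x]]]) (use C1(1) s_bounds(1) in auto)
    also have "\<dots> = C1 * C2 * s ^ n * (s * t) ^ k" by (simp add: power_add power_mult_distrib)
    finally show "norm (a k * poly (p k) x) \<le> C1 * C2 * s ^ n * (s * t) ^ k" .
  next
    show "summable (\<lambda>k. C1 * C2 * s ^ n * (s * t) ^ k)"
      by (rule summable_mult[OF summable_geometric[OF st]])
  qed
  have ulL: "uniform_limit L1 S S' sequentially" by (rule uniform_limit_on_subset[OF ul]) auto
  have Sz: "(\<lambda>m. S m z) \<longlonglongrightarrow> S' z" by (rule tendsto_uniform_limitI[OF ul]) (use z in auto)
  have Sc: "continuous_on A (S m)" for A m unfolding S_def by (intro continuous_intros)
  have S'c: "continuous_on L1 S'" by (rule uniform_limit_theorem[OF _ ulL]) (use Sc in auto)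
  define N where "N x = R n x - S' x" for x
  have Nc: "continuous_on L1 N" unfolding N_def by (intro continuous_intros R_cont S'c)
  have Sp: "ip (S m) (poly (p j)) = a j" if "j < m" for m j
  proof -
    have "ip (S m) (poly (p j)) = (\<Sum>k<m. a k * ip (poly (p k)) (poly (p j)))"
      unfolding S_def by (subst ip_sum) (auto intro!: continuous_intros simp: ip_cmult)
    also have "\<dots> = (\<Sum>k<m. if k = j then a j else 0)"
      by (intro sum.cong) (auto simp: orthonormal)
    finally show ?thesis using that by simp
  qed
  have orth: "ip N (poly (p j)) = 0" for j
  proof -
    have "(\<lambda>m. ip (S m) (poly (p j))) \<longlonglongrightarrow> ip S' (poly (p j))"
      by (rule ip_uniform_limit[OF Sc poly_cont ulL])
    moreover have "(\<lambda>m. ip (S m) (poly (p j))) \<longlonglongrightarrow> a j"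
      by (rule tendsto_eventually) (use Sp in \<open>auto intro: eventually_sequentiallyI[of "Suc j"]\<close>)
    ultimately have "ip S' (poly (p j)) = a j" using LIMSEQ_unique by blast
    then show ?thesis
      unfolding N_def ip_diff[OF R_cont S'c poly_cont] by (simp add: a_def)
  qed
  obtain k M V where kM: "open V" "L1 \<subseteq> V" "inside L1 \<subseteq> V" "M holomorphic_on V"
    "\<And>g. transform g z = k * ip g M"
    by (rule transform_as_ip[OF z]) (rule that)
  have Mc: "continuous_on L1 M" using kM(2,4) continuous_on_subset holomorphic_on_imp_continuous_on by blast
  have "ip N M = 0" by (rule orthogonal_polynomials_analytic[OF Nc orth kM(1-4)])
  then have RS: "ip (R n) M = ip S' M" unfolding N_def ip_diff[OF R_cont S'c Mc] by simp
  have "(\<lambda>m. k * ip (S m) M) \<longlonglongrightarrow> k * ip S' M"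
    by (intro tendsto_intros ip_uniform_limit[OF Sc Mc ulL])
  moreover have "k * ip (S m) M = S m z" for m
  proof -
    have "S m holomorphic_on UNIV" unfolding S_def by (intro holomorphic_intros)
    from transform_entire[OF this z] show ?thesis using kM(5)[of "S m"] by simp
  qed
  ultimately have "(\<lambda>m. S m z) \<longlonglongrightarrow> transform (R n) z" by (simp add: kM(5)[of "R n"] RS)
  then show ?thesis unfolding sums_def S_def a_def .
qed

text \<open>Linearity of the transform is read off from its form as a pairing, and
  \<open>Fp n\<close> is reproduced because it is entire.\<close>

lemma transform_B:
  assumes z: "z \<in> inside L1"
  shows "transform (B n) z = poly (Fp n) z - transform (R n) z"
proof -
  obtain k M V where kM: "open V" "L1 \<subseteq> V" "inside L1 \<subseteq> V" "M holomorphic_on V"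
    "\<And>g. transform g z = k * ip g M"
    by (rule transform_as_ip[OF z]) (rule that)
  have Mc: "continuous_on L1 M" using kM(2,4) continuous_on_subset holomorphic_on_imp_continuous_on by blast
  have "ip (R n) M = ip (poly (Fp n)) M - ip (B n) M"
    unfolding R_def[abs_def] by (rule ip_diff[OF poly_cont B_cont Mc])
  then have "transform (R n) z = transform (poly (Fp n)) z - transform (B n) z"
    unfolding kM(5) by (simp only: right_diff_distrib)
  moreover have "transform (poly (Fp n)) z = poly (Fp n) z"
    by (rule transform_entire[OF _ z]) (intro holomorphic_intros)
  ultimately show ?thesis by simp
qed

text \<open>Sharpens \<open>p_bound\<close> on smaller levels: the approximation of
  \<open>p n\<close> by a multiple of \<open>B n\<close> is now available down to \<open>s'\<close>,
  so the growth on the level \<open>r\<close> is that of \<open>B n\<close>. This is the source of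
  the factor \<open>r ^ n\<close> in the interior error.\<close>

lemma interior_p_bound:
  assumes r: "s' \<le> r" "r \<le> t"
  obtains C where "0 < C" "\<And>k z. z \<notin> Om \<psi> r \<Longrightarrow> norm (poly (p k) z) \<le> C * r ^ k"
proof -
  have r0: "0 < r" "\<rho>' < r" "\<rho> < r" "s \<le> r" using r s s_bounds by auto
  obtain C where C: "0 < C"
    "\<And>n w. s' \<le> norm w \<Longrightarrow> norm w \<le> t \<Longrightarrow> norm (of_real (1 / \<xi> n) * poly (p n) (\<psi> w) - B n (\<psi> w)) \<le> C * s ^ n"
    by (rule p_minus_B_bound) (rule that)
  obtain M where M: "0 < M" "\<And>n w. norm w = r \<Longrightarrow> norm (B n (\<psi> w)) \<le> M * r ^ n"
    by (rule B_level_bound[OF r0(3)]) (rule that)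
  have level: "norm (poly (p k) (\<psi> w)) \<le> (C + M) * r ^ k" if w: "norm w = r" for k w
  proof -
    let ?x = "of_real (1 / \<xi> k) * poly (p k) (\<psi> w)"
    have "norm ?x \<le> norm (?x - B k (\<psi> w)) + norm (B k (\<psi> w))"
      using norm_triangle_ineq[of "?x - B k (\<psi> w)" "B k (\<psi> w)"] by simp
    also have "\<dots> \<le> C * s ^ k + M * r ^ k"
      using C(2)[of w k] M(2)[OF w, of k] r w by simp
    also have "\<dots> \<le> C * r ^ k + M * r ^ k"
      using C(1) r0 s_bounds(1) by (intro add_right_mono mult_left_mono power_mono) auto
    finally have x: "norm ?x \<le> (C + M) * r ^ k" by (simp add: algebra_simps)
    have "poly (p k) (\<psi> w) = of_real (\<xi> k) * ?x" using xi_pos[of k] by simp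
    then have "norm (poly (p k) (\<psi> w)) = \<xi> k * norm ?x"
      using xi_pos[of k] by (metis abs_of_pos norm_mult norm_of_real)
    also have "\<dots> \<le> 1 * norm ?x" by (rule mult_right_mono[OF xi_le_1]) simp
    finally show ?thesis using x by simp
  qed
  have main: "norm (poly (p k) z) \<le> (C + M) * r ^ k" if "z \<notin> Om \<psi> r" for k z
  proof (rule maximum_modulus_level[OF r0(2) _ _ that])
    show "norm (poly (p k) (\<psi> w)) \<le> (C + M) * r ^ k" if "norm w = r" for w by (rule level[OF that])
  qed (intro holomorphic_intros)
  have "0 < C + M" using C(1) M(1) by simp
  then show ?thesis by (rule that[OF _ main])
qed

text \<open>The lower terms of the series for \<open>transform (R n)\<close> cancel those in the
  expansion of \<open>Fp n\<close>, leaving the terms with index at least \<open>n\<close>. Such a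
  term is of order \<open>s ^ (n + k) * r ^ k\<close>; at \<open>k = n\<close> this is
  \<open>r ^ n * s ^ (2 * n)\<close>, and the rest is geometric in \<open>s * r\<close>.\<close>

lemma interior_asymptotics:
  assumes r: "s' \<le> r" "r < 1"
  obtains C where "0 < C"
    "\<And>n z. z \<notin> Om \<psi> r \<Longrightarrow> norm (of_real (1 / \<xi> n) * poly (p n) z - transform (B n) z) \<le> C * (r ^ n * s ^ (2 * n))"
proof -
  have r0: "0 < r" "\<rho>' \<le> r" "r \<le> t" using r s s_bounds t by auto
  obtain C1 where C1: "0 < C1" "\<And>n k. norm (ip (R n) (poly (p k))) \<le> C1 * s ^ (n + k)"
    by (rule ip_R_p_bound) (rule that)
  obtain C2 where C2: "0 < C2" "\<And>k z. z \<notin> Om \<psi> r \<Longrightarrow> norm (poly (p k) z) \<le> C2 * r ^ k"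
    by (rule interior_p_bound[OF r(1) r0(3)]) (rule that)
  have sr: "0 \<le> s * r" "s * r < 1"
  proof -
    have "s * r < 1 * 1" by (rule mult_strict_mono) (use r r0 s_bounds in auto)
    then show "0 \<le> s * r" "s * r < 1" using r0 s_bounds by auto
  qed
  have main: "norm (of_real (1 / \<xi> n) * poly (p n) z - transform (B n) z) \<le> C1 * C2 / (1 - s * r) * (r ^ n * s ^ (2 * n))"
    if z: "z \<notin> Om \<psi> r" for n z
  proof -
    have zi: "z \<in> inside L1" by (rule Compl_Om_inside[OF r0(2) r(2) z])
    define a where "a k = ip (R n) (poly (p k)) * poly (p k) z" for k
    have sums: "a sums transform (R n) z" unfolding a_def by (rule transform_R_sums[OF zi])
    have "of_real (1 / \<xi> n) * poly (p n) z - transform (B n) z = transform (R n) z - (\<Sum>k<n. a k)"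
      unfolding transform_B[OF zi] Fp_expansion a_def by simp
    also have "\<dots> = (\<Sum>k. a (k + n))"
      using sums suminf_minus_initial_segment[OF sums_summable[OF sums], of n] sums_unique[OF sums] by simp
    finally have eq: "of_real (1 / \<xi> n) * poly (p n) z - transform (B n) z = (\<Sum>k. a (k + n))" .
    have an: "norm (a (k + n)) \<le> C1 * C2 * (r ^ n * s ^ (2 * n)) * (s * r) ^ k" for k
    proof -
      have "norm (a (k + n)) \<le> (C1 * s ^ (n + (k + n))) * (C2 * r ^ (k + n))"
        unfolding a_def norm_mult
        by (rule mult_mono[OF C1(2) C2(2)[OF z]]) (use C1(1) s_bounds(1) in auto)
      also have "\<dots> = C1 * C2 * (r ^ n * s ^ (2 * n)) * (s * r) ^ k"
        by (simp add: power_add power_mult_distrib mult_2)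
      finally show ?thesis .
    qed
    have gs: "(\<lambda>k. C1 * C2 * (r ^ n * s ^ (2 * n)) * (s * r) ^ k) sums (C1 * C2 * (r ^ n * s ^ (2 * n)) * (1 / (1 - s * r)))"
      by (intro sums_mult geometric_sums) (use sr in auto)
    have "norm (\<Sum>k. a (k + n)) \<le> (\<Sum>k. C1 * C2 * (r ^ n * s ^ (2 * n)) * (s * r) ^ k)"
      by (rule norm_suminf_le[OF an sums_summable[OF gs]])
    also have "\<dots> = C1 * C2 / (1 - s * r) * (r ^ n * s ^ (2 * n))"
      using sums_unique[OF gs] by simp
    finally show ?thesis unfolding eq .
  qed
  have "0 < C1 * C2 / (1 - s * r)" using C1(1) C2(1) sr by simp
  then show ?thesis by (rule that[OF _ main])
qed

end

section \<open>Passage from the given curve to a parametrization of the whole real line\<close>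

lemma vector_derivative_within_cong:
  assumes "\<And>x. x \<in> S \<Longrightarrow> f x = g x" "t \<in> S"
  shows "vector_derivative f (at t within S) = vector_derivative g (at t within S)"
proof -
  have "(f has_vector_derivative D) (at t within S) \<longleftrightarrow> (g has_vector_derivative D) (at t within S)" for D
    using has_vector_derivative_transform[of t S f g D] has_vector_derivative_transform[of t S g f D] assms by auto
  then show ?thesis by (simp add: vector_derivative_def)
qed

text \<open>Two paths that agree on the unit interval have the same derivatives within it, whatever
  they do elsewhere; this lets integrals along the given curve be computed on its periodic
  extension.\<close>

lemma contour_integral_path_cong:
  assumes "\<And>x. x \<in> {0..1} \<Longrightarrow> f x = g x"
  shows "contour_integral f u = contour_integral g u"
proof -
  have "(u has_contour_integral I) f \<longleftrightarrow> (u has_contour_integral I) g" for I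
    unfolding has_contour_integral_def
    by (rule has_integral_cong) (use vector_derivative_within_cong[of "{0..1}" f g] assms in auto)
  then show ?thesis by (simp add: contour_integral_def contour_integrable_on_def)
qed

text \<open>The univalent \<open>F\<close> is composed with the exponential on the whole real line.
  Univalence near the circle gives both simplicity of the path and a derivative without
  zeros.\<close>

lemma analytic_jordan_path_parametrization:
  assumes "analytic_jordan_path c"
  obtains c0 c0' where "\<And>x. x \<in> {0..1} \<Longrightarrow> c x = c0 x"
    "\<And>t. (c0 has_vector_derivative c0' t) (at t)" "continuous_on UNIV c0'" "\<And>t. c0' t \<noteq> (0::complex)"
    "\<And>t. c0 t \<in> path_image c0" "simple_path c0" "pathfinish c0 = pathstart c0"
proof -
  obtain F U where F: "open U" "sphere 0 1 \<subseteq> U" "F holomorphic_on U" "inj_on F U"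
    "\<forall>t\<in>{0..1}. c t = F (exp (2 * of_real pi * \<i> * of_real t))"
    using assms unfolding analytic_jordan_path_def by blast
  define e where "e t = exp (2 * of_real pi * \<i> * complex_of_real t)" for t
  have ec: "e = circlepath 0 1" by (rule ext) (simp add: e_def circlepath)
  have es: "e t \<in> sphere 0 1" for t by (simp add: e_def norm_exp_eq_Re)
  have eU: "e t \<in> U" for t using es F(2) by blast
  have ed: "(e has_vector_derivative 2 * of_real pi * \<i> * e t) (at t)" for t
    unfolding ec using has_vector_derivative_circlepath[of 0 1 t UNIV] by (simp add: circlepath)
  define c0 where "c0 = F \<circ> e"
  define c0' where "c0' t = (2 * of_real pi * \<i> * e t) * deriv F (e t)" for t
  have e_cont: "continuous_on UNIV e" unfolding e_def by (intro continuous_intros)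
  show ?thesis
  proof (rule that[of c0 c0'])
    show "c x = c0 x" if "x \<in> {0..1}" for x using F(5) that by (simp add: c0_def e_def)
    show "(c0 has_vector_derivative c0' t) (at t)" for t
      unfolding c0_def c0'_def
      by (rule field_vector_diff_chain_at[OF ed holomorphic_derivI[OF F(3,1) eU]])
    have "continuous_on UNIV (\<lambda>t. deriv F (e t))"
      by (rule continuous_on_compose2[OF holomorphic_on_imp_continuous_on[OF holomorphic_deriv[OF F(3,1)]] e_cont])
         (use eU in auto)
    then show "continuous_on UNIV c0'" unfolding c0'_def by (intro continuous_intros e_cont)
    show "c0' t \<noteq> 0" for t
      using holomorphic_injective_imp_regular[OF F(3,1,4) eU[of t]] by (simp add: c0'_def e_def)
    show "c0 t \<in> path_image c0" for t
    proof -
      have "e t \<in> path_image (circlepath 0 1)" using es by simp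
      then obtain x where "x \<in> {0..1}" "e t = e x" unfolding path_image_def ec by (elim imageE)
      then show ?thesis by (auto simp: c0_def path_image_def)
    qed
    show "simple_path c0" unfolding c0_def ec
    proof (rule simple_path_continuous_image)
      show "simple_path (circlepath 0 1)" by (simp add: simple_path_circlepath)
      show "continuous_on (path_image (circlepath 0 1)) F"
        by (rule continuous_on_subset[OF holomorphic_on_imp_continuous_on[OF F(3)]]) (use F(2) in simp)
      show "inj_on F (path_image (circlepath 0 1))"
        by (rule inj_on_subset[OF F(4)]) (use F(2) in simp)
    qed
    show "pathfinish c0 = pathstart c0"
      by (simp add: c0_def ec pathfinish_compose pathstart_compose)
  qed
qed

section \<open>The expansions in their final form\<close>

context szego_full
begin

text \<open>The relative error is \<open>\<xi> n - 1\<close>. As \<open>0 < \<xi> n \<le> 1\<close>,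
  its modulus is at most \<open>1 - (\<xi> n)^2\<close>, which \<open>xi_error\<close>
  controls.\<close>

lemma expansion_lc:
  assumes r: "s \<le> r"
  shows "\<exists>\<epsilon>. \<epsilon> \<in> O(\<lambda>n. r ^ (2 * n)) \<and> (\<forall>n. lc n = d * b powr (real n + 1 / 2) * (1 + \<epsilon> n))"
proof -
  obtain C where C: "0 < C" "\<And>n. 1 - (\<xi> n)\<^sup>2 \<le> C * s ^ (2 * n)"
    by (rule xi_error) (rule that)
  have "(\<lambda>n. \<xi> n - 1) \<in> O(\<lambda>n. r ^ (2 * n))"
  proof (rule bigoI[where c = C], rule always_eventually, rule allI)
    fix n
    have x: "0 < \<xi> n" "\<xi> n \<le> 1" by (rule xi_pos, rule xi_le_1)
    then have "(\<xi> n)\<^sup>2 \<le> \<xi> n" by (simp add: power2_eq_square mult_left_le)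
    then have "norm (\<xi> n - 1) \<le> 1 - (\<xi> n)\<^sup>2" using x by simp
    also have "\<dots> \<le> C * s ^ (2 * n)" by (rule C)
    also have "\<dots> \<le> C * r ^ (2 * n)"
      using C(1) s_bounds(1) r by (intro mult_left_mono power_mono) auto
    also have "\<dots> = C * norm (r ^ (2 * n))" by simp
    finally show "norm (\<xi> n - 1) \<le> C * norm (r ^ (2 * n))" .
  qed
  moreover have "lc n = d * b powr (real n + 1 / 2) * (1 + (\<xi> n - 1))" for n
    using kappa_pos[of n] by (simp add: kappa_powr[symmetric] \<xi>_def)
  ultimately show ?thesis by blast
qed

lemma closure_Om_psi:
  assumes "\<rho>' < r" "z \<in> closure (Om \<psi> r)"
  obtains w where "z = \<psi> w" "r \<le> norm w" "\<phi> z = w"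
proof -
  obtain w where w: "z = \<psi> w" "r \<le> norm w" using closure_Om[OF assms(1)] assms(2) by auto
  have "\<phi> z = w" unfolding w(1) by (rule phi_psi) (use w(2) assms(1) in simp)
  with w that show ?thesis by blast
qed

text \<open>The error is defined by solving the claimed identity for it, which is possible since
  \<open>q * \<phi> ^ n\<close> has no zeros; the identity then holds for all \<open>n\<close>. The
  rate obtained is \<open>s\<close>, and any \<open>r \<ge> s\<close> follows.\<close>

lemma expansion_exterior_additive:
  assumes r: "s \<le> r" and r1: "s' \<le> r1" "r1 \<le> t"
  shows "\<exists>\<epsilon>. uniform_bigo (closure (Om \<psi> r1)) \<epsilon> (\<lambda>n. r ^ n / r1 ^ n) \<and>
    (\<forall>n. \<forall>z\<in>closure (Om \<psi> r1).
      poly (smult (1 / of_real (lc n)) (p n)) z = q z * \<phi> z ^ n / of_real (d * b powr (real n + 1 / 2)) * (De z + \<epsilon> n z))"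
proof -
  have r0: "0 < r1" "\<rho>' < r1" using r1 s s_bounds by auto
  obtain C where C: "0 < C" "\<And>n w. r1 \<le> norm w \<Longrightarrow>
       norm (of_real (1 / \<xi> n) * poly (p n) (\<psi> w) / (q (\<psi> w) * w ^ n) - De (\<psi> w)) \<le> C * (s ^ n / r1 ^ n)"
    by (rule exterior_asymptotics[OF r1]) (rule that)
  define \<epsilon> where "\<epsilon> n z = of_real (1 / \<xi> n) * poly (p n) z / (q z * \<phi> z ^ n) - De z" for n z
  have "uniform_bigo (closure (Om \<psi> r1)) \<epsilon> (\<lambda>n. r ^ n / r1 ^ n)"
    unfolding uniform_bigo_def
  proof (rule exI[of _ C], rule always_eventually, intro allI ballI)
    fix n z assume "z \<in> closure (Om \<psi> r1)"
    then obtain w where w: "z = \<psi> w" "r1 \<le> norm w" "\<phi> z = w" by (rule closure_Om_psi[OF r0(2)])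
    have "norm (\<epsilon> n z) \<le> C * (s ^ n / r1 ^ n)" unfolding \<epsilon>_def w(3) unfolding w(1) by (rule C(2)[OF w(2)])
    also have "\<dots> \<le> C * (r ^ n / r1 ^ n)"
      using C(1) s_bounds(1) r r0 by (intro mult_left_mono divide_right_mono power_mono) auto
    finally show "norm (\<epsilon> n z) \<le> C * (r ^ n / r1 ^ n)" .
  qed
  moreover have "poly (smult (1 / of_real (lc n)) (p n)) z = q z * \<phi> z ^ n / of_real (d * b powr (real n + 1 / 2)) * (De z + \<epsilon> n z)"
    if z: "z \<in> closure (Om \<psi> r1)" for n z
  proof -
    obtain w where w: "z = \<psi> w" "r1 \<le> norm w" "\<phi> z = w" by (rule closure_Om_psi[OF r0(2) z])
    have zO: "z \<in> Om \<psi> \<rho>'" using w r0 by (auto simp: Om_def Ext_def)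
    define X where "X = q z * \<phi> z ^ n"
    have X: "X \<noteq> 0" using q_nz[OF zO] phi_nz[OF zO] by (simp add: X_def)
    have "De z + \<epsilon> n z = of_real (1 / \<xi> n) * poly (p n) z / X" by (simp add: \<epsilon>_def X_def)
    then have "X / of_real (\<kappa> n) * (De z + \<epsilon> n z) = of_real (1 / \<xi> n) * poly (p n) z / of_real (\<kappa> n)"
      using X by simp
    then have "q z * \<phi> z ^ n / of_real (\<kappa> n) * (De z + \<epsilon> n z) = of_real (1 / \<xi> n) * poly (p n) z / of_real (\<kappa> n)"
      unfolding X_def .
    also have "\<dots> = poly (smult (1 / of_real (lc n)) (p n)) z"
      using kappa_pos[of n] by (simp add: \<xi>_def)
    finally show ?thesis by (simp only: kappa_powr)
  qed
  ultimately show ?thesis by blast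
qed

text \<open>Near infinity \<open>norm (De z)\<close> exceeds \<open>d / 2\<close>; the remaining
  part of \<open>A\<close> is compact, and \<open>De\<close> is continuous without zeros on
  it.\<close>

lemma De_bounded_below:
  assumes A: "A \<subseteq> closure (Om \<psi> r1)" "closed A" "\<And>z. z \<in> A \<Longrightarrow> De z \<noteq> 0" and r1: "\<rho> < r1"
  obtains \<delta> where "0 < \<delta>" "\<And>z. z \<in> A \<Longrightarrow> \<delta> \<le> norm (De z)"
proof -
  have r0: "\<rho>' < r1" using r1 rho_ge by simp
  have AO: "A \<subseteq> Om \<psi> \<rho>"
  proof
    fix z assume "z \<in> A"
    then have "z \<in> closure (Om \<psi> r1)" using A(1) by auto
    then obtain w where "z = \<psi> w" "r1 \<le> norm w" "\<phi> z = w" by (rule closure_Om_psi[OF r0])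
    then show "z \<in> Om \<psi> \<rho>" using r1 by (auto simp: Om_def Ext_def)
  qed
  have "((\<lambda>z. norm (De z)) \<longlongrightarrow> norm (complex_of_real d)) at_infinity"
    by (intro tendsto_intros De_infinity)
  then have "eventually (\<lambda>z. d / 2 < norm (De z)) at_infinity"
    by (rule order_tendstoD) (use De_infinity(1) in simp)
  then obtain K where K: "\<And>z. K \<le> norm z \<Longrightarrow> d / 2 < norm (De z)"
    unfolding eventually_at_infinity by blast
  have comp: "compact (A \<inter> cball 0 K)" using A(2) by (simp add: closed_Int_compact)
  show ?thesis
  proof (cases "A \<inter> cball 0 K = {}")
    case True
    have "d / 2 \<le> norm (De z)" if "z \<in> A" for z
      using K[of z] True that by fastforce
    then show ?thesis using De_infinity(1) by (intro that[of "d / 2"]) auto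
  next
    case False
    have "continuous_on (A \<inter> cball 0 K) (\<lambda>z. norm (De z))"
      using AO by (intro continuous_intros continuous_on_subset[OF holomorphic_on_imp_continuous_on[OF De_hol]]) auto
    from continuous_attains_inf[OF comp False this]
    obtain x where x: "x \<in> A \<inter> cball 0 K" "\<forall>y\<in>A \<inter> cball 0 K. norm (De x) \<le> norm (De y)" by blast
    have "min (d / 2) (norm (De x)) \<le> norm (De z)" if "z \<in> A" for z
    proof (cases "K \<le> norm z")
      case True
      then show ?thesis using K[of z] by linarith
    next
      case False
      then have "z \<in> A \<inter> cball 0 K" using that by simp
      then show ?thesis using x(2) by (meson min.coboundedI2)
    qed
    then show ?thesis using De_infinity(1) A(3) x(1) by (intro that[of "min (d / 2) (norm (De x))"]) auto
  qed
qed

text \<open>With \<open>De\<close> bounded away from 0 on \<open>A\<close>, dividing the additive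
  error by \<open>De\<close> costs only a constant.\<close>

lemma expansion_exterior:
  assumes r: "s \<le> r" and r1: "s' \<le> r1" "r1 \<le> t"
    and A: "A \<subseteq> closure (Om \<psi> r1)" "closed A" "\<And>z. z \<in> A \<Longrightarrow> De z \<noteq> 0"
  shows "\<exists>\<epsilon>. uniform_bigo A \<epsilon> (\<lambda>n. r ^ n / r1 ^ n) \<and>
    (\<forall>n. \<forall>z\<in>A. poly (smult (1 / of_real (lc n)) (p n)) z
      = De z * q z * \<phi> z ^ n / of_real (d * b powr (real n + 1 / 2)) * (1 + \<epsilon> n z))"
proof -
  have r0: "0 < r1" "\<rho> < r1" "0 < r" using r1 r s s_bounds by auto
  obtain \<delta> where \<delta>: "0 < \<delta>" "\<And>z. z \<in> A \<Longrightarrow> \<delta> \<le> norm (De z)"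
    by (rule De_bounded_below[OF A(1,2) _ r0(2)], erule A(3), rule that)
  from expansion_exterior_additive[OF r r1] obtain \<epsilon> where
    \<epsilon>: "uniform_bigo (closure (Om \<psi> r1)) \<epsilon> (\<lambda>n. r ^ n / r1 ^ n)"
    "\<forall>n. \<forall>z\<in>closure (Om \<psi> r1).
      poly (smult (1 / of_real (lc n)) (p n)) z = q z * \<phi> z ^ n / of_real (d * b powr (real n + 1 / 2)) * (De z + \<epsilon> n z)"
    by (elim exE conjE)
  from \<epsilon>(1)[unfolded uniform_bigo_def] obtain C where
    C: "\<forall>\<^sub>F n in sequentially. \<forall>z\<in>closure (Om \<psi> r1). norm (\<epsilon> n z) \<le> C * (r ^ n / r1 ^ n)" by (elim exE)
  define \<eta> where "\<eta> n z = \<epsilon> n z / De z" for n z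
  have "\<forall>\<^sub>F n in sequentially. \<forall>z\<in>A. norm (\<eta> n z) \<le> C / \<delta> * (r ^ n / r1 ^ n)"
  proof (rule eventually_mono[OF C], rule ballI)
    fix n z assume n: "\<forall>z\<in>closure (Om \<psi> r1). norm (\<epsilon> n z) \<le> C * (r ^ n / r1 ^ n)" and z: "z \<in> A"
    have le: "norm (\<epsilon> n z) \<le> C * (r ^ n / r1 ^ n)" using n z A(1) by auto
    have "norm (\<eta> n z) = norm (\<epsilon> n z) / norm (De z)" by (simp add: \<eta>_def norm_divide)
    also have "\<dots> \<le> (C * (r ^ n / r1 ^ n)) / \<delta>"
      by (rule frac_le[OF order_trans[OF norm_ge_zero le] le \<delta>(1) \<delta>(2)[OF z]])
    finally show "norm (\<eta> n z) \<le> C / \<delta> * (r ^ n / r1 ^ n)" by (simp add: mult_ac)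
  qed
  then have "uniform_bigo A \<eta> (\<lambda>n. r ^ n / r1 ^ n)" unfolding uniform_bigo_def by (rule exI)
  moreover have "poly (smult (1 / of_real (lc n)) (p n)) z
      = De z * q z * \<phi> z ^ n / of_real (d * b powr (real n + 1 / 2)) * (1 + \<eta> n z)" if z: "z \<in> A" for n z
  proof -
    have "De z + \<epsilon> n z = De z * (1 + \<eta> n z)" using A(3)[OF z] by (simp add: \<eta>_def distrib_left)
    moreover have "poly (smult (1 / of_real (lc n)) (p n)) z
        = q z * \<phi> z ^ n / of_real (d * b powr (real n + 1 / 2)) * (De z + \<epsilon> n z)" using \<epsilon>(2) z A(1) by blast
    ultimately show ?thesis by (simp add: mult_ac)
  qed
  ultimately show ?thesis by blast
qed

lemma expansion_interior:
  assumes r: "s \<le> r" and r1: "s' \<le> r1" "r1 < 1"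
  shows "\<exists>\<epsilon>. uniform_bigo (closure (Gd \<psi> r1)) \<epsilon> (\<lambda>n. r1 ^ n * r ^ (2 * n)) \<and>
    (\<forall>n. \<forall>z\<in>closure (Gd \<psi> r1).
      of_real d * poly (smult (1 / of_real (lc n)) (p n)) z / of_real (b powr (- real n - 1 / 2))
      = inverse (Di z) / (2 * of_real pi * \<i>)
          * contour_integral c (\<lambda>\<zeta>. De \<zeta> * Di \<zeta> * W_kernel f qf \<zeta> z * q \<zeta> * \<phi> \<zeta> ^ n) + \<epsilon> n z)"
proof -
  have r0: "0 < r1" "\<rho>' \<le> r1" using r1 s s_bounds by auto
  obtain C where C: "0 < C"
    "\<And>n z. z \<notin> Om \<psi> r1 \<Longrightarrow> norm (of_real (1 / \<xi> n) * poly (p n) z - transform (B n) z) \<le> C * (r1 ^ n * s ^ (2 * n))"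
    by (rule interior_asymptotics[OF r1]) (rule that)
  define \<epsilon> where "\<epsilon> n z = of_real (1 / \<xi> n) * poly (p n) z - transform (B n) z" for n z
  have notin: "z \<notin> Om \<psi> r1" if "z \<in> closure (Gd \<psi> r1)" for z
  proof -
    have "closure (Gd \<psi> r1) \<subseteq> - Om \<psi> r1"
      using open_Om[OF r0(2)] closure_subset[of "Om \<psi> r1"] unfolding Gd_def by (intro closure_minimal) auto
    then show ?thesis using that by auto
  qed
  have "uniform_bigo (closure (Gd \<psi> r1)) \<epsilon> (\<lambda>n. r1 ^ n * r ^ (2 * n))"
    unfolding uniform_bigo_def
  proof (rule exI[of _ C], rule always_eventually, intro allI ballI)
    fix n z assume "z \<in> closure (Gd \<psi> r1)"
    then have "norm (\<epsilon> n z) \<le> C * (r1 ^ n * s ^ (2 * n))" unfolding \<epsilon>_def by (rule C(2)[OF notin])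
    also have "\<dots> \<le> C * (r1 ^ n * r ^ (2 * n))"
      using C(1) s_bounds(1) r r0 by (intro mult_left_mono power_mono) auto
    finally show "norm (\<epsilon> n z) \<le> C * (r1 ^ n * r ^ (2 * n))" .
  qed
  moreover have "of_real d * poly (smult (1 / of_real (lc n)) (p n)) z / of_real (b powr (- real n - 1 / 2))
      = inverse (Di z) / (2 * of_real pi * \<i>)
          * contour_integral c (\<lambda>\<zeta>. De \<zeta> * Di \<zeta> * W_kernel f qf \<zeta> z * q \<zeta> * \<phi> \<zeta> ^ n) + \<epsilon> n z" for n z
  proof -
    \<comment> \<open>The negative exponent in the denominator makes the left side of the formula
      \<open>\<kappa> n\<close> times the monic polynomial, that is
      \<open>p n / \<xi> n\<close>.\<close>
    have "d / b powr (- real n - 1 / 2) = \<kappa> n"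
    proof -
      have "- real n - 1 / 2 = - (real n + 1 / 2)" by simp
      then show ?thesis unfolding kappa_powr by (simp only: powr_minus_divide) simp
    qed
    then have "complex_of_real (d / b powr (- real n - 1 / 2)) = of_real (\<kappa> n)" by (rule arg_cong)
    then have "of_real d * poly (smult (1 / of_real (lc n)) (p n)) z / of_real (b powr (- real n - 1 / 2))
        = of_real (\<kappa> n) * poly (smult (1 / of_real (lc n)) (p n)) z"
      by (simp only: of_real_divide times_divide_eq_left[symmetric])
    also have "\<dots> = of_real (1 / \<xi> n) * poly (p n) z" by (simp add: \<xi>_def)
    also have "\<dots> = transform (B n) z + \<epsilon> n z" by (simp add: \<epsilon>_def)
    also have "transform (B n) z = inverse (Di z) / (2 * of_real pi * \<i>)
          * contour_integral c (\<lambda>\<zeta>. De \<zeta> * Di \<zeta> * W_kernel f qf \<zeta> z * q \<zeta> * \<phi> \<zeta> ^ n)"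
      unfolding transform_def by (rule arg_cong[OF contour_integral_eq]) (simp add: B_def mult_ac)
    finally show ?thesis .
  qed
  ultimately show ?thesis by blast
qed

end

section \<open>Choice of the levels and transfer to the given curve\<close>

theorem corollary1p4:
  fixes c :: "real \<Rightarrow> complex"
    and h \<psi> \<phi> q\<phi> De Di f q\<^sub>f :: "complex \<Rightarrow> complex"
    and p P :: "nat \<Rightarrow> complex poly"
    and lc :: "nat \<Rightarrow> real"
    and \<rho>' \<rho> r\<^sub>1 r d b :: real
  assumes curve: "analytic_jordan_path c" "positively_oriented c"
    and weight: "positive_analytic_weight c h"
    and polys: "orthonormal_polys c h p lc"
    and monic: "\<And>n. P n = smult (1 / of_real (lc n)) (p n)"
    and psi: "exterior_map c \<psi>" "univalence_radius \<psi> \<rho>'"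
    and phi: "\<phi> = phi \<psi> \<rho>'" "b = value_at_inf (deriv \<phi>)"
    and sqrt_phi: "sqrt_dphi \<psi> \<rho>' q\<phi>"
    and De: "exterior_szego c h \<psi> De" "szego_radius \<psi> \<rho>' De \<rho>" "d = value_at_inf De"
    and Di: "interior_szego c h \<psi> Di"
    and kernel: "interior_map \<psi> \<rho>' f q\<^sub>f"
    and r1: "\<rho> < r\<^sub>1" "\<rho> > 0 \<longrightarrow> r\<^sub>1 < 1 / \<rho>"
    and r: "\<rho> < r"
  shows
    "(\<exists>\<epsilon>. \<epsilon> \<in> O(\<lambda>n. r ^ (2 * n)) \<and>
          (\<forall>n. lc n = d * b powr (real n + 1 / 2) * (1 + \<epsilon> n)))
     \<and>
     (\<exists>\<epsilon>. uniform_bigo (closure (Om \<psi> r\<^sub>1)) \<epsilon> (\<lambda>n. r ^ n / r\<^sub>1 ^ n) \<and>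
          (\<forall>n. \<forall>z\<in>closure (Om \<psi> r\<^sub>1).
             poly (P n) z = q\<phi> z * \<phi> z ^ n / of_real (d * b powr (real n + 1 / 2))
                              * (De z + \<epsilon> n z)))
     \<and>
     (\<forall>A. A \<subseteq> closure (Om \<psi> r\<^sub>1) \<and> closed A \<and> (\<forall>z\<in>A. De z \<noteq> 0) \<longrightarrow>
        (\<exists>\<epsilon>. uniform_bigo A \<epsilon> (\<lambda>n. r ^ n / r\<^sub>1 ^ n) \<and>
          (\<forall>n. \<forall>z\<in>A.
             poly (P n) z = De z * q\<phi> z * \<phi> z ^ n / of_real (d * b powr (real n + 1 / 2))
                              * (1 + \<epsilon> n z))))
     \<and>
     (r\<^sub>1 < 1 \<longrightarrow>
        (\<exists>\<epsilon>. uniform_bigo (closure (Gd \<psi> r\<^sub>1)) \<epsilon> (\<lambda>n. r\<^sub>1 ^ n * r ^ (2 * n)) \<and>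
          (\<forall>n. \<forall>z\<in>closure (Gd \<psi> r\<^sub>1).
             of_real d * poly (P n) z / of_real (b powr (- real n - 1 / 2))
             = inverse (Di z) / (2 * of_real pi * \<i>)
                 * contour_integral c (\<lambda>\<zeta>. De \<zeta> * Di \<zeta> * W_kernel f q\<^sub>f \<zeta> z * q\<phi> \<zeta> * \<phi> \<zeta> ^ n)
               + \<epsilon> n z)))"
proof -
  have rho: "0 \<le> \<rho>'" "\<rho>' \<le> \<rho>" using psi(2) De(2) by (auto simp: univalence_radius_def szego_radius_def)
  have r1': "0 < r\<^sub>1" "0 < r" using rho r1 r by auto
  have rr: "\<rho> * r\<^sub>1 < 1"
  proof (cases "\<rho> = 0")
    case False
    then show ?thesis using rho r1 by (simp add: field_simps)
  qed simp
  \<comment> \<open>For \<open>\<rho> \<noteq> 0\<close> the range of \<open>r\<^sub>1\<close>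
    forces this: \<open>\<rho> * \<rho> < \<rho> * r\<^sub>1 < 1\<close>.\<close>
  have rho1: "\<rho> < 1"
  proof (cases "\<rho> = 0")
    case False
    then have "\<rho> * \<rho> < \<rho> * r\<^sub>1" using rho r1(1) by (intro mult_strict_left_mono) auto
    then have "\<rho> * \<rho> < 1" using rr by simp
    then show ?thesis using rho by (metis abs_of_nonneg abs_square_less_1 order_trans power2_eq_square)
  qed simp
  \<comment> \<open>The given \<open>c\<close> is determined only on the unit interval; all data in
    the hypotheses depend on it through that interval and carry over to \<open>c0\<close>.\<close>
  obtain c0 c0' where c0: "\<And>x. x \<in> {0..1} \<Longrightarrow> c x = c0 x"
    "\<And>t. (c0 has_vector_derivative c0' t) (at t)" "continuous_on UNIV c0'" "\<And>t. c0' t \<noteq> 0"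
    "\<And>t. c0 t \<in> path_image c0" "simple_path c0" "pathfinish c0 = pathstart c0"
    by (rule analytic_jordan_path_parametrization[OF curve(1)]) (rule that)
  have img: "path_image c0 = path_image c" unfolding path_image_def using c0(1) by (intro image_cong) auto
  have wind: "winding_number c0 z = winding_number c z" for z
    by (rule winding_number_cong) (use c0(1) in auto)
  have arc: "arclength_integral c0 u = arclength_integral c u" for u
    unfolding arclength_integral_def
    by (rule integral_cong) (use c0(1) vector_derivative_within_cong[of "{0..1}" c c0] in auto)
  have cint: "contour_integral c0 u = contour_integral c u" for u
    by (rule contour_integral_path_cong) (use c0(1) in auto)
  \<comment> \<open>The level \<open>t\<close> must exceed 1 and reach \<open>r\<^sub>1\<close>,
    while \<open>s * t < 1\<close> for some \<open>s > \<rho>\<close>. Since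
    \<open>\<rho> * m < 1\<close>, there is room for \<open>s\<close> between \<open>\<rho>\<close>
    and \<open>1 / m\<close>, and then for \<open>t\<close> between \<open>m\<close> and
    \<open>1 / s\<close>.\<close>
  define m where "m = max 1 r\<^sub>1"
  have m: "1 \<le> m" "r\<^sub>1 \<le> m" "\<rho> * m < 1" using rho1 rr by (auto simp: m_def max_def)
  then have "\<rho> < 1 / m" by (simp add: pos_less_divide_eq)
  then have "\<rho> < min (min r r\<^sub>1) (1 / m)" using r r1 by simp
  then obtain s where s: "\<rho> < s" "s < min (min r r\<^sub>1) (1 / m)" using dense by blast
  have "1 / m \<le> 1" using m by simp
  then have s1: "s < 1" "s < r\<^sub>1" "s < r" "s < 1 / m" "0 < s" using s rho by auto
  \<comment> \<open>\<open>s'\<close> has to stay below 1, so that the curve lies in the region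
    where \<open>R n\<close> is bounded, and below \<open>r\<^sub>1\<close>, so that the required
    level does too.\<close>
  then obtain s' where s': "s < s'" "s' < min 1 r\<^sub>1" using dense[of s "min 1 r\<^sub>1"] by auto
  have "m < 1 / s" using s1 m by (simp add: field_simps)
  then obtain t where t: "m < t" "t < 1 / s" using dense by blast
  have st: "s * t < 1" using t(2) s1 by (simp add: field_simps)
  have le: "s \<le> r" "s' \<le> r\<^sub>1" "r\<^sub>1 \<le> t" using s1 s' t m by auto
  interpret szego_full c0 c0' h \<psi> \<phi> q\<phi> De p lc \<rho>' \<rho> b d s s' t Di f q\<^sub>f
  proof unfold_locales
    show "h z \<in> \<real> \<and> 0 < Re (h z)" if "z \<in> path_image c0" for z
      using weight that by (simp add: img positive_analytic_weight_def)
    show "positively_oriented c0" using curve(2) by (simp add: positively_oriented_def img wind)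
    show "orthonormal_polys c0 h p lc" using polys unfolding orthonormal_polys_def arc .
    show "exterior_map c0 \<psi>" using psi(1) by (simp add: exterior_map_def img)
    show "\<psi> holomorphic_on Ext \<rho>'" "inj_on \<psi> (Ext \<rho>')" using psi(2) by (auto simp: univalence_radius_def)
    show "exterior_szego c0 h \<psi> De" using De(1) by (simp add: exterior_szego_def img)
    show "De holomorphic_on Om \<psi> \<rho>" using De(2) by (simp add: szego_radius_def)
    show "interior_szego c0 h \<psi> Di" using Di by (simp add: interior_szego_def img)
  qed (use c0 rho rho1 phi De sqrt_phi kernel s s' t m st in auto)
  show ?thesis
    unfolding monic cint[symmetric]
    by (intro conjI allI impI expansion_lc[OF le(1)] expansion_exterior_additive[OF le]
        expansion_exterior[OF le] expansion_interior[OF le(1,2)]) auto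
qed

end
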